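(* Let $p$ be a prime, $k\ge 0$ an even integer and $\Gamma=\Gamma^{(p)}_{N^+,N^-}$ (the group of reduced-norm-one units of a $\mathbb{Z}[1/p]$-Eichler order in a definite rational quaternion algebra, see context). The restriction of the specialization map $$\rho\colon \mathcal{A}_k(\Gamma)^{U_p=p^{k/2}}\longrightarrow \mathbb{A}_k(\Gamma)^{U_p=p^{k/2}}$$ is an isomorphism. Here the superscript $U_p=p^{k/2}$ denotes the subspace of all elements $\Phi$ with $U_p\Phi=p^{k/2}\Phi$.
   Context: Let $B$ be a definite quaternion algebra over $\mathbb{Q}$ of discriminant $N^-$ coprime to $p$, $N^+$ a positive integer coprime to $pN^-$, $R\subset B$ an Eichler $\mathbb{Z}$-order of level $N^+$, and $\Gamma=R[1/p]^\times_1$ the group of elements of reduced norm $1$ in $R[1/p]$. Fix a splitting $\iota\colon B\otimes_{\mathbb{Q}}\mathbb{Q}_p\to \mathrm{M}_2(\mathbb{Q}_p)$ with $\iota(R\otimes_{\mathbb{Z}}\mathbb{Z}_p)=\mathrm{M}_2(\mathbb{Z}_p)$ and regard $\Gamma$ as a subgroup of $\mathrm{SL}_2(\mathbb{Q}_p)$ via $\iota$. Let $\Gamma_0(p\mathbb{Z}_p)=\{\begin{pmatrix}a&b\\c&d\end{pmatrix}\in \mathrm{GL}_2(\mathbb{Z}_p): p\mid c\}$ and $\Sigma_0(p)=\{\begin{pmatrix}a&b\\c&d\end{pmatrix}\in \mathrm{M}_2(\mathbb{Z}_p): p\mid c,\ a\in\mathbb{Z}_p^\times,\ ad-bc\ne0\}$,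 so $\Gamma_0(p\mathbb{Z}_p)\subset\Sigma_0(p)$. $\mathcal{P}_k\subset\mathbb{Q}_p[x]$ is the space of polynomials of degree $\le k$ with right action of $\mathrm{GL}_2(\mathbb{Q}_p)$ given by $(P\cdot_k g)(x)=\det(g)^{-k/2}(cx+d)^kP\left(\frac{ax+b}{cx+d}\right)$ for $g=\begin{pmatrix}a&b\\c&d\end{pmatrix}$, regarded also as a left module by $g\cdot_kP=P\cdot_kg^{-1}$. $V_k=\mathrm{Hom}_{\mathbb{Q}_p}(\mathcal{P}_k,\mathbb{Q}_p)$ carries the right action $(\omega\cdot_k g)(P)=\omega(g\cdot_k P)$. $\mathbb{T}_k$ is the Tate algebra $\{\sum_{n\ge0}a_nx^n\in\mathbb{Q}_p[[x]]: a_n\to0\}$ with the sup-norm and left action of $\mathbb{Q}_p^\times\Sigma_0(p)$: for $u\in\mathbb{Q}_p^\times$, $\sigma=\begin{pmatrix}a&b\\c&d\end{pmatrix}\in\Sigma_0(p)$, $(u\sigma\cdot_kf)(x)=\det(\sigma)^{-k/2}(-cx+a)^kf\left(\frac{dx-b}{-cx+a}\right)$. $\mathbb{D}_k=\mathrm{Hom}_{\mathrm{cont}}(\mathbb{T}_k,\mathbb{Q}_p)$ with induced right action $(\omega\cdot_k s)(f)=\omega(s\cdot_kf)$. Dual to the inclusion $\mathcal{P}_k\subset\mathbb{T}_k$ is the equivariant surjection $\pi\colon\mathbb{D}_k\to V_k$. For a module $V$ with right action of $\Gamma_0(p\mathbb{Z}_p)$, $\mathbb{A}(\Gamma,V)$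 is the space of maps $\phi\colon\mathrm{GL}_2(\mathbb{Q}_p)\to V$ with $\phi(u\gamma g\sigma)=\phi(g)\cdot\sigma$ for all $u\in\mathbb{Q}_p^\times$, $\gamma\in\Gamma$, $\sigma\in\Gamma_0(p\mathbb{Z}_p)$, $g\in\mathrm{GL}_2(\mathbb{Q}_p)$. Put $\mathbb{A}_k(\Gamma)=\mathbb{A}(\Gamma,V_k)$ and $\mathcal{A}_k(\Gamma)=\mathbb{A}(\Gamma,\mathbb{D}_k)$. The specialization map $\rho\colon\mathcal{A}_k(\Gamma)\to\mathbb{A}_k(\Gamma)$ is $\rho(\Phi)(g)=\pi(\Phi(g))$. With $\alpha_j=\begin{pmatrix}p&j\\0&1\end{pmatrix}$, $j=0,\dots,p-1$ (note $\alpha_j^{-1}\in\mathbb{Q}_p^\times\Sigma_0(p)$), the operator $U_p$ on $\mathcal{A}_k(\Gamma)$, and likewise on $\mathbb{A}_k(\Gamma)$, is $(U_p\Phi)(g)=p^{k/2}\sum_{j=0}^{p-1}\Phi(g\alpha_j)\cdot_k\alpha_j^{-1}$. *)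

theory Defs
  imports
    "HOL-Algebra.QuotRing"
    "HOL-Algebra.Subrings"
    "HOL-Library.Function_Algebras"
    "Berlekamp_Zassenhaus.Finite_Field"
    "HOL-Computational_Algebra.Computational_Algebra"
    "HOL-Analysis.Analysis"
begin

section \<open>The field of p-adic numbers\<close>

text \<open>
  \<open>\<rat>\<^sub>p\<close> is the completion of \<open>\<rat>\<close>: Cauchy sequences modulo null sequences. It is first built as a ring
  record depending on the natural number \<open>p\<close>, because the discriminant of a quaternion algebra
  involves all primes at once; the type \<open>'p padic\<close>, with \<open>p = CARD('p)\<close>, is the same field as an
  instance of the algebraic and metric type classes.
\<close>

definition padic_val :: "nat \<Rightarrow> rat \<Rightarrow> int" where
  "padic_val p x = (case quotient_of x of (n, d) \<Rightarrow>
     int (multiplicity (int p) n) - int (multiplicity (int p) d))"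

definition padic_abs :: "nat \<Rightarrow> rat \<Rightarrow> real" where
  "padic_abs p x = (if x = 0 then 0 else real p powi (- padic_val p x))"

definition padic_cauchy :: "nat \<Rightarrow> (nat \<Rightarrow> rat) \<Rightarrow> bool" where
  "padic_cauchy p X \<longleftrightarrow> (\<forall>e>0. \<exists>N. \<forall>m\<ge>N. \<forall>n\<ge>N. padic_abs p (X m - X n) < e)"

definition padic_cauchy_ring :: "nat \<Rightarrow> (nat \<Rightarrow> rat) ring" where
  "padic_cauchy_ring p = \<lparr>carrier = {X. padic_cauchy p X},
     monoid.mult = (\<lambda>X Y n. X n * Y n), one = (\<lambda>n. 1), ring.zero = (\<lambda>n. 0), ring.add = (\<lambda>X Y n. X n + Y n)\<rparr>"

definition padic_null :: "nat \<Rightarrow> (nat \<Rightarrow> rat) set" where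
  "padic_null p = {X. (\<lambda>n. padic_abs p (X n)) \<longlonglongrightarrow> 0}"

definition padic_field :: "nat \<Rightarrow> (nat \<Rightarrow> rat) set ring" where
  "padic_field p = padic_cauchy_ring p Quot padic_null p"

definition padic_const :: "nat \<Rightarrow> rat \<Rightarrow> (nat \<Rightarrow> rat) set" where
  "padic_const p x = padic_null p +>\<^bsub>padic_cauchy_ring p\<^esub> (\<lambda>n. x)"

context
  fixes p :: nat
  assumes p: "prime p"
begin

lemma padic_val_frac:
  assumes "n \<noteq> 0" "d \<noteq> 0"
  shows "padic_val p (of_int n / of_int d) = int (multiplicity (int p) n) - int (multiplicity (int p) d)"
proof -
  obtain n' d' where q: "quotient_of (of_int n / of_int d) = (n', d')" by force
  have d': "d' > 0" using quotient_of_denom_pos[OF q] .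
  have eq: "(of_int n / of_int d :: rat) = of_int n' / of_int d'" using quotient_of_div[OF q] .
  have n': "n' \<noteq> 0" using eq assms d' by auto
  have "(of_int (n * d') :: rat) = of_int (n' * d)" using eq assms d' by (simp add: field_simps)
  hence e: "n * d' = n' * d" using of_int_eq_iff by blast
  have pe: "prime_elem (int p)" using p by (simp add: prime_imp_prime_elem)
  have "multiplicity (int p) n + multiplicity (int p) d' = multiplicity (int p) n' + multiplicity (int p) d"
    using prime_elem_multiplicity_mult_distrib[OF pe, of n d'] prime_elem_multiplicity_mult_distrib[OF pe, of n' d]
      e assms n' d' by simp
  thus ?thesis using q by (simp add: padic_val_def)
qed

lemma rat_fracE:
  fixes x :: rat
  obtains n d where "x = of_int n / of_int d" "d > 0"
proof -
  obtain n d where q: "quotient_of x = (n, d)" by force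
  show thesis by (rule that[OF quotient_of_div[OF q] quotient_of_denom_pos[OF q]])
qed

lemma padic_val_mult:
  assumes "x \<noteq> 0" "y \<noteq> 0"
  shows "padic_val p (x * y) = padic_val p x + padic_val p y"
proof -
  obtain n d where x: "x = of_int n / of_int d" "d > 0" by (rule rat_fracE)
  obtain m e where y: "y = of_int m / of_int e" "e > 0" by (rule rat_fracE)
  have nz: "n \<noteq> 0" "m \<noteq> 0" "d \<noteq> 0" "e \<noteq> 0"
    using assms(1,2) x y by fastforce+
  have xy: "x * y = of_int (n * m) / of_int (d * e)" using x y by simp
  have pe: "prime_elem (int p)" using p by (simp add: prime_imp_prime_elem)
  show ?thesis unfolding xy using nz
    by (subst padic_val_frac)
      (auto simp: x y padic_val_frac prime_elem_multiplicity_mult_distrib[OF pe])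
qed

lemma p_gt: "real p > 1" using prime_gt_1_nat[OF p] by simp

lemma padic_abs_0 [simp]: "padic_abs p 0 = 0" by (simp add: padic_abs_def)

lemma padic_abs_nonneg [simp]: "padic_abs p x \<ge> 0" by (simp add: padic_abs_def)

lemma padic_abs_pos: "x \<noteq> 0 \<Longrightarrow> padic_abs p x > 0"
  using p_gt by (simp add: padic_abs_def)

lemma padic_abs_mult: "padic_abs p (x * y) = padic_abs p x * padic_abs p y"
proof (cases "x = 0 \<or> y = 0")
  case False
  hence "- padic_val p (x * y) = - padic_val p x + - padic_val p y" by (simp add: padic_val_mult)
  hence "real p powi (- padic_val p (x * y)) = real p powi (- padic_val p x) * real p powi (- padic_val p y)"
    using p_gt power_int_add[of "real p" "- padic_val p x" "- padic_val p y"] by simp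
  thus ?thesis using False by (simp add: padic_abs_def)
qed auto

lemma padic_abs_1 [simp]: "padic_abs p 1 = 1"
proof -
  have "padic_abs p 1 = padic_abs p 1 * padic_abs p 1" using padic_abs_mult[of 1 1] by simp
  thus ?thesis using padic_abs_pos[of 1] by simp
qed

lemma padic_abs_minus [simp]: "padic_abs p (- x) = padic_abs p x"
proof -
  have "padic_abs p (-1) * padic_abs p (-1) = 1" using padic_abs_mult[of "-1" "-1"] by simp
  hence "padic_abs p (-1) = 1"
    using padic_abs_nonneg[of "-1"] by (auto simp: square_eq_1_iff)
  thus ?thesis using padic_abs_mult[of "-1" x] by simp
qed

lemma padic_abs_diff_commute: "padic_abs p (x - y) = padic_abs p (y - x)"
  using padic_abs_minus[of "x - y"] by simp

lemma padic_abs_inverse: "padic_abs p (inverse x) = inverse (padic_abs p x)"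
proof (cases "x = 0")
  case False
  have "padic_abs p x * padic_abs p (inverse x) = 1" using False padic_abs_mult[of x "inverse x"] by simp
  thus ?thesis by (rule inverse_unique[symmetric])
qed simp

lemma padic_val_add_aux:
  fixes x y :: rat
  assumes "x \<noteq> 0" "y \<noteq> 0" "x + y \<noteq> 0"
  shows "padic_val p (x + y) \<ge> min (padic_val p x) (padic_val p y)"
proof -
  obtain n d where x: "x = of_int n / of_int d" "d > 0" by (rule rat_fracE)
  obtain m e where y: "y = of_int m / of_int e" "e > 0" by (rule rat_fracE)
  have nz: "n \<noteq> 0" "m \<noteq> 0" "d \<noteq> 0" "e \<noteq> 0"
    using assms(1,2) x y by fastforce+
  have X: "x = of_int (n * e) / of_int (d * e)" and Y: "y = of_int (m * d) / of_int (d * e)"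
    using nz x(1) y(1) by (simp_all only: of_int_mult nonzero_mult_divide_mult_cancel_right nonzero_mult_divide_mult_cancel_right2 of_int_eq_0_iff not_False_eq_True mult.commute[of "of_int d" "of_int e"])
  have S: "x + y = of_int (n * e + m * d) / of_int (d * e)"
    unfolding X Y by (simp only: of_int_add add_divide_distrib)
  have s0: "n * e + m * d \<noteq> 0"
  proof
    assume "n * e + m * d = 0"
    hence "x + y = 0" unfolding S by (simp only: of_int_0 div_0)
    thus False using assms by simp
  qed
  let ?M = "multiplicity (int p)"
  let ?k = "min (?M (n * e)) (?M (m * d))"
  have "int p ^ ?k dvd n * e" "int p ^ ?k dvd m * d"
    by (auto intro: multiplicity_dvd')
  hence "int p ^ ?k dvd n * e + m * d" by simp
  hence "?k \<le> ?M (n * e + m * d)"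
    using s0 p by (intro multiplicity_geI) (auto dest: prime_gt_1_nat)
  moreover have "padic_val p x = int (?M (n * e)) - int (?M (d * e))"
    unfolding X using nz by (intro padic_val_frac) simp_all
  moreover have "padic_val p y = int (?M (m * d)) - int (?M (d * e))"
    unfolding Y using nz by (intro padic_val_frac) simp_all
  moreover have "padic_val p (x + y) = int (?M (n * e + m * d)) - int (?M (d * e))"
    unfolding S using nz s0 by (intro padic_val_frac) simp_all
  ultimately show ?thesis by linarith
qed

lemma padic_abs_add: "padic_abs p (x + y) \<le> max (padic_abs p x) (padic_abs p y)"
proof (cases "x = 0 \<or> y = 0 \<or> x + y = 0")
  case True
  thus ?thesis by (auto simp: le_max_iff_disj)
next
  case False
  hence "- padic_val p (x + y) \<le> - padic_val p x \<or> - padic_val p (x + y) \<le> - padic_val p y"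
    using padic_val_add_aux[of x y] by linarith
  thus ?thesis using False p_gt by (auto simp: padic_abs_def le_max_iff_disj intro!: power_int_increasing)
qed

lemma padic_abs_triangle: "padic_abs p (x + y) \<le> padic_abs p x + padic_abs p y"
  using padic_abs_add[of x y] padic_abs_nonneg[of x] padic_abs_nonneg[of y] by linarith

lemma padic_abs_diff_abs: "\<bar>padic_abs p x - padic_abs p y\<bar> \<le> padic_abs p (x - y)"
  using padic_abs_triangle[of "x - y" y] padic_abs_triangle[of "y - x" x]
    padic_abs_diff_commute[of x y] by simp

lemma padic_cauchy_abs_Cauchy:
  assumes "padic_cauchy p X"
  shows "convergent (\<lambda>n. padic_abs p (X n))"
proof (rule Cauchy_convergent, rule metric_CauchyI)
  fix e :: real assume "e > 0"
  then obtain N where "\<forall>m\<ge>N. \<forall>n\<ge>N. padic_abs p (X m - X n) < e"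
    using assms unfolding padic_cauchy_def by blast
  thus "\<exists>M. \<forall>m\<ge>M. \<forall>n\<ge>M. dist (padic_abs p (X m)) (padic_abs p (X n)) < e"
    unfolding dist_real_def by (intro exI[of _ N] allI impI le_less_trans[OF padic_abs_diff_abs]) auto
qed

lemma padic_cauchy_bounded:
  assumes "padic_cauchy p X"
  obtains K where "K > 0" "\<And>n. padic_abs p (X n) \<le> K"
  using convergent_imp_Bseq[OF padic_cauchy_abs_Cauchy[OF assms]]
  by (auto simp: Bseq_def)

lemma padic_cauchy_const: "padic_cauchy p (\<lambda>n. x)"
  by (auto simp: padic_cauchy_def)

lemma padic_cauchy_add:
  assumes "padic_cauchy p X" "padic_cauchy p Y"
  shows "padic_cauchy p (\<lambda>n. X n + Y n)"
  unfolding padic_cauchy_def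
proof safe
  fix e :: real assume e: "e > 0"
  obtain N where N: "\<forall>m\<ge>N. \<forall>n\<ge>N. padic_abs p (X m - X n) < e"
    using assms(1) e unfolding padic_cauchy_def by blast
  obtain M where M: "\<forall>m\<ge>M. \<forall>n\<ge>M. padic_abs p (Y m - Y n) < e"
    using assms(2) e unfolding padic_cauchy_def by blast
  show "\<exists>N. \<forall>m\<ge>N. \<forall>n\<ge>N. padic_abs p (X m + Y m - (X n + Y n)) < e"
  proof (intro exI[of _ "max N M"] allI impI)
    fix m n assume "max N M \<le> m" "max N M \<le> n"
    hence "padic_abs p (X m - X n) < e" "padic_abs p (Y m - Y n) < e" using N M by auto
    moreover have "padic_abs p (X m + Y m - (X n + Y n)) \<le> max (padic_abs p (X m - X n)) (padic_abs p (Y m - Y n))"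
      using padic_abs_add[of "X m - X n" "Y m - Y n"] by (simp add: algebra_simps)
    ultimately show "padic_abs p (X m + Y m - (X n + Y n)) < e" by linarith
  qed
qed

lemma padic_cauchy_minus:
  "padic_cauchy p X \<Longrightarrow> padic_cauchy p (\<lambda>n. - X n)"
  unfolding padic_cauchy_def using padic_abs_diff_commute by simp

lemma padic_cauchy_mult:
  assumes "padic_cauchy p X" "padic_cauchy p Y"
  shows "padic_cauchy p (\<lambda>n. X n * Y n)"
  unfolding padic_cauchy_def
proof safe
  fix e :: real assume e: "e > 0"
  obtain K where K: "K > 0" "\<And>n. padic_abs p (X n) \<le> K" by (rule padic_cauchy_bounded[OF assms(1)]) blast
  obtain L where L: "L > 0" "\<And>n. padic_abs p (Y n) \<le> L" by (rule padic_cauchy_bounded[OF assms(2)]) blast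
  obtain N where N: "\<forall>m\<ge>N. \<forall>n\<ge>N. padic_abs p (X m - X n) < e / L"
    using assms(1) e L(1) unfolding padic_cauchy_def by (meson divide_pos_pos)
  obtain M where M: "\<forall>m\<ge>M. \<forall>n\<ge>M. padic_abs p (Y m - Y n) < e / K"
    using assms(2) e K(1) unfolding padic_cauchy_def by (meson divide_pos_pos)
  show "\<exists>N. \<forall>m\<ge>N. \<forall>n\<ge>N. padic_abs p (X m * Y m - X n * Y n) < e"
  proof (intro exI[of _ "max N M"] allI impI)
    fix m n assume "max N M \<le> m" "max N M \<le> n"
    hence a: "padic_abs p (X m - X n) < e / L" and b: "padic_abs p (Y m - Y n) < e / K" using N M by auto
    have "padic_abs p (X m - X n) * padic_abs p (Y m) \<le> padic_abs p (X m - X n) * L"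
      by (intro mult_left_mono L) simp
    also have "\<dots> < e" using a L(1) by (simp add: field_simps)
    finally have 1: "padic_abs p ((X m - X n) * Y m) < e" by (simp add: padic_abs_mult)
    have "padic_abs p (X n) * padic_abs p (Y m - Y n) \<le> K * padic_abs p (Y m - Y n)"
      by (intro mult_right_mono K) simp
    also have "\<dots> < e" using b K(1) by (simp add: field_simps)
    finally have 2: "padic_abs p (X n * (Y m - Y n)) < e" by (simp add: padic_abs_mult)
    have "X m * Y m - X n * Y n = (X m - X n) * Y m + X n * (Y m - Y n)" by (simp add: algebra_simps)
    thus "padic_abs p (X m * Y m - X n * Y n) < e"
      using padic_abs_add[of "(X m - X n) * Y m" "X n * (Y m - Y n)"] 1 2 by simp
  qed
qed

lemma padic_nullD:
  assumes "X \<in> padic_null p" "e > 0"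
  shows "\<exists>N. \<forall>n\<ge>N. padic_abs p (X n) < e"
  using assms by (auto simp: padic_null_def LIMSEQ_iff)

lemma padic_nullI:
  assumes "\<And>e. e > 0 \<Longrightarrow> \<exists>N. \<forall>n\<ge>N. padic_abs p (X n) < e"
  shows "X \<in> padic_null p"
  using assms by (auto simp: padic_null_def LIMSEQ_iff)

lemma padic_null_cauchy:
  assumes "X \<in> padic_null p"
  shows "padic_cauchy p X"
  unfolding padic_cauchy_def
proof safe
  fix e :: real assume e: "e > 0"
  obtain N where N: "\<forall>n\<ge>N. padic_abs p (X n) < e" using padic_nullD[OF assms e] by blast
  have "padic_abs p (X m - X n) < e" if "m \<ge> N" "n \<ge> N" for m n
  proof -
    have "padic_abs p (X m) < e" "padic_abs p (X n) < e" using N that by auto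
    thus ?thesis using padic_abs_add[of "X m" "- X n"] by simp
  qed
  thus "\<exists>N. \<forall>m\<ge>N. \<forall>n\<ge>N. padic_abs p (X m - X n) < e" by blast
qed

lemma padic_null_add:
  assumes "X \<in> padic_null p" "Y \<in> padic_null p"
  shows "(\<lambda>n. X n + Y n) \<in> padic_null p"
proof (rule padic_nullI)
  fix e :: real assume e: "e > 0"
  obtain N where N: "\<forall>n\<ge>N. padic_abs p (X n) < e" using padic_nullD[OF assms(1) e] by blast
  obtain M where M: "\<forall>n\<ge>M. padic_abs p (Y n) < e" using padic_nullD[OF assms(2) e] by blast
  have "padic_abs p (X n + Y n) < e" if "n \<ge> max N M" for n
  proof -
    have "padic_abs p (X n) < e" "padic_abs p (Y n) < e" using N M that by auto
    thus ?thesis using padic_abs_add[of "X n" "Y n"] by simp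
  qed
  thus "\<exists>N. \<forall>n\<ge>N. padic_abs p (X n + Y n) < e" by blast
qed

lemma padic_null_minus: "X \<in> padic_null p \<Longrightarrow> (\<lambda>n. - X n) \<in> padic_null p"
  by (simp add: padic_null_def)

lemma padic_null_mult:
  assumes "X \<in> padic_null p" "padic_cauchy p Y"
  shows "(\<lambda>n. X n * Y n) \<in> padic_null p"
proof -
  obtain K where K: "K > 0" "\<And>n. padic_abs p (Y n) \<le> K" by (rule padic_cauchy_bounded[OF assms(2)]) blast
  have "(\<lambda>n. padic_abs p (X n) * K) \<longlonglongrightarrow> 0"
    using assms(1) tendsto_mult_left_zero unfolding padic_null_def by blast
  hence "(\<lambda>n. padic_abs p (X n * Y n)) \<longlonglongrightarrow> 0"
    by (rule tendsto_sandwich[rotated 2, OF tendsto_const])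
      (auto simp: padic_abs_mult intro!: always_eventually mult_left_mono K)
  thus ?thesis by (simp add: padic_null_def)
qed


lemma padic_cauchy_ring_cring: "cring (padic_cauchy_ring p)"
proof (rule cringI)
  show "abelian_group (padic_cauchy_ring p)"
  proof (rule abelian_groupI)
    fix X assume "X \<in> carrier (padic_cauchy_ring p)"
    thus "\<exists>Y\<in>carrier (padic_cauchy_ring p). Y \<oplus>\<^bsub>padic_cauchy_ring p\<^esub> X = \<zero>\<^bsub>padic_cauchy_ring p\<^esub>"
      by (intro bexI[of _ "\<lambda>n. - X n"]) (auto simp: padic_cauchy_ring_def padic_cauchy_minus)
  qed (auto simp: padic_cauchy_ring_def padic_cauchy_add padic_cauchy_const algebra_simps)
  show "comm_monoid (padic_cauchy_ring p)"
    by (rule comm_monoidI)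
      (auto simp: padic_cauchy_ring_def padic_cauchy_mult padic_cauchy_const algebra_simps)
qed (auto simp: padic_cauchy_ring_def algebra_simps)

lemma padic_null_ideal: "ideal (padic_null p) (padic_cauchy_ring p)"
proof (rule idealI)
  interpret cring "padic_cauchy_ring p" by (rule padic_cauchy_ring_cring)
  show "ring (padic_cauchy_ring p)" by (rule ring_axioms)
  show "subgroup (padic_null p) (add_monoid (padic_cauchy_ring p))"
  proof (rule subgroup.intro)
    show "padic_null p \<subseteq> carrier (add_monoid (padic_cauchy_ring p))"
      by (auto simp: padic_cauchy_ring_def padic_null_cauchy)
    show "\<one>\<^bsub>add_monoid (padic_cauchy_ring p)\<^esub> \<in> padic_null p"
      by (auto simp: padic_null_def padic_cauchy_ring_def)
    fix X assume X: "X \<in> padic_null p"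
    have "\<ominus>\<^bsub>padic_cauchy_ring p\<^esub> X = (\<lambda>n. - X n)"
      using X by (intro minus_equality)
        (auto simp: padic_cauchy_ring_def padic_null_cauchy padic_cauchy_minus)
    thus "inv\<^bsub>add_monoid (padic_cauchy_ring p)\<^esub> X \<in> padic_null p"
      using X padic_null_minus unfolding a_inv_def by simp
    fix Y assume "Y \<in> padic_null p"
    thus "X \<otimes>\<^bsub>add_monoid (padic_cauchy_ring p)\<^esub> Y \<in> padic_null p"
      using X padic_null_add by (simp add: padic_cauchy_ring_def)
  qed
  fix X Y assume "X \<in> padic_null p" "Y \<in> carrier (padic_cauchy_ring p)"
  thus "Y \<otimes>\<^bsub>padic_cauchy_ring p\<^esub> X \<in> padic_null p" "X \<otimes>\<^bsub>padic_cauchy_ring p\<^esub> Y \<in> padic_null p"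
    using padic_null_mult[of X Y] by (auto simp: padic_cauchy_ring_def mult.commute)
qed

lemma padic_inverse_seq:
  assumes X: "padic_cauchy p X" and nX: "X \<notin> padic_null p"
  obtains Y where "padic_cauchy p Y" "(\<lambda>n. X n * Y n - 1) \<in> padic_null p"
proof -
  obtain l where l: "(\<lambda>n. padic_abs p (X n)) \<longlonglongrightarrow> l"
    using padic_cauchy_abs_Cauchy[OF X] by (auto simp: convergent_def)
  have "l \<ge> 0" by (rule LIMSEQ_le_const[OF l]) auto
  moreover have "l \<noteq> 0" using l nX by (auto simp: padic_null_def)
  ultimately have l0: "l > 0" by simp
  define c where "c = l / 2"
  have c: "c > 0" "c < l" using l0 by (auto simp: c_def)
  from order_tendstoD(1)[OF l c(2)] obtain N where N: "\<And>n. n \<ge> N \<Longrightarrow> padic_abs p (X n) > c"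
    by (auto simp: eventually_sequentially)
  have nz: "X n \<noteq> 0" if "n \<ge> N" for n using N[OF that] c by auto
  have cau: "padic_cauchy p (\<lambda>n. inverse (X n))"
    unfolding padic_cauchy_def
  proof safe
    fix e :: real assume e: "e > 0"
    hence "e * c * c > 0" using c by simp
    then obtain M where M: "\<forall>m\<ge>M. \<forall>n\<ge>M. padic_abs p (X m - X n) < e * c * c"
      using X unfolding padic_cauchy_def by blast
    show "\<exists>N. \<forall>m\<ge>N. \<forall>n\<ge>N. padic_abs p (inverse (X m) - inverse (X n)) < e"
    proof (intro exI[of _ "max N M"] allI impI)
      fix m n assume mn: "max N M \<le> m" "max N M \<le> n"
      let ?a = "padic_abs p (X m)" and ?b = "padic_abs p (X n)"
      have ab: "?a > c" "?b > c" using N mn by auto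
      have z: "X m \<noteq> 0" "X n \<noteq> 0" using nz mn by auto
      have "inverse (X m) - inverse (X n) = (X n - X m) * (inverse (X m) * inverse (X n))"
        using z by (simp add: field_simps)
      hence "padic_abs p (inverse (X m) - inverse (X n)) = padic_abs p (X n - X m) * (inverse ?a * inverse ?b)"
        by (simp only: padic_abs_mult padic_abs_inverse)
      also have "\<dots> < (e * c * c) * (inverse ?a * inverse ?b)"
        using M mn ab c by (intro mult_strict_right_mono mult_pos_pos) auto
      also have "\<dots> \<le> (e * c * c) * (inverse c * inverse c)"
        using ab c e by (intro mult_left_mono mult_mono) (auto intro!: le_imp_inverse_le)
      also have "\<dots> = e" using c by (simp add: field_simps)
      finally show "padic_abs p (inverse (X m) - inverse (X n)) < e" .
    qed
  qed
  have "(\<lambda>n. X n * inverse (X n) - 1) \<in> padic_null p"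
  proof (rule padic_nullI)
    fix e :: real assume "e > 0"
    thus "\<exists>N. \<forall>n\<ge>N. padic_abs p (X n * inverse (X n) - 1) < e"
      using nz by (intro exI[of _ N]) simp
  qed
  with cau show thesis by (rule that)
qed

lemma padic_field_cring: "cring (padic_field p)"
  unfolding padic_field_def by (rule ideal.quotient_is_cring[OF padic_null_ideal padic_cauchy_ring_cring])

lemma padic_cosetE:
  assumes "x \<in> carrier (padic_field p)"
  obtains X where "padic_cauchy p X" "x = padic_null p +>\<^bsub>padic_cauchy_ring p\<^esub> X"
  using assms unfolding padic_field_def FactRing_def A_RCOSETS_def'
  by (auto simp: padic_cauchy_ring_def)

lemma padic_coset_carrier:
  "padic_cauchy p X \<Longrightarrow> padic_null p +>\<^bsub>padic_cauchy_ring p\<^esub> X \<in> carrier (padic_field p)"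
  unfolding padic_field_def FactRing_def A_RCOSETS_def' by (auto simp: padic_cauchy_ring_def)

lemma padic_coset_mem:
  "Y \<in> padic_null p +>\<^bsub>padic_cauchy_ring p\<^esub> X \<longleftrightarrow> (\<lambda>n. Y n - X n) \<in> padic_null p"
proof
  assume "Y \<in> padic_null p +>\<^bsub>padic_cauchy_ring p\<^esub> X"
  thus "(\<lambda>n. Y n - X n) \<in> padic_null p"
    by (auto simp: a_r_coset_def' padic_cauchy_ring_def)
next
  assume "(\<lambda>n. Y n - X n) \<in> padic_null p"
  thus "Y \<in> padic_null p +>\<^bsub>padic_cauchy_ring p\<^esub> X"
    by (auto simp: a_r_coset_def' padic_cauchy_ring_def intro!: bexI[of _ "\<lambda>n. Y n - X n"])
qed

lemma padic_coset_eq: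
  assumes "padic_cauchy p X" "padic_cauchy p Y"
  shows "padic_null p +>\<^bsub>padic_cauchy_ring p\<^esub> X = padic_null p +>\<^bsub>padic_cauchy_ring p\<^esub> Y
    \<longleftrightarrow> (\<lambda>n. X n - Y n) \<in> padic_null p"
proof
  assume "padic_null p +>\<^bsub>padic_cauchy_ring p\<^esub> X = padic_null p +>\<^bsub>padic_cauchy_ring p\<^esub> Y"
  moreover have "X \<in> padic_null p +>\<^bsub>padic_cauchy_ring p\<^esub> X"
    unfolding padic_coset_mem by (simp add: padic_null_def)
  ultimately show "(\<lambda>n. X n - Y n) \<in> padic_null p" by (simp add: padic_coset_mem)
next
  assume n: "(\<lambda>n. X n - Y n) \<in> padic_null p"
  show "padic_null p +>\<^bsub>padic_cauchy_ring p\<^esub> X = padic_null p +>\<^bsub>padic_cauchy_ring p\<^esub> Y"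
  proof (intro Set.set_eqI, unfold padic_coset_mem)
    fix Z
    have a: "(\<lambda>k. (Z k - X k) + (X k - Y k)) = (\<lambda>k. Z k - Y k)"
      and b: "(\<lambda>k. (Z k - Y k) + - (X k - Y k)) = (\<lambda>k. Z k - X k)" by auto
    show "(\<lambda>n. Z n - X n) \<in> padic_null p \<longleftrightarrow> (\<lambda>n. Z n - Y n) \<in> padic_null p"
      using padic_null_add[OF _ n, of "\<lambda>k. Z k - X k"]
        padic_null_add[OF _ padic_null_minus[OF n], of "\<lambda>k. Z k - Y k"] unfolding a b by blast
  qed
qed

lemma padic_field_ops:
  assumes "padic_cauchy p X" "padic_cauchy p Y"
  shows "(padic_null p +>\<^bsub>padic_cauchy_ring p\<^esub> X) \<otimes>\<^bsub>padic_field p\<^esub> (padic_null p +>\<^bsub>padic_cauchy_ring p\<^esub> Y)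
      = padic_null p +>\<^bsub>padic_cauchy_ring p\<^esub> (\<lambda>n. X n * Y n)"
    and "(padic_null p +>\<^bsub>padic_cauchy_ring p\<^esub> X) \<oplus>\<^bsub>padic_field p\<^esub> (padic_null p +>\<^bsub>padic_cauchy_ring p\<^esub> Y)
      = padic_null p +>\<^bsub>padic_cauchy_ring p\<^esub> (\<lambda>n. X n + Y n)"
    and "\<one>\<^bsub>padic_field p\<^esub> = padic_null p +>\<^bsub>padic_cauchy_ring p\<^esub> (\<lambda>n. 1)"
    and "\<zero>\<^bsub>padic_field p\<^esub> = padic_null p +>\<^bsub>padic_cauchy_ring p\<^esub> (\<lambda>n. 0)"
proof -
  interpret ideal "padic_null p" "padic_cauchy_ring p" by (rule padic_null_ideal)
  have c: "X \<in> carrier (padic_cauchy_ring p)" "Y \<in> carrier (padic_cauchy_ring p)"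
    using assms by (auto simp: padic_cauchy_ring_def)
  show "(padic_null p +>\<^bsub>padic_cauchy_ring p\<^esub> X) \<otimes>\<^bsub>padic_field p\<^esub> (padic_null p +>\<^bsub>padic_cauchy_ring p\<^esub> Y)
      = padic_null p +>\<^bsub>padic_cauchy_ring p\<^esub> (\<lambda>n. X n * Y n)"
    using rcoset_mult_add[OF c] by (simp add: padic_field_def FactRing_def) (simp add: padic_cauchy_ring_def)
  show "(padic_null p +>\<^bsub>padic_cauchy_ring p\<^esub> X) \<oplus>\<^bsub>padic_field p\<^esub> (padic_null p +>\<^bsub>padic_cauchy_ring p\<^esub> Y)
      = padic_null p +>\<^bsub>padic_cauchy_ring p\<^esub> (\<lambda>n. X n + Y n)"
    using a_rcos_sum[OF c] by (simp add: padic_field_def FactRing_def) (simp add: padic_cauchy_ring_def)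
  show "\<one>\<^bsub>padic_field p\<^esub> = padic_null p +>\<^bsub>padic_cauchy_ring p\<^esub> (\<lambda>n. 1)"
    by (simp add: padic_field_def FactRing_def) (simp add: padic_cauchy_ring_def)
  show "\<zero>\<^bsub>padic_field p\<^esub> = padic_null p +>\<^bsub>padic_cauchy_ring p\<^esub> (\<lambda>n. 0)"
  proof (rule Set.set_eqI)
    fix Z show "Z \<in> \<zero>\<^bsub>padic_field p\<^esub> \<longleftrightarrow> Z \<in> padic_null p +>\<^bsub>padic_cauchy_ring p\<^esub> (\<lambda>n. 0)"
      unfolding padic_coset_mem by (simp add: padic_field_def FactRing_def)
  qed
qed

lemma padic_field_one_neq_zero: "\<one>\<^bsub>padic_field p\<^esub> \<noteq> \<zero>\<^bsub>padic_field p\<^esub>"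
  unfolding padic_field_ops(3,4)[OF padic_cauchy_const padic_cauchy_const]
    padic_coset_eq[OF padic_cauchy_const padic_cauchy_const]
  by (simp add: padic_null_def LIMSEQ_const_iff)

lemma padic_field_inv:
  assumes "x \<in> carrier (padic_field p)" "x \<noteq> \<zero>\<^bsub>padic_field p\<^esub>"
  shows "\<exists>y\<in>carrier (padic_field p). y \<otimes>\<^bsub>padic_field p\<^esub> x = \<one>\<^bsub>padic_field p\<^esub>"
proof -
  obtain X where X: "padic_cauchy p X" "x = padic_null p +>\<^bsub>padic_cauchy_ring p\<^esub> X"
    using assms(1) by (rule padic_cosetE)
  have "X \<notin> padic_null p"
    using assms(2) unfolding X(2) padic_field_ops(4)[OF X(1) X(1)] padic_coset_eq[OF X(1) padic_cauchy_const]
    by simp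
  then obtain Y where Y: "padic_cauchy p Y" "(\<lambda>n. X n * Y n - 1) \<in> padic_null p"
    using padic_inverse_seq[OF X(1)] by blast
  show ?thesis
  proof (rule bexI)
    show "padic_null p +>\<^bsub>padic_cauchy_ring p\<^esub> Y \<in> carrier (padic_field p)"
      by (rule padic_coset_carrier[OF Y(1)])
    show "(padic_null p +>\<^bsub>padic_cauchy_ring p\<^esub> Y) \<otimes>\<^bsub>padic_field p\<^esub> x = \<one>\<^bsub>padic_field p\<^esub>"
      unfolding X(2) padic_field_ops(1)[OF Y(1) X(1)] padic_field_ops(3)[OF X(1) X(1)]
        padic_coset_eq[OF padic_cauchy_mult[OF Y(1) X(1)] padic_cauchy_const]
      using Y(2) by (simp add: mult.commute)
  qed
qed

end


typedef (overloaded) ('p :: prime_card) padic = "carrier (padic_field CARD('p))"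
  using padic_coset_carrier[OF prime_card padic_cauchy_const[OF prime_card]] by blast

setup_lifting type_definition_padic

lift_definition padic_of_seq :: "(nat \<Rightarrow> rat) \<Rightarrow> 'p::prime_card padic" is
  "\<lambda>X. if padic_cauchy CARD('p) X then padic_null CARD('p) +>\<^bsub>padic_cauchy_ring CARD('p)\<^esub> X
       else \<zero>\<^bsub>padic_field CARD('p)\<^esub>"
  using padic_coset_carrier[OF prime_card]
    cring.cring_simprules(2)[OF padic_field_cring[OF prime_card]] by auto

instantiation padic :: (prime_card) comm_ring_1
begin

lift_definition zero_padic :: "'a padic" is "\<zero>\<^bsub>padic_field CARD('a)\<^esub>"
  by (rule cring.cring_simprules(2)[OF padic_field_cring[OF prime_card]])
lift_definition one_padic :: "'a padic" is "\<one>\<^bsub>padic_field CARD('a)\<^esub>"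
  by (rule cring.cring_simprules(6)[OF padic_field_cring[OF prime_card]])
lift_definition plus_padic :: "'a padic \<Rightarrow> 'a padic \<Rightarrow> 'a padic" is "(\<oplus>\<^bsub>padic_field CARD('a)\<^esub>)"
  by (rule cring.cring_simprules(1)[OF padic_field_cring[OF prime_card]])
lift_definition times_padic :: "'a padic \<Rightarrow> 'a padic \<Rightarrow> 'a padic" is "(\<otimes>\<^bsub>padic_field CARD('a)\<^esub>)"
  by (rule cring.cring_simprules(5)[OF padic_field_cring[OF prime_card]])
lift_definition uminus_padic :: "'a padic \<Rightarrow> 'a padic" is "a_inv (padic_field CARD('a))"
  by (rule cring.cring_simprules(3)[OF padic_field_cring[OF prime_card]])
definition minus_padic :: "'a padic \<Rightarrow> 'a padic \<Rightarrow> 'a padic" where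
  "minus_padic x y = x + - y"

instance
proof
  fix a b c :: "'a padic"
  note F = padic_field_cring[where p = "CARD('a)", OF prime_card]
  show "a * b * c = a * (b * c)" by transfer (rule cring.cring_simprules[OF F])
  show "a * b = b * a" by transfer (rule cring.cring_simprules[OF F])
  show "1 * a = a" by transfer (rule cring.cring_simprules[OF F])
  show "a + b + c = a + (b + c)" by transfer (rule cring.cring_simprules[OF F])
  show "a + b = b + a" by transfer (rule cring.cring_simprules[OF F])
  show "0 + a = a" by transfer (rule cring.cring_simprules[OF F])
  show "- a + a = 0" by transfer (rule cring.cring_simprules[OF F])
  show "a - b = a + - b" by (rule minus_padic_def)
  show "(a + b) * c = a * c + b * c" by transfer (rule cring.cring_simprules[OF F])
  show "(0 :: 'a padic) \<noteq> 1" by transfer (rule padic_field_one_neq_zero[OF prime_card, symmetric])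
qed

end

instantiation padic :: (prime_card) field
begin

definition inverse_padic :: "'a padic \<Rightarrow> 'a padic" where
  "inverse_padic x = (if x = 0 then 0 else (THE y. y * x = 1))"
definition divide_padic :: "'a padic \<Rightarrow> 'a padic \<Rightarrow> 'a padic" where
  "divide_padic x y = x * inverse y"

instance
proof
  fix a b :: "'a padic"
  show "inverse a * a = 1" if "a \<noteq> 0"
  proof -
    have "\<exists>y. y * a = 1"
      using that by transfer (use padic_field_inv[OF prime_card] in blast)
    then obtain y where y: "y * a = 1" ..
    have "(THE y. y * a = 1) = y"
    proof (rule the_equality)
      show "y * a = 1" by (rule y)
    next
      fix z assume "z * a = 1"
      hence "z * a * y = y" by simp
      moreover have "z * a * y = z * (y * a)" by (simp only: mult.assoc mult.commute[of a y])
      ultimately show "z = y" using y by simp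
    qed
    thus ?thesis using y that by (simp add: inverse_padic_def)
  qed
  show "a div b = a * inverse b" by (rule divide_padic_def)
  show "inverse (0 :: 'a padic) = 0" by (simp add: inverse_padic_def)
qed

end

lemma padic_of_seq_surj:
  obtains X where "padic_cauchy CARD('p::prime_card) X" "x = (padic_of_seq X :: 'p padic)"
proof -
  have "\<exists>X. padic_cauchy CARD('p) X \<and> x = (padic_of_seq X :: 'p padic)"
  proof (transfer, goal_cases)
    case (1 x)
    then obtain X where "padic_cauchy CARD('p) X" "x = padic_null CARD('p) +>\<^bsub>padic_cauchy_ring CARD('p)\<^esub> X"
      using padic_cosetE[OF prime_card, of x] by blast
    thus ?case by (intro exI[of _ X]) simp
  qed
  thus thesis using that by blast
qed

lemma padic_of_seq_eq_iff:
  assumes "padic_cauchy CARD('p::prime_card) X" "padic_cauchy CARD('p) Y"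
  shows "(padic_of_seq X :: 'p padic) = padic_of_seq Y \<longleftrightarrow> (\<lambda>n. X n - Y n) \<in> padic_null CARD('p)"
  using assms by (transfer fixing: X Y) (simp add: padic_coset_eq[OF prime_card])

lemma padic_of_seq_mem_iff:
  assumes "padic_cauchy CARD('p::prime_card) X"
  shows "Y \<in> Rep_padic (padic_of_seq X :: 'p padic) \<longleftrightarrow> (\<lambda>n. Y n - X n) \<in> padic_null CARD('p)"
  using assms by (simp add: padic_of_seq.rep_eq padic_coset_mem[OF prime_card])

lemma padic_of_seq_add:
  assumes "padic_cauchy CARD('p::prime_card) X" "padic_cauchy CARD('p) Y"
  shows "(padic_of_seq X + padic_of_seq Y :: 'p padic) = padic_of_seq (\<lambda>n. X n + Y n)"
  using assms padic_cauchy_add[OF prime_card assms]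
  by (transfer fixing: X Y) (simp add: padic_field_ops[OF prime_card])

lemma padic_of_seq_mult:
  assumes "padic_cauchy CARD('p::prime_card) X" "padic_cauchy CARD('p) Y"
  shows "(padic_of_seq X * padic_of_seq Y :: 'p padic) = padic_of_seq (\<lambda>n. X n * Y n)"
  using assms padic_cauchy_mult[OF prime_card assms]
  by (transfer fixing: X Y) (simp add: padic_field_ops[OF prime_card])

lemma padic_of_seq_0: "padic_of_seq (\<lambda>n. 0) = (0 :: 'p::prime_card padic)"
  using padic_cauchy_const[of "CARD('p)" 0, OF prime_card]
  by transfer (simp add: padic_field_ops(4)[OF prime_card])

lemma padic_of_seq_1: "padic_of_seq (\<lambda>n. 1) = (1 :: 'p::prime_card padic)"
  using padic_cauchy_const[of "CARD('p)" 1, OF prime_card]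
  by transfer (simp add: padic_field_ops(3)[OF prime_card])

lemma padic_of_seq_minus:
  assumes "padic_cauchy CARD('p::prime_card) X"
  shows "(- padic_of_seq X :: 'p padic) = padic_of_seq (\<lambda>n. - X n)"
proof -
  have "(padic_of_seq X + padic_of_seq (\<lambda>n. - X n) :: 'p padic) = 0"
    using assms by (simp add: padic_of_seq_add padic_cauchy_minus[OF prime_card] padic_of_seq_0)
  thus ?thesis by (rule minus_unique)
qed

lemma padic_of_seq_diff:
  assumes "padic_cauchy CARD('p::prime_card) X" "padic_cauchy CARD('p) Y"
  shows "(padic_of_seq X - padic_of_seq Y :: 'p padic) = padic_of_seq (\<lambda>n. X n - Y n)"
  using assms by (simp add: minus_padic_def padic_of_seq_minus padic_of_seq_add padic_cauchy_minus[OF prime_card])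

lemma padic_of_seq_of_nat: "padic_of_seq (\<lambda>n. of_nat m) = (of_nat m :: 'p::prime_card padic)"
proof (induction m)
  case (Suc m)
  have "(of_nat (Suc m) :: 'p padic) = padic_of_seq (\<lambda>n. 1) + padic_of_seq (\<lambda>n. of_nat m)"
    using Suc by (simp add: padic_of_seq_1)
  also have "\<dots> = padic_of_seq (\<lambda>n. of_nat (Suc m))"
    by (simp add: padic_of_seq_add padic_cauchy_const[OF prime_card])
  finally show ?case ..
qed (simp add: padic_of_seq_0)

lemma padic_const_null_iff:
  assumes "prime p"
  shows "(\<lambda>n. x) \<in> padic_null p \<longleftrightarrow> x = 0"
proof (cases "x = 0")
  case False
  thus ?thesis using padic_abs_pos[OF assms, of x] by (simp add: padic_null_def LIMSEQ_const_iff)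
qed (simp add: padic_null_def padic_abs_def)

instance padic :: (prime_card) field_char_0
proof
  show "inj (of_nat :: nat \<Rightarrow> 'a padic)"
  proof (rule injI)
    fix m n assume "of_nat m = (of_nat n :: 'a padic)"
    hence "(\<lambda>k. of_nat m - of_nat n) \<in> padic_null CARD('a)"
      unfolding padic_of_seq_of_nat[symmetric]
      by (simp add: padic_of_seq_eq_iff padic_cauchy_const[OF prime_card])
    thus "m = n" by (simp add: padic_const_null_iff[OF prime_card])
  qed
qed

lemma padic_of_seq_of_rat: "padic_of_seq (\<lambda>n. x) = (of_rat x :: 'p::prime_card padic)"
proof -
  let ?e = "\<lambda>x. padic_of_seq (\<lambda>n. x) :: 'p padic"
  note c = padic_cauchy_const[OF prime_card]
  have int: "?e (of_int k) = of_int k" for k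
  proof (cases k rule: int_cases2)
    case (nonneg n)
    thus ?thesis by (simp add: padic_of_seq_of_nat)
  next
    case (nonpos n)
    have "?e (of_int k) = - ?e (of_nat n)" by (simp add: padic_of_seq_minus[OF c] nonpos)
    thus ?thesis by (simp add: padic_of_seq_of_nat nonpos)
  qed
  obtain n d where x: "x = of_int n / of_int d" "d > 0"
    by (rule rat_fracE[OF prime_card[where 'a = 'p]])
  have "?e x * ?e (of_int d) = ?e (of_int n)"
    using x by (subst padic_of_seq_mult[OF c c]) simp
  hence "?e x * of_int d = of_int n" unfolding int .
  moreover have "(of_int d :: 'p padic) \<noteq> 0" using x by simp
  ultimately have "?e x = of_int n / of_int d" by (simp add: eq_divide_eq)
  thus ?thesis using x by (simp add: of_rat_divide)
qed

lemma Rep_padic_of_rat: "Rep_padic (of_rat x :: 'p::prime_card padic) = padic_const CARD('p) x"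
  by (simp add: padic_of_seq_of_rat[symmetric] padic_of_seq.rep_eq padic_cauchy_const[OF prime_card] padic_const_def)

text \<open>
  The class constant \<open>norm\<close> is constrained to real normed vector spaces, so the p-adic absolute value
  gets its own name. It is normalised by \<open>\<bar>p\<bar> = 1/p\<close>.
\<close>

definition padic_norm :: "'p::prime_card padic \<Rightarrow> real" where
  "padic_norm x = lim (\<lambda>n. padic_abs CARD('p) ((SOME X. X \<in> Rep_padic x) n))"

lemma padic_norm_of_seq:
  assumes X: "padic_cauchy CARD('p::prime_card) X"
  shows "(\<lambda>n. padic_abs CARD('p) (X n)) \<longlonglongrightarrow> padic_norm (padic_of_seq X :: 'p padic)"
proof -
  define Y where "Y = (SOME Y. Y \<in> Rep_padic (padic_of_seq X :: 'p padic))"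
  have "X \<in> Rep_padic (padic_of_seq X :: 'p padic)"
    by (simp add: padic_of_seq_mem_iff[OF X] padic_null_def padic_abs_def)
  hence "Y \<in> Rep_padic (padic_of_seq X :: 'p padic)" unfolding Y_def by (rule someI[of "\<lambda>Z. Z \<in> Rep_padic (padic_of_seq X :: 'p padic)"])
  hence n: "(\<lambda>n. padic_abs CARD('p) (Y n - X n)) \<longlonglongrightarrow> 0"
    by (simp add: padic_of_seq_mem_iff[OF X] padic_null_def)
  obtain l where l: "(\<lambda>n. padic_abs CARD('p) (X n)) \<longlonglongrightarrow> l"
    using padic_cauchy_abs_Cauchy[OF prime_card X] by (auto simp: convergent_def)
  have "(\<lambda>n. padic_abs CARD('p) (Y n) - padic_abs CARD('p) (X n)) \<longlonglongrightarrow> 0"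
    by (rule Lim_null_comparison[OF always_eventually n])
      (simp add: padic_abs_diff_abs[OF prime_card])
  from tendsto_add[OF this l] have "(\<lambda>n. padic_abs CARD('p) (Y n)) \<longlonglongrightarrow> l" by simp
  hence "padic_norm (padic_of_seq X :: 'p padic) = l"
    unfolding padic_norm_def Y_def[symmetric] by (rule limI)
  thus ?thesis using l by simp
qed

lemma padic_norm_of_rat: "padic_norm (of_rat x :: 'p::prime_card padic) = padic_abs CARD('p) x"
  using padic_norm_of_seq[OF padic_cauchy_const[OF prime_card], where 'p = 'p, of x]
  by (simp add: padic_of_seq_of_rat LIMSEQ_const_iff)

lemma padic_norm_eq_0_iff: "padic_norm x = 0 \<longleftrightarrow> (x :: 'p::prime_card padic) = 0"
proof -
  obtain X where X: "padic_cauchy CARD('p) X" "x = padic_of_seq X" by (rule padic_of_seq_surj)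
  have "x = 0 \<longleftrightarrow> X \<in> padic_null CARD('p)"
    unfolding X(2) padic_of_seq_0[symmetric]
    by (simp add: padic_of_seq_eq_iff X padic_cauchy_const[OF prime_card])
  also have "\<dots> \<longleftrightarrow> padic_norm x = 0"
  proof
    assume "X \<in> padic_null CARD('p)"
    hence "(\<lambda>n. padic_abs CARD('p) (X n)) \<longlonglongrightarrow> 0" by (simp add: padic_null_def)
    thus "padic_norm x = 0" unfolding X(2) by (rule LIMSEQ_unique[OF padic_norm_of_seq[OF X(1)]])
  next
    assume "padic_norm x = 0"
    thus "X \<in> padic_null CARD('p)"
      using padic_norm_of_seq[OF X(1)] by (simp add: padic_null_def X(2))
  qed
  finally show ?thesis ..
qed

lemma padic_norm_add: "padic_norm (x + y) \<le> max (padic_norm x) (padic_norm (y :: 'p::prime_card padic))"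
proof -
  obtain X where X: "padic_cauchy CARD('p) X" "x = padic_of_seq X" by (rule padic_of_seq_surj)
  obtain Y where Y: "padic_cauchy CARD('p) Y" "y = padic_of_seq Y" by (rule padic_of_seq_surj)
  show ?thesis unfolding X(2) Y(2) padic_of_seq_add[OF X(1) Y(1)]
    by (rule LIMSEQ_le[OF padic_norm_of_seq[OF padic_cauchy_add[OF prime_card X(1) Y(1)]]
          tendsto_max[OF padic_norm_of_seq[OF X(1)] padic_norm_of_seq[OF Y(1)]]])
      (simp add: padic_abs_add[OF prime_card])
qed

lemma padic_norm_mult: "padic_norm (x * y) = padic_norm x * padic_norm (y :: 'p::prime_card padic)"
proof -
  obtain X where X: "padic_cauchy CARD('p) X" "x = padic_of_seq X" by (rule padic_of_seq_surj)
  obtain Y where Y: "padic_cauchy CARD('p) Y" "y = padic_of_seq Y" by (rule padic_of_seq_surj)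
  have "(\<lambda>n. padic_abs CARD('p) (X n * Y n)) \<longlonglongrightarrow> padic_norm x * padic_norm y"
    unfolding padic_abs_mult[OF prime_card] X(2) Y(2)
    by (intro tendsto_mult padic_norm_of_seq X Y)
  thus ?thesis
    using padic_norm_of_seq[OF padic_cauchy_mult[OF prime_card X(1) Y(1)]]
    unfolding X(2) Y(2) padic_of_seq_mult[OF X(1) Y(1)] by (rule LIMSEQ_unique[symmetric])
qed

lemma padic_norm_nonneg [simp]: "padic_norm (x :: 'p::prime_card padic) \<ge> 0"
proof -
  obtain X where X: "padic_cauchy CARD('p) X" "x = padic_of_seq X" by (rule padic_of_seq_surj)
  show ?thesis unfolding X(2)
    by (rule LIMSEQ_le_const[OF padic_norm_of_seq[OF X(1)]]) (simp add: padic_abs_def)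
qed

lemma padic_norm_minus [simp]: "padic_norm (- x :: 'p::prime_card padic) = padic_norm x"
proof -
  have "padic_norm (- 1 :: 'p padic) = 1"
    using padic_norm_of_rat[of "- 1", where 'p = 'p]
    by (simp add: padic_abs_minus[OF prime_card] padic_abs_1[OF prime_card] of_rat_minus)
  thus ?thesis using padic_norm_mult[of "- 1" x] by simp
qed

instantiation padic :: (prime_card) metric_space
begin

definition dist_padic :: "'a padic \<Rightarrow> 'a padic \<Rightarrow> real" where
  "dist_padic x y = padic_norm (x - y)"
definition uniformity_padic :: "('a padic \<times> 'a padic) filter" where
  "uniformity_padic = (INF e\<in>{0<..}. principal {(x, y). dist x y < e})"
definition open_padic :: "'a padic set \<Rightarrow> bool" where
  "open_padic U \<longleftrightarrow> (\<forall>x\<in>U. eventually (\<lambda>(x', y). x' = x \<longrightarrow> y \<in> U) uniformity)"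

instance
proof
  fix x y z :: "'a padic"
  show "dist x y = 0 \<longleftrightarrow> x = y" by (simp add: dist_padic_def padic_norm_eq_0_iff)
  have "padic_norm (x - y) \<le> max (padic_norm (x - z)) (padic_norm (z - y))"
    using padic_norm_add[of "x - z" "z - y"] by simp
  also have "padic_norm (z - y) = padic_norm (y - z)" using padic_norm_minus[of "y - z"] by simp
  also have "max (padic_norm (x - z)) (padic_norm (y - z)) \<le> padic_norm (x - z) + padic_norm (y - z)" by simp
  finally show "dist x y \<le> dist x z + dist y z" by (simp add: dist_padic_def)
qed (auto simp: dist_padic_def uniformity_padic_def open_padic_def)

end

section \<open>Rational quaternion algebras and Eichler orders\<close>

definition type_ring :: "'a::comm_ring_1 ring" where
  "type_ring = \<lparr>carrier = UNIV, monoid.mult = (*), one = 1, ring.zero = 0, ring.add = (+)\<rparr>"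

context
  fixes K :: "('a, 'm) ring_scheme" (structure)
begin

text \<open>
  The quaternion algebra \<open>(a, b | K)\<close> with basis \<open>1, i, j, ij\<close>, where \<open>i\<^sup>2 = a\<close>, \<open>j\<^sup>2 = b\<close> and
  \<open>ji = - ij\<close>. In characteristic other than 2 every quaternion algebra over \<open>K\<close> is of this form with
  \<open>a, b\<close> nonzero, and its base change to an extension field \<open>L\<close> is \<open>(a, b | L)\<close>.
\<close>

definition quat_alg :: "'a \<Rightarrow> 'a \<Rightarrow> ('a \<times> 'a \<times> 'a \<times> 'a) ring" where
  "quat_alg a b = \<lparr>carrier = carrier K \<times> carrier K \<times> carrier K \<times> carrier K,
     monoid.mult = (\<lambda>(x0, x1, x2, x3) (y0, y1, y2, y3).
       (x0 \<otimes> y0 \<oplus> a \<otimes> x1 \<otimes> y1 \<oplus> b \<otimes> x2 \<otimes> y2 \<ominus> a \<otimes> b \<otimes> x3 \<otimes> y3,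
        x0 \<otimes> y1 \<oplus> x1 \<otimes> y0 \<ominus> b \<otimes> x2 \<otimes> y3 \<oplus> b \<otimes> x3 \<otimes> y2,
        x0 \<otimes> y2 \<oplus> x2 \<otimes> y0 \<oplus> a \<otimes> x1 \<otimes> y3 \<ominus> a \<otimes> x3 \<otimes> y1,
        x0 \<otimes> y3 \<oplus> x3 \<otimes> y0 \<oplus> x1 \<otimes> y2 \<ominus> x2 \<otimes> y1)),
     one = (\<one>, \<zero>, \<zero>, \<zero>),
     ring.zero = (\<zero>, \<zero>, \<zero>, \<zero>),
     ring.add = (\<lambda>(x0, x1, x2, x3) (y0, y1, y2, y3). (x0 \<oplus> y0, x1 \<oplus> y1, x2 \<oplus> y2, x3 \<oplus> y3))\<rparr>"

end

definition is_division_ring :: "('a, 'm) ring_scheme \<Rightarrow> bool" where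
  "is_division_ring A \<longleftrightarrow> Units A = carrier A - {\<zero>\<^bsub>A\<^esub>}"

definition definite_quat :: "rat \<Rightarrow> rat \<Rightarrow> bool" where
  "definite_quat a b \<longleftrightarrow> is_division_ring (quat_alg (type_ring :: real ring) (of_rat a) (of_rat b))"

definition ramified_at :: "nat \<Rightarrow> rat \<Rightarrow> rat \<Rightarrow> bool" where
  "ramified_at l a b \<longleftrightarrow>
     is_division_ring (quat_alg (padic_field l) (padic_const l a) (padic_const l b))"

definition has_discriminant :: "rat \<Rightarrow> rat \<Rightarrow> nat \<Rightarrow> bool" where
  "has_discriminant a b D \<longleftrightarrow>
     finite {l. prime l \<and> ramified_at l a b} \<and> D = \<Prod>{l. prime l \<and> ramified_at l a b}"

abbreviation rat_quat :: "rat \<Rightarrow> rat \<Rightarrow> (rat \<times> rat \<times> rat \<times> rat) ring" where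
  "rat_quat a b \<equiv> quat_alg (type_ring :: rat ring) a b"

fun quat_nrd :: "rat \<Rightarrow> rat \<Rightarrow> rat \<times> rat \<times> rat \<times> rat \<Rightarrow> rat" where
  "quat_nrd a b (x0, x1, x2, x3) = x0\<^sup>2 - a * x1\<^sup>2 - b * x2\<^sup>2 + a * b * x3\<^sup>2"

lemma type_ring_cring: "cring (type_ring :: 'a::comm_ring_1 ring)"
proof (rule cringI)
  show "abelian_group (type_ring :: 'a ring)"
  proof (rule abelian_groupI)
    fix x :: 'a assume "x \<in> carrier type_ring"
    show "\<exists>y\<in>carrier type_ring. y \<oplus>\<^bsub>type_ring\<^esub> x = \<zero>\<^bsub>type_ring\<^esub>"
      by (intro bexI[of _ "- x"]) (auto simp: type_ring_def)
  qed (auto simp: type_ring_def algebra_simps)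
  show "comm_monoid (type_ring :: 'a ring)"
    by (rule comm_monoidI) (auto simp: type_ring_def algebra_simps)
qed (auto simp: type_ring_def algebra_simps)

lemma type_ring_simps:
  fixes x y :: "'a::comm_ring_1"
  shows "carrier type_ring = (UNIV :: 'a set)" "x \<otimes>\<^bsub>type_ring\<^esub> y = x * y" "x \<oplus>\<^bsub>type_ring\<^esub> y = x + y"
    "\<one>\<^bsub>type_ring\<^esub> = (1 :: 'a)" "\<zero>\<^bsub>type_ring\<^esub> = (0 :: 'a)" "x \<ominus>\<^bsub>type_ring\<^esub> y = x - y"
proof -
  interpret cring "type_ring :: 'a ring" by (rule type_ring_cring)
  have "\<ominus>\<^bsub>type_ring\<^esub> y = - y" by (rule minus_equality) (auto simp: type_ring_def)
  thus "x \<ominus>\<^bsub>type_ring\<^esub> y = x - y" by (simp add: a_minus_def) (simp add: type_ring_def)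
qed (auto simp: type_ring_def)

lemma quat_mult_conj:
  "(x0, x1, x2, x3) \<otimes>\<^bsub>rat_quat a b\<^esub> (x0, - x1, - x2, - x3) = (quat_nrd a b (x0, x1, x2, x3), 0, 0, 0)"
  by (simp add: quat_alg_def type_ring_simps power2_eq_square algebra_simps)

definition is_order :: "('a, 'm) ring_scheme \<Rightarrow> 'a set \<Rightarrow> bool" where
  "is_order A S \<longleftrightarrow> subring S A \<and>
     (\<exists>G. finite G \<and> G \<subseteq> carrier A \<and> S = generate (add_monoid A) G) \<and>
     (\<forall>x\<in>carrier A. \<exists>n::nat. n > 0 \<and> [n] \<cdot>\<^bsub>A\<^esub> x \<in> S)"

definition is_maximal_order :: "('a, 'm) ring_scheme \<Rightarrow> 'a set \<Rightarrow> bool" where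
  "is_maximal_order A S \<longleftrightarrow> is_order A S \<and> (\<forall>T. is_order A T \<and> S \<subseteq> T \<longrightarrow> T = S)"

text \<open>An Eichler order is an intersection of two maximal orders; its level is its index in either.\<close>

definition is_eichler_order :: "('a, 'm) ring_scheme \<Rightarrow> nat \<Rightarrow> 'a set \<Rightarrow> bool" where
  "is_eichler_order A N R \<longleftrightarrow> (\<exists>S T. is_maximal_order A S \<and> is_maximal_order A T \<and>
     R = S \<inter> T \<and> card ((\<lambda>x. R +>\<^bsub>A\<^esub> x) ` S) = N)"

definition invert_in_order :: "('a, 'm) ring_scheme \<Rightarrow> 'a set \<Rightarrow> nat \<Rightarrow> 'a set" where
  "invert_in_order A R p = {x \<in> carrier A. \<exists>n::nat. [(p ^ n)] \<cdot>\<^bsub>A\<^esub> x \<in> R}"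


section \<open>Splitting at p and the p-arithmetic group\<close>

definition padic_ints :: "'p::prime_card padic set" where
  "padic_ints = {x. padic_norm x \<le> 1}"

definition padic_units :: "'p::prime_card padic set" where
  "padic_units = {x \<in> padic_ints. \<exists>y\<in>padic_ints. x * y = 1}"

fun quat_of_rat :: "rat \<times> rat \<times> rat \<times> rat \<Rightarrow> 'a \<times> 'a \<times> 'a \<times> 'a::field_char_0" where
  "quat_of_rat (x0, x1, x2, x3) = (of_rat x0, of_rat x1, of_rat x2, of_rat x3)"

abbreviation padic_quat :: "rat \<Rightarrow> rat \<Rightarrow>
    ('p padic \<times> 'p padic \<times> 'p padic \<times> 'p::prime_card padic) ring" where
  "padic_quat a b \<equiv> quat_alg type_ring (of_rat a) (of_rat b)"

definition mat2_ring :: "('a::comm_ring_1 ^ 2 ^ 2) ring" where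
  "mat2_ring = \<lparr>carrier = UNIV, monoid.mult = (**), one = mat 1, ring.zero = 0, ring.add = (+)\<rparr>"

definition mat2_ints :: "('p::prime_card padic ^ 2 ^ 2) set" where
  "mat2_ints = {g. \<forall>i j. g $ i $ j \<in> padic_ints}"

text \<open>The second condition is \<open>\<rat>\<^sub>p\<close>-linearity, \<open>(c, 0, 0, 0)\<close> being the scalar \<open>c\<close>.\<close>

definition is_splitting :: "rat \<Rightarrow> rat \<Rightarrow>
    ('p padic \<times> 'p padic \<times> 'p padic \<times> 'p::prime_card padic \<Rightarrow> 'p padic ^ 2 ^ 2) \<Rightarrow> bool" where
  "is_splitting a b \<iota> \<longleftrightarrow> \<iota> \<in> ring_iso (padic_quat a b) mat2_ring \<and> (\<forall>c. \<iota> (c, 0, 0, 0) = mat c)"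

text \<open>The image of \<open>R \<otimes> \<int>\<^sub>p\<close> in \<open>B \<otimes> \<rat>\<^sub>p\<close>, i.e. the \<open>\<int>\<^sub>p\<close>-span of \<open>R\<close>.\<close>

definition padic_completion :: "rat \<Rightarrow> rat \<Rightarrow> (rat \<times> rat \<times> rat \<times> rat) set \<Rightarrow>
    ('p padic \<times> 'p padic \<times> 'p padic \<times> 'p::prime_card padic) set" where
  "padic_completion a b R = generate (add_monoid (padic_quat a b))
     {(z, 0, 0, 0) \<otimes>\<^bsub>padic_quat a b\<^esub> quat_of_rat r | z r. z \<in> padic_ints \<and> r \<in> R}"

definition quat_Gamma :: "rat \<Rightarrow> rat \<Rightarrow> (rat \<times> rat \<times> rat \<times> rat) set \<Rightarrow>
    ('p padic \<times> 'p padic \<times> 'p padic \<times> 'p::prime_card padic \<Rightarrow> 'p padic ^ 2 ^ 2) \<Rightarrow>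
    ('p padic ^ 2 ^ 2) set" where
  "quat_Gamma a b R \<iota> =
     {\<iota> (quat_of_rat x) | x. x \<in> invert_in_order (rat_quat a b) R CARD('p) \<and> quat_nrd a b x = 1}"

definition Gamma0 :: "('p::prime_card padic ^ 2 ^ 2) set" where
  "Gamma0 = {g \<in> mat2_ints. det g \<in> padic_units \<and> (\<exists>z\<in>padic_ints. g $ 2 $ 1 = of_nat CARD('p) * z)}"

definition Sigma0 :: "('p::prime_card padic ^ 2 ^ 2) set" where
  "Sigma0 = {g \<in> mat2_ints. (\<exists>z\<in>padic_ints. g $ 2 $ 1 = of_nat CARD('p) * z) \<and>
     g $ 1 $ 1 \<in> padic_units \<and> det g \<noteq> 0}"


section \<open>Polynomials, the Tate algebra and their duals\<close>

text \<open>
  Elements of dual spaces, and automorphic forms below, are represented by functions on a whole type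
  that vanish outside their proper domain, so that the vector space operations are the pointwise
  ones. Throughout, the weight \<open>k\<close> is even.
\<close>

definition poly_space :: "nat \<Rightarrow> 'a::zero poly set" where
  "poly_space k = {P. Polynomial.degree P \<le> k}"

text \<open>\<open>(cx + d)\<^sup>k P((ax + b) / (cx + d))\<close> is expanded as \<open>\<Sum>\<^sub>i P\<^sub>i (ax + b)\<^sup>i (cx + d)\<^sup>k\<^sup>-\<^sup>i\<close>.\<close>

definition poly_ract :: "nat \<Rightarrow> 'a::field poly \<Rightarrow> 'a ^ 2 ^ 2 \<Rightarrow> 'a poly" where
  "poly_ract k P g = Polynomial.smult (det g powi (- int (k div 2)))
     (\<Sum>i\<le>k. Polynomial.smult (poly.coeff P i)
        ([:g $ 1 $ 2, g $ 1 $ 1:] ^ i * [:g $ 2 $ 2, g $ 2 $ 1:] ^ (k - i)))"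

definition poly_lact :: "nat \<Rightarrow> 'a::field ^ 2 ^ 2 \<Rightarrow> 'a poly \<Rightarrow> 'a poly" where
  "poly_lact k g P = poly_ract k P (matrix_inv g)"

definition poly_dual :: "nat \<Rightarrow> ('a::field poly \<Rightarrow> 'a) set" where
  "poly_dual k = {\<omega>. (\<forall>P\<in>poly_space k. \<forall>Q\<in>poly_space k. \<omega> (P + Q) = \<omega> P + \<omega> Q) \<and>
     (\<forall>c. \<forall>P\<in>poly_space k. \<omega> (Polynomial.smult c P) = c * \<omega> P) \<and>
     (\<forall>P. P \<notin> poly_space k \<longrightarrow> \<omega> P = 0)}"

definition poly_dual_act :: "nat \<Rightarrow> ('a::field poly \<Rightarrow> 'a) \<Rightarrow> 'a ^ 2 ^ 2 \<Rightarrow> 'a poly \<Rightarrow> 'a" where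
  "poly_dual_act k \<omega> g = (\<lambda>P. if P \<in> poly_space k then \<omega> (poly_lact k g P) else 0)"

definition tate :: "'p::prime_card padic fps set" where
  "tate = {f. (\<lambda>n. fps_nth f n) \<longlonglongrightarrow> 0}"

text \<open>
  The sup-norm on the Tate algebra is the supremum over the closed unit disc of an algebraic closure,
  which is the Gauss norm (not the supremum over \<open>\<int>\<^sub>p\<close>).
\<close>

definition gauss_norm :: "'p::prime_card padic fps \<Rightarrow> real" where
  "gauss_norm f = (SUP n. padic_norm (fps_nth f n))"

text \<open>
  Substitution \<open>f(h)\<close> by coefficientwise convergence in the p-adic topology. The library composition
  of formal power series does not apply, since here \<open>h\<close> may have a nonzero constant term.
\<close>

definition fps_subst :: "'p::prime_card padic fps \<Rightarrow> 'p padic fps \<Rightarrow> 'p padic fps" where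
  "fps_subst f h = Abs_fps (\<lambda>m. \<Sum>n. fps_nth f n * fps_nth (h ^ n) m)"

text \<open>
  The formula for \<open>\<sigma> \<in> \<Sigma>\<^sub>0(p)\<close> is invariant under scaling of \<open>\<sigma>\<close>, see \<open>tate_act_scalar\<close> below;
  thus it is used verbatim for elements \<open>u\<sigma>\<close> of \<open>\<rat>\<^sub>p\<^sup>\<times>\<Sigma>\<^sub>0(p)\<close>.
\<close>

definition tate_act :: "nat \<Rightarrow> 'p::prime_card padic ^ 2 ^ 2 \<Rightarrow> 'p padic fps \<Rightarrow> 'p padic fps" where
  "tate_act k s f =
     (let a = fps_const (s $ 1 $ 1); b = fps_const (s $ 1 $ 2);
          c = fps_const (s $ 2 $ 1); d = fps_const (s $ 2 $ 2)
      in fps_const (det s powi (- int (k div 2))) * (- c * fps_X + a) ^ k *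
         fps_subst f ((d * fps_X - b) * inverse (- c * fps_X + a)))"

lemma tate_act_scalar:
  assumes "even k" "u \<noteq> 0" "s \<in> Sigma0"
  shows "tate_act k (mat u ** s) f = tate_act k s f"
proof -
  let ?a = "fps_const (s $ 1 $ 1)" and ?b = "fps_const (s $ 1 $ 2)"
  let ?c = "fps_const (s $ 2 $ 1)" and ?d = "fps_const (s $ 2 $ 2)"
  obtain m where k: "k = 2 * m" using assms(1) by blast
  have d0: "det s \<noteq> 0" using assms(3) by (simp add: Sigma0_def)
  have e: "(mat u ** s) $ i $ j = u * s $ i $ j" for i j
    by (simp add: matrix_matrix_mult_def mat_def if_distrib[of "\<lambda>x. x * _"] cong: if_cong)
  have den: "- fps_const (u * s $ 2 $ 1) * fps_X + fps_const (u * s $ 1 $ 1)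
      = fps_const u * (- ?c * fps_X + ?a)"
    by (simp only: fps_const_mult[symmetric]) (simp only: algebra_simps mult_minus_left mult_minus_right)
  have num: "fps_const (u * s $ 2 $ 2) * fps_X - fps_const (u * s $ 1 $ 2)
      = fps_const u * (?d * fps_X - ?b)"
    by (simp only: fps_const_mult[symmetric]) (simp only: algebra_simps mult_minus_left mult_minus_right)
  have q: "fps_const u * (?d * fps_X - ?b) * inverse (fps_const u * (- ?c * fps_X + ?a))
      = (?d * fps_X - ?b) * inverse (- ?c * fps_X + ?a)"
  proof -
    have "fps_const u * inverse (fps_const u) = 1"
      using assms(2) by (simp add: fps_const_inverse)
    hence "(fps_const u * inverse (fps_const u)) * ((?d * fps_X - ?b) * inverse (- ?c * fps_X + ?a))
      = (?d * fps_X - ?b) * inverse (- ?c * fps_X + ?a)" by (simp only: mult_1_left)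
    hence "fps_const u * (?d * fps_X - ?b) * (inverse (fps_const u) * inverse (- ?c * fps_X + ?a))
      = (?d * fps_X - ?b) * inverse (- ?c * fps_X + ?a)" by (simp only: ac_simps)
    thus ?thesis by (simp only: fps_inverse_mult)
  qed
  have dt: "det (mat u ** s) = u\<^sup>2 * det s"
    by (simp add: det_2 e power2_eq_square algebra_simps)
  have "det (mat u ** s) powi (- int (k div 2)) * u ^ k = det s powi (- int (k div 2))"
    unfolding dt k using assms(2) d0
    by (simp add: power_int_minus power_mult_distrib power_mult[symmetric] field_simps)
  hence sc: "fps_const (det (mat u ** s) powi (- int (k div 2))) * fps_const u ^ k
      = fps_const (det s powi (- int (k div 2)))"
    by (simp add: fps_const_power)
  show ?thesis
    unfolding tate_act_def Let_def e den num q power_mult_distrib sc[symmetric]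
    by (simp only: mult.assoc)
qed

definition distributions :: "('p::prime_card padic fps \<Rightarrow> 'p padic) set" where
  "distributions = {\<omega>. (\<forall>f\<in>tate. \<forall>g\<in>tate. \<omega> (f + g) = \<omega> f + \<omega> g) \<and>
     (\<forall>c. \<forall>f\<in>tate. \<omega> (fps_const c * f) = c * \<omega> f) \<and>
     (\<forall>f\<in>tate. \<forall>e>0. \<exists>d>0. \<forall>g\<in>tate. gauss_norm (g - f) < d \<longrightarrow> dist (\<omega> g) (\<omega> f) < e) \<and>
     (\<forall>f. f \<notin> tate \<longrightarrow> \<omega> f = 0)}"

definition distr_act :: "nat \<Rightarrow> ('p::prime_card padic fps \<Rightarrow> 'p padic) \<Rightarrow> 'p padic ^ 2 ^ 2 \<Rightarrow>
    'p padic fps \<Rightarrow> 'p padic" where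
  "distr_act k \<omega> s = (\<lambda>f. if f \<in> tate then \<omega> (tate_act k s f) else 0)"

definition distr_to_dual :: "nat \<Rightarrow> ('p::prime_card padic fps \<Rightarrow> 'p padic) \<Rightarrow> 'p padic poly \<Rightarrow> 'p padic" where
  "distr_to_dual k \<omega> = (\<lambda>P. if P \<in> poly_space k then \<omega> (fps_of_poly P) else 0)"


section \<open>Automorphic forms, specialization and the operator \<open>U\<^sub>p\<close>\<close>

text \<open>
  Coefficient modules \<open>V\<close> are sets of \<open>\<rat>\<^sub>p\<close>-valued functions on some type \<open>'x\<close>, with right action \<open>act\<close>.
\<close>

definition aut_forms :: "('p::prime_card padic ^ 2 ^ 2) set \<Rightarrow> ('x \<Rightarrow> 'p padic) set \<Rightarrow>
    (('x \<Rightarrow> 'p padic) \<Rightarrow> 'p padic ^ 2 ^ 2 \<Rightarrow> 'x \<Rightarrow> 'p padic) \<Rightarrow>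
    ('p padic ^ 2 ^ 2 \<Rightarrow> 'x \<Rightarrow> 'p padic) set" where
  "aut_forms \<Gamma> V act = {\<phi>. (\<forall>g. invertible g \<longrightarrow> \<phi> g \<in> V) \<and> (\<forall>g. \<not> invertible g \<longrightarrow> \<phi> g = 0) \<and>
     (\<forall>u \<gamma> g \<sigma>. u \<noteq> 0 \<and> \<gamma> \<in> \<Gamma> \<and> invertible g \<and> \<sigma> \<in> Gamma0 \<longrightarrow>
        \<phi> (mat u ** \<gamma> ** g ** \<sigma>) = act (\<phi> g) \<sigma>)}"

definition scale_form :: "'a::times \<Rightarrow> ('g \<Rightarrow> 'x \<Rightarrow> 'a) \<Rightarrow> 'g \<Rightarrow> 'x \<Rightarrow> 'a" where
  "scale_form c \<phi> = (\<lambda>g x. c * \<phi> g x)"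

definition alpha :: "nat \<Rightarrow> 'p::prime_card padic ^ 2 ^ 2" where
  "alpha j = vector [vector [of_nat CARD('p), of_nat j], vector [0, 1]]"

definition U_op :: "nat \<Rightarrow> (('x \<Rightarrow> 'p padic) \<Rightarrow> 'p padic ^ 2 ^ 2 \<Rightarrow> 'x \<Rightarrow> 'p padic) \<Rightarrow>
    ('p::prime_card padic ^ 2 ^ 2 \<Rightarrow> 'x \<Rightarrow> 'p padic) \<Rightarrow> 'p padic ^ 2 ^ 2 \<Rightarrow> 'x \<Rightarrow> 'p padic" where
  "U_op k act \<phi> = (\<lambda>g x. of_nat CARD('p) ^ (k div 2) *
     (\<Sum>j<CARD('p). act (\<phi> (g ** alpha j)) (matrix_inv (alpha j)) x))"

definition U_eigenspace :: "nat \<Rightarrow> (('x \<Rightarrow> 'p padic) \<Rightarrow> 'p padic ^ 2 ^ 2 \<Rightarrow> 'x \<Rightarrow> 'p padic) \<Rightarrow>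
    'p padic \<Rightarrow> ('p::prime_card padic ^ 2 ^ 2 \<Rightarrow> 'x \<Rightarrow> 'p padic) set \<Rightarrow>
    ('p padic ^ 2 ^ 2 \<Rightarrow> 'x \<Rightarrow> 'p padic) set" where
  "U_eigenspace k act c A = {\<phi> \<in> A. U_op k act \<phi> = scale_form c \<phi>}"

definition classical_forms :: "nat \<Rightarrow> ('p::prime_card padic ^ 2 ^ 2) set \<Rightarrow>
    ('p padic ^ 2 ^ 2 \<Rightarrow> 'p padic poly \<Rightarrow> 'p padic) set" where
  "classical_forms k \<Gamma> = aut_forms \<Gamma> (poly_dual k) (poly_dual_act k)"

definition rigid_forms :: "nat \<Rightarrow> ('p::prime_card padic ^ 2 ^ 2) set \<Rightarrow>
    ('p padic ^ 2 ^ 2 \<Rightarrow> 'p padic fps \<Rightarrow> 'p padic) set" where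
  "rigid_forms k \<Gamma> = aut_forms \<Gamma> distributions (distr_act k)"

definition specialization :: "nat \<Rightarrow> ('p::prime_card padic ^ 2 ^ 2 \<Rightarrow> 'p padic fps \<Rightarrow> 'p padic) \<Rightarrow>
    'p padic ^ 2 ^ 2 \<Rightarrow> 'p padic poly \<Rightarrow> 'p padic" where
  "specialization k \<Phi> = (\<lambda>g. distr_to_dual k (\<Phi> g))"

definition is_linear_iso :: "('g \<Rightarrow> 'x \<Rightarrow> 'a::field) set \<Rightarrow> ('h \<Rightarrow> 'y \<Rightarrow> 'a) set \<Rightarrow>
    (('g \<Rightarrow> 'x \<Rightarrow> 'a) \<Rightarrow> 'h \<Rightarrow> 'y \<Rightarrow> 'a) \<Rightarrow> bool" where
  "is_linear_iso E F \<rho> \<longleftrightarrow>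
     module.subspace scale_form E \<and> module.subspace scale_form F \<and> bij_betw \<rho> E F \<and>
     (\<forall>\<Phi>\<in>E. \<forall>\<Psi>\<in>E. \<rho> (\<Phi> + \<Psi>) = \<rho> \<Phi> + \<rho> \<Psi>) \<and>
     (\<forall>c. \<forall>\<Phi>\<in>E. \<rho> (scale_form c \<Phi>) = scale_form c (\<rho> \<Phi>))"

end

theory Submission
  imports Defs
begin

text \<open>
  The operator \<open>U\<^sub>p\<close> substitutes \<open>j + px\<close> into the argument of a functional:
  \<open>(U\<^sub>p\<Phi>)(g)(f) = \<Sum>\<^sub>j \<Phi>(g\<alpha>\<^sub>j)(f(j + px))\<close>, because the normalising powers of \<open>p\<close> cancel. The coefficient of
  \<open>x\<^sup>i\<close> in \<open>f(j + px)\<close> is divisible by \<open>p\<^sup>i\<close>. So on functionals that vanish on \<open>\<P>\<^sub>k\<close> only terms of degree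
  at least \<open>k + 1\<close> count, and \<open>p\<^sup>-\<^sup>k\<^sup>/\<^sup>2 U\<^sub>p\<close> shrinks norms by the factor \<open>p\<^sup>-\<^sup>(\<^sup>k\<^sup>/\<^sup>2\<^sup>+\<^sup>1\<^sup>)\<close>: the slope \<open>k/2\<close> is
  smaller than \<open>k + 1\<close>. This is the lemma \<open>U_contraction\<close>, on which both halves of the proof rest.

  \<^item> Injectivity: the difference of two eigenforms with the same specialization vanishes on \<open>\<P>\<^sub>k\<close> and
    is fixed by the contraction. Being bounded, it is zero.
  \<^item> Surjectivity: given a classical eigenform \<open>\<phi>\<close>, lift it by Taylor truncation, \<open>f \<mapsto> \<phi>(g)(T\<^sub>k f)\<close>, and
    iterate \<open>p\<^sup>-\<^sup>k\<^sup>/\<^sup>2 U\<^sub>p\<close>. Successive differences vanish on \<open>\<P>\<^sub>k\<close> since \<open>\<phi>\<close> is an eigenform, so the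
    iterates converge. The truncation need not be equivariant under \<open>\<Gamma>\<^sub>0(p)\<close>, but the defect vanishes on
    \<open>\<P>\<^sub>k\<close> too and satisfies the same recursion, since \<open>\<Gamma>\<^sub>0(p)\<close> permutes the cosets \<open>\<alpha>\<^sub>j\<Gamma>\<^sub>0(p)\<close>; hence it
    tends to zero.

  Both arguments need a bound that is uniform in \<open>g\<close>. As \<open>\<Gamma>\<^sub>0(p)\<close> acts by isometries, it exists once
  \<open>\<rat>\<^sub>p\<^sup>\<times>\<Gamma>\<close> and \<open>\<Gamma>\<^sub>0(p)\<close> have finitely many double cosets in \<open>GL\<^sub>2(\<rat>\<^sub>p)\<close>, and this is where definiteness of
  the quaternion algebra enters (\<open>finite_double_cosets\<close>). Scale \<open>g\<close> to be primitive, with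
  \<open>\<bar>det g\<bar> = p\<^sup>-\<^sup>v\<close>. By the pigeonhole principle \<open>R\<close> contains a nonzero \<open>x\<close> with image \<open>gm\<close>, \<open>m\<close> integral,
  whose coordinates have size about \<open>p\<^sup>v\<^sup>/\<^sup>2\<close>. As the norm form is definite, the norm of \<open>x\<close> is \<open>np\<^sup>v\<close> with
  \<open>n\<close> bounded. If two matrices \<open>g\<close>, \<open>g'\<close> give the same \<open>n\<close>, the same parity of \<open>v\<close>, congruent \<open>x\<close>, \<open>x'\<close>
  modulo \<open>nR\<close>, and congruent \<open>m\<close>, \<open>m'\<close> modulo a high power of \<open>p\<close>, then \<open>x'x\<^sup>-\<^sup>1\<close> times a power of \<open>p\<close> lies in
  \<open>\<Gamma>\<close> and \<open>m(m')\<^sup>-\<^sup>1\<close> in \<open>\<Gamma>\<^sub>0(p)\<close>, so \<open>g\<close> and \<open>g'\<close> represent the same double coset.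

  Identities between operators on the Tate algebra, such as multiplicativity of substitution, are checked
  on monomials, which suffices by density (\<open>tate_functional_eq_0\<close>).
\<close>

(* The dollar sign is to denote entries of vectors, not coefficients of series. *)
unbundle no Formal_Power_Series.fps_syntax

section \<open>The p-adic absolute value\<close>

lemma CARD_gt_1: "1 < CARD('p::prime_card)"
  by (rule prime_gt_1_nat[OF prime_card])

lemma CARD_gt_1_real: "1 < real CARD('p::prime_card)"
  using CARD_gt_1[where 'p='p] by linarith

lemma padic_norm_0 [simp]: "padic_norm (0 :: 'p::prime_card padic) = 0"
  by (simp add: padic_norm_eq_0_iff)

lemma padic_norm_1 [simp]: "padic_norm (1 :: 'p::prime_card padic) = 1"
  using padic_norm_of_rat[of 1, where 'p='p] by (simp add: padic_abs_1[OF prime_card])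

lemma padic_norm_pos: "x \<noteq> 0 \<Longrightarrow> padic_norm (x :: 'p::prime_card padic) > 0"
  using padic_norm_nonneg[of x] padic_norm_eq_0_iff[of x] by linarith

lemma padic_norm_diff: "padic_norm (x - y) \<le> max (padic_norm x) (padic_norm (y :: 'p::prime_card padic))"
  using padic_norm_add[of x "-y"] by simp

lemma padic_norm_minus_commute: "padic_norm (x - y) = padic_norm (y - x :: 'p::prime_card padic)"
  using padic_norm_minus[of "x - y"] by simp

lemma padic_norm_power: "padic_norm (x ^ n) = padic_norm (x :: 'p::prime_card padic) ^ n"
  by (induction n) (simp_all add: padic_norm_mult)

lemma padic_norm_inverse: "padic_norm (inverse x) = inverse (padic_norm (x :: 'p::prime_card padic))"
proof (cases "x = 0")
  case False
  have "padic_norm x * padic_norm (inverse x) = 1"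
    using False padic_norm_mult[of x "inverse x"] by simp
  thus ?thesis by (rule inverse_unique[symmetric])
qed simp

lemma padic_norm_divide: "padic_norm (x / y) = padic_norm x / padic_norm (y :: 'p::prime_card padic)"
  by (simp add: divide_inverse padic_norm_mult padic_norm_inverse)

lemma padic_norm_power_int: "padic_norm (x powi n) = padic_norm (x :: 'p::prime_card padic) powi n"
  by (cases "n \<ge> 0") (simp_all add: power_int_def padic_norm_power padic_norm_inverse)

lemma padic_norm_sum_le:
  assumes "\<And>i. i \<in> A \<Longrightarrow> padic_norm (f i :: 'p::prime_card padic) \<le> C" "C \<ge> 0"
  shows "padic_norm (sum f A) \<le> C"
  using assms(1)
proof (induction A rule: infinite_finite_induct)
  case (insert x F)
  have "padic_norm (f x + sum f F) \<le> max (padic_norm (f x)) (padic_norm (sum f F))"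
    by (rule padic_norm_add)
  also have "\<dots> \<le> C" using insert by simp
  finally show ?case using insert by simp
qed (use assms(2) in auto)

lemma padic_norm_close:
  assumes "padic_norm (x - y) < padic_norm (x :: 'p::prime_card padic)"
  shows "padic_norm y = padic_norm x"
proof (rule antisym)
  show "padic_norm y \<le> padic_norm x"
    using padic_norm_diff[of x "x - y"] assms by simp
  show "padic_norm x \<le> padic_norm y"
    using padic_norm_add[of "x - y" y] assms by simp
qed

lemma padic_norm_of_int_le: "padic_norm (of_int n :: 'p::prime_card padic) \<le> 1"
proof (cases "n = 0")
  case False
  have "padic_val CARD('p) (of_int n / of_int 1) \<ge> 0"
    using False by (subst padic_val_frac[OF prime_card]) auto
  hence "real CARD('p) powi (- padic_val CARD('p) (of_int n)) \<le> real CARD('p) powi 0"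
    using CARD_gt_1_real[where 'p='p] by (intro power_int_increasing) auto
  thus ?thesis using False padic_norm_of_rat[of "of_int n", where 'p='p] by (simp add: padic_abs_def)
qed simp

lemma padic_norm_of_nat_le: "padic_norm (of_nat n :: 'p::prime_card padic) \<le> 1"
  using padic_norm_of_int_le[of "int n", where 'p='p] by simp

lemma padic_norm_p: "padic_norm (of_nat CARD('p) :: 'p::prime_card padic) = 1 / real CARD('p)"
proof -
  have p: "prime_elem (int CARD('p))" using prime_card[where 'a='p] by (simp add: prime_imp_prime_elem)
  have "padic_val CARD('p) (of_int (int CARD('p)) / of_int 1) = 1"
    using p by (subst padic_val_frac[OF prime_card]) (auto simp: prime_elem_def)
  thus ?thesis using padic_norm_of_rat[of "of_nat CARD('p)", where 'p='p]
    by (simp add: padic_abs_def power_int_minus divide_simps)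
qed

lemma padic_norm_p_power: "padic_norm (of_nat CARD('p) ^ n :: 'p::prime_card padic) = 1 / real CARD('p) ^ n"
  by (simp add: padic_norm_power padic_norm_p power_one_over)

lemma padic_norm_of_int_le_iff:
  "padic_norm (of_int n :: 'p::prime_card padic) \<le> 1 / real CARD('p) ^ v \<longleftrightarrow> int CARD('p) ^ v dvd n"
proof (cases "n = 0")
  case False
  have "padic_val CARD('p) (of_int n / of_int 1) = int (multiplicity (int CARD('p)) n)"
    using False by (subst padic_val_frac[OF prime_card]) auto
  hence "padic_norm (of_int n :: 'p padic) = 1 / real CARD('p) ^ multiplicity (int CARD('p)) n"
    using False padic_norm_of_rat[of "of_int n", where 'p='p]
    by (simp add: padic_abs_def power_int_minus divide_simps)
  moreover have "int CARD('p) ^ v dvd n \<longleftrightarrow> v \<le> multiplicity (int CARD('p)) n"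
    using False CARD_gt_1[where 'p='p] by (intro power_dvd_iff_le_multiplicity) auto
  moreover have "1 / real CARD('p) ^ m \<le> 1 / real CARD('p) ^ v \<longleftrightarrow> v \<le> m" for m
    using CARD_gt_1_real[where 'p='p] by (simp add: divide_simps)
  ultimately show ?thesis by simp
qed simp

lemma padic_approx:
  assumes "e > 0"
  obtains r where "padic_norm (x - of_rat r :: 'p::prime_card padic) < e"
proof -
  obtain X where X: "padic_cauchy CARD('p) X" "x = padic_of_seq X" by (rule padic_of_seq_surj)
  obtain N where N: "\<forall>m\<ge>N. \<forall>n\<ge>N. padic_abs CARD('p) (X m - X n) < e / 2"
    using X(1) assms unfolding padic_cauchy_def by (meson half_gt_zero)
  note c = padic_cauchy_const[OF prime_card[where 'a='p], of "X N"]
  have eq: "x - of_rat (X N) = padic_of_seq (\<lambda>n. X n - X N)"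
    unfolding X(2) padic_of_seq_of_rat[symmetric] by (rule padic_of_seq_diff[OF X(1) c])
  have cc: "padic_cauchy CARD('p) (\<lambda>n. X n - X N)"
    using padic_cauchy_add[OF prime_card X(1) padic_cauchy_const[OF prime_card, of "- X N"]] by simp
  have "padic_norm (x - of_rat (X N)) \<le> e / 2"
    unfolding eq by (rule LIMSEQ_le_const2[OF padic_norm_of_seq[OF cc]]) (use N in \<open>auto intro!: exI[of _ N] less_imp_le\<close>)
  thus thesis using assms by (intro that[of "X N"]) linarith
qed

lemma padic_norm_discrete:
  assumes "x \<noteq> (0 :: 'p::prime_card padic)"
  obtains i :: int where "padic_norm x = real CARD('p) powi i"
proof -
  obtain r where r: "padic_norm (x - of_rat r) < padic_norm x"
    using padic_approx[OF padic_norm_pos[OF assms]] by blast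
  have e: "padic_norm x = padic_abs CARD('p) r"
    using padic_norm_close[OF r] by (simp add: padic_norm_of_rat)
  moreover have "r \<noteq> 0" using e padic_norm_pos[OF assms] by (auto simp: padic_abs_def)
  ultimately show thesis using that by (auto simp: padic_abs_def)
qed

lemma padic_norm_less_1:
  assumes "padic_norm (x :: 'p::prime_card padic) < 1"
  shows "padic_norm x \<le> 1 / real CARD('p)"
proof (cases "x = 0")
  case False
  then obtain i where i: "padic_norm x = real CARD('p) powi i" by (rule padic_norm_discrete)
  have "i < 0"
  proof (rule ccontr)
    assume "\<not> i < 0"
    hence "real CARD('p) powi 0 \<le> real CARD('p) powi i"
      using CARD_gt_1_real[where 'p='p] by (intro power_int_increasing) auto
    thus False using assms i by simp
  qed
  hence "real CARD('p) powi i \<le> real CARD('p) powi (-1)"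
    using CARD_gt_1_real[where 'p='p] by (intro power_int_increasing) auto
  thus ?thesis by (simp add: i power_int_minus divide_simps)
qed simp

text \<open>A rational number close to a p-adic integer has a denominator prime to \<open>p\<close>, and that denominator is
  invertible modulo \<open>p\<^sup>n\<close>.\<close>

lemma padic_residue_exists:
  assumes "padic_norm (x :: 'p::prime_card padic) \<le> 1"
  shows "\<exists>r<CARD('p) ^ n. padic_norm (x - of_nat r) \<le> 1 / real CARD('p) ^ n"
proof -
  let ?p = "CARD('p)" and ?q = "int CARD('p) ^ n"
  have q: "?q > 0" using CARD_gt_1[where 'p='p] by simp
  obtain s where s: "padic_norm (x - of_rat s) < 1 / real ?p ^ n"
    using padic_approx[of "1 / real ?p ^ n" x] by (auto simp: prime_gt_0_nat[OF prime_card])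
  have "1 / real ?p ^ n \<le> 1" using CARD_gt_1_real[where 'p='p] by simp
  hence s1: "padic_norm (of_rat s :: 'p padic) \<le> 1"
    using padic_norm_diff[of x "x - of_rat s", simplified] assms s by linarith
  obtain a d where ad: "quotient_of s = (a, d)" by force
  have d: "d > 0" using quotient_of_denom_pos[OF ad] .
  have sd: "(of_rat s :: 'p padic) * of_int d = of_int a"
    using quotient_of_div[OF ad] d by (simp add: of_rat_divide)
  have cop: "coprime a d" using quotient_of_coprime[OF ad] .
  have "\<not> int ?p dvd d"
  proof
    assume pd: "int ?p dvd d"
    hence "padic_norm (of_int d :: 'p padic) \<le> 1 / real ?p"
      using padic_norm_of_int_le_iff[where 'p='p, of d 1] by simp
    hence "padic_norm (of_rat s * of_int d :: 'p padic) \<le> 1 * (1 / real ?p)"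
      unfolding padic_norm_mult using s1 by (intro mult_mono) auto
    hence "int ?p dvd a" using padic_norm_of_int_le_iff[where 'p='p, of a 1] sd by simp
    with pd cop have "int ?p dvd 1" by (meson coprime_common_divisor)
    thus False using CARD_gt_1[where 'p='p] by simp
  qed
  hence copd: "coprime d ?q" and nd: "padic_norm (of_int d :: 'p padic) = 1"
  proof -
    assume nd: "\<not> int ?p dvd d"
    have "prime (int ?p)" using prime_card[where 'a='p] by simp
    hence "coprime (int ?p) d" using nd by (rule prime_imp_coprime)
    thus "coprime d ?q" by (simp add: coprime_commute)
    have "\<not> padic_norm (of_int d :: 'p padic) \<le> 1 / real ?p"
      using nd padic_norm_of_int_le_iff[where 'p='p, of d 1] by simp
    thus "padic_norm (of_int d :: 'p padic) = 1"
      using padic_norm_less_1[of "of_int d :: 'p padic"] padic_norm_of_int_le[of d, where 'p='p] by fastforce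
  qed
  obtain e where e: "[d * e = 1] (mod ?q)" using cong_solve_coprime_int[OF copd] by blast
  define r where "r = nat ((a * e) mod ?q)"
  have r: "int r = (a * e) mod ?q" using q by (simp add: r_def)
  have "[d * int r = d * (a * e)] (mod ?q)" unfolding r by (simp add: unique_euclidean_semiring_class.cong_def mod_mult_right_eq)
  also have "d * (a * e) = a * (d * e)" by simp
  also have "[a * (d * e) = a * 1] (mod ?q)" by (rule cong_scalar_left[OF e])
  finally have "[a = d * int r] (mod ?q)" by (simp add: cong_sym_eq)
  hence "?q dvd a - d * int r" by (simp add: cong_iff_dvd_diff)
  hence "padic_norm (of_int (a - d * int r) :: 'p padic) \<le> 1 / real ?p ^ n"
    by (simp only: padic_norm_of_int_le_iff)
  also have "(of_int (a - d * int r) :: 'p padic) = (of_rat s - of_nat r) * of_int d"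
    using sd by (simp add: algebra_simps)
  finally have "padic_norm (of_rat s - of_nat r :: 'p padic) \<le> 1 / real ?p ^ n"
    by (simp add: padic_norm_mult nd)
  hence "padic_norm (x - of_nat r) \<le> 1 / real ?p ^ n"
    using padic_norm_add[of "x - of_rat s" "of_rat s - of_nat r"] s by simp
  moreover have "r < ?p ^ n"
  proof -
    have "int r < ?q" unfolding r using q by simp
    thus ?thesis by (simp only: of_nat_power[symmetric] of_nat_less_iff)
  qed
  ultimately show ?thesis by blast
qed

definition padic_residue :: "nat \<Rightarrow> 'p::prime_card padic \<Rightarrow> nat" where
  "padic_residue n x = (SOME r. r < CARD('p) ^ n \<and> padic_norm (x - of_nat r) \<le> 1 / real CARD('p) ^ n)"

lemma padic_residue:
  assumes "padic_norm (x :: 'p::prime_card padic) \<le> 1"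
  shows "padic_residue n x < CARD('p) ^ n"
    and "padic_norm (x - of_nat (padic_residue n x)) \<le> 1 / real CARD('p) ^ n"
  using someI_ex[OF padic_residue_exists[OF assms, of n]] by (auto simp: padic_residue_def)

lemma padic_residue_eq:
  assumes "padic_norm (x :: 'p::prime_card padic) \<le> 1" "padic_norm y \<le> 1"
    and "padic_residue n x = padic_residue n y"
  shows "padic_norm (x - y) \<le> 1 / real CARD('p) ^ n"
proof -
  have "x - y = (x - of_nat (padic_residue n x)) - (y - of_nat (padic_residue n y))"
    using assms(3) by simp
  thus ?thesis
    using padic_norm_diff[of "x - of_nat (padic_residue n x)" "y - of_nat (padic_residue n y)"]
      padic_residue(2)[OF assms(1), of n] padic_residue(2)[OF assms(2), of n] by simp
qed

lemma padic_residue_unique: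
  assumes "r < CARD('p)" "s < CARD('p)" "padic_norm (of_nat r - of_nat s :: 'p::prime_card padic) < 1"
  shows "r = s"
proof -
  have "padic_norm (of_int (int r - int s) :: 'p padic) \<le> 1 / real CARD('p) ^ 1"
    using padic_norm_less_1[OF assms(3)] by simp
  hence "int CARD('p) ^ 1 dvd int r - int s" by (simp only: padic_norm_of_int_le_iff)
  hence "int r mod int CARD('p) = int s mod int CARD('p)" by (simp add: mod_eq_dvd_iff)
  thus ?thesis using assms(1,2) by simp
qed

text \<open>A Cauchy sequence is approximated by a Cauchy sequence of rationals, whose class is the limit.\<close>

instance padic :: (prime_card) complete_space
proof
  fix X :: "nat \<Rightarrow> 'a padic"
  assume C: "Cauchy X"
  have "\<exists>r. padic_norm (X n - of_rat r) < 1 / real (Suc n)" for n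
    using padic_approx[of "1 / real (Suc n)" "X n"] by (metis of_nat_0_less_iff zero_less_Suc zero_less_divide_1_iff)
  then obtain r where r: "\<And>n. padic_norm (X n - of_rat (r n)) < 1 / real (Suc n)" by metis
  have inv: "\<exists>N. \<forall>n\<ge>N. 1 / real (Suc n) < e" if "e > 0" for e :: real
  proof -
    obtain N where N: "1 / real (Suc N) < e" using nat_approx_posE[OF \<open>e > 0\<close>] by blast
    have "1 / real (Suc n) < e" if "n \<ge> N" for n
      using N that by (smt (verit) frac_le of_nat_0_less_iff of_nat_mono Suc_le_mono zero_less_Suc)
    thus ?thesis by blast
  qed
  have rc: "padic_cauchy CARD('a) r"
    unfolding padic_cauchy_def
  proof safe
    fix e :: real assume e: "e > 0"
    obtain M where M: "\<forall>m\<ge>M. \<forall>n\<ge>M. padic_norm (X m - X n) < e"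
      using C e unfolding Cauchy_def dist_padic_def by blast
    obtain N where N: "\<forall>n\<ge>N. 1 / real (Suc n) < e" using inv[OF e] by blast
    show "\<exists>N. \<forall>m\<ge>N. \<forall>n\<ge>N. padic_abs CARD('a) (r m - r n) < e"
    proof (intro exI[of _ "max M N"] allI impI)
      fix m n assume mn: "max M N \<le> m" "max M N \<le> n"
      have "padic_norm (of_rat (r m) - X m) < e" "padic_norm (X n - of_rat (r n)) < e" "padic_norm (X m - X n) < e"
        using r[of m] r[of n] N[rule_format, of m] N[rule_format, of n] M mn
        by (auto simp: padic_norm_minus_commute[of _ "X m"] simp del: of_nat_Suc)
      moreover have "of_rat (r m) - of_rat (r n) = (of_rat (r m) - X m) + ((X m - X n) + (X n - of_rat (r n)))" by simp
      ultimately have "padic_norm (of_rat (r m) - of_rat (r n) :: 'a padic) < e"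
        using padic_norm_add[of "of_rat (r m) - X m" "(X m - X n) + (X n - of_rat (r n))"]
          padic_norm_add[of "X m - X n" "X n - of_rat (r n)"] by simp
      thus "padic_abs CARD('a) (r m - r n) < e"
        by (simp only: of_rat_diff[symmetric] padic_norm_of_rat)
    qed
  qed
  have "X \<longlonglongrightarrow> padic_of_seq r"
    unfolding LIMSEQ_iff_nz[symmetric] lim_sequentially dist_padic_def
  proof (intro allI impI)
    fix e :: real assume e: "e > 0"
    obtain M where M: "\<forall>m\<ge>M. \<forall>n\<ge>M. padic_abs CARD('a) (r m - r n) < e / 2"
      using rc e unfolding padic_cauchy_def by (meson half_gt_zero)
    obtain N where N: "\<forall>n\<ge>N. 1 / real (Suc n) < e" using inv[OF e] by blast
    show "\<exists>N. \<forall>n\<ge>N. padic_norm (X n - padic_of_seq r) < e"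
    proof (intro exI[of _ "max M N"] allI impI)
      fix n assume n: "max M N \<le> n"
      note c = padic_cauchy_const[OF prime_card[where 'a='a], of "r n"]
      have cc: "padic_cauchy CARD('a) (\<lambda>m. r n - r m)"
        using padic_cauchy_add[OF prime_card c padic_cauchy_minus[OF prime_card rc]] by simp
      have "padic_norm (padic_of_seq (\<lambda>m. r n - r m) :: 'a padic) \<le> e / 2"
        by (rule LIMSEQ_le_const2[OF padic_norm_of_seq[OF cc]])
          (use M n in \<open>auto intro!: exI[of _ M] less_imp_le\<close>)
      hence "padic_norm (of_rat (r n) - padic_of_seq r :: 'a padic) \<le> e / 2"
        by (simp add: padic_of_seq_diff[OF c rc, symmetric] padic_of_seq_of_rat)
      moreover have "padic_norm (X n - of_rat (r n)) < e"
        using r[of n] N n by (meson less_trans max.boundedE)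
      ultimately show "padic_norm (X n - padic_of_seq r) < e"
        using padic_norm_add[of "X n - of_rat (r n)" "of_rat (r n) - padic_of_seq r"] e by simp
    qed
  qed
  thus "convergent X" by (auto simp: convergent_def)
qed

lemma padic_tendsto_iff: "X \<longlonglongrightarrow> l \<longleftrightarrow> (\<lambda>n. padic_norm (X n - l)) \<longlonglongrightarrow> (0::real)"
  for l :: "'p::prime_card padic"
  by (simp add: tendsto_dist_iff[of X l] dist_padic_def)

lemma padic_tendsto_0_iff: "X \<longlonglongrightarrow> 0 \<longleftrightarrow> (\<forall>e>0. \<exists>N. \<forall>n\<ge>N. padic_norm (X n :: 'p::prime_card padic) < e)"
  by (simp add: lim_sequentially dist_padic_def)

lemma tendsto_padic_norm:
  assumes "X \<longlonglongrightarrow> (l :: 'p::prime_card padic)"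
  shows "(\<lambda>n. padic_norm (X n)) \<longlonglongrightarrow> padic_norm l"
  using tendsto_dist[OF assms tendsto_const[of "0 :: 'p padic"]] by (simp add: dist_padic_def)

instance padic :: (prime_card) topological_monoid_add
proof
  fix a b :: "'a padic"
  have "((\<lambda>x. fst x + snd x) \<longlongrightarrow> a + b) (nhds a \<times>\<^sub>F nhds b)"
  proof (rule tendstoI)
    fix e :: real assume "e > 0"
    hence "eventually (\<lambda>x. dist x a < e) (nhds a)" "eventually (\<lambda>x. dist x b < e) (nhds b)"
      by (auto simp: eventually_nhds_metric)
    thus "eventually (\<lambda>x. dist (fst x + snd x) (a + b) < e) (nhds a \<times>\<^sub>F nhds b)"
      unfolding eventually_prod_filter
    proof (intro exI conjI allI impI)
      fix x y assume "dist x a < e" "dist y b < e"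
      thus "dist (fst (x, y) + snd (x, y)) (a + b) < e"
        using padic_norm_add[of "x - a" "y - b"] by (simp add: dist_padic_def algebra_simps)
    qed auto
  qed
  thus "LIM x (nhds a \<times>\<^sub>F nhds b). fst x + snd x :> nhds (a + b)" .
qed

instance padic :: (prime_card) topological_comm_monoid_add ..

lemma padic_tendsto_mult_left:
  assumes "X \<longlonglongrightarrow> (l :: 'p::prime_card padic)"
  shows "(\<lambda>n. c * X n) \<longlonglongrightarrow> c * l"
proof -
  have "(\<lambda>n. padic_norm c * padic_norm (X n - l)) \<longlonglongrightarrow> padic_norm c * 0"
    using assms unfolding padic_tendsto_iff by (intro tendsto_intros)
  thus ?thesis unfolding padic_tendsto_iff[of "\<lambda>n. c * X n"]
    by (simp add: padic_norm_mult right_diff_distrib[symmetric])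
qed

text \<open>The ultrametric inequality bounds a block of a series by its largest term.\<close>

lemma padic_summable:
  assumes "a \<longlonglongrightarrow> (0 :: 'p::prime_card padic)"
  shows "summable a"
proof -
  have "Cauchy (\<lambda>n. \<Sum>i<n. a i)"
  proof (rule metric_CauchyI)
    fix e :: real assume e: "e > 0"
    then obtain N where N: "\<forall>n\<ge>N. padic_norm (a n) < e / 2"
      using assms unfolding padic_tendsto_0_iff by (meson half_gt_zero)
    have *: "dist (\<Sum>i<m. a i) (\<Sum>i<n. a i) < e" if "m \<ge> n" "n \<ge> N" for m n
    proof -
      have "(\<Sum>i<m. a i) - (\<Sum>i<n. a i) = (\<Sum>i\<in>{n..<m}. a i)"
        using that by (simp add: sum_diff_nat_ivl lessThan_atLeast0)
      moreover have "padic_norm (\<Sum>i\<in>{n..<m}. a i) \<le> e / 2"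
        using that N e by (intro padic_norm_sum_le) (auto intro: less_imp_le)
      ultimately show ?thesis using e by (simp add: dist_padic_def)
    qed
    show "\<exists>M. \<forall>m\<ge>M. \<forall>n\<ge>M. dist (\<Sum>i<m. a i) (\<Sum>i<n. a i) < e"
      using * by (metis dist_commute nle_le)
  qed
  thus ?thesis by (simp add: summable_iff_convergent Cauchy_convergent)
qed

lemma padic_suminf_norm_le:
  assumes "summable a" "\<And>n. padic_norm (a n :: 'p::prime_card padic) \<le> C" "C \<ge> 0"
  shows "padic_norm (suminf a) \<le> C"
  by (rule LIMSEQ_le_const2[OF tendsto_padic_norm[OF summable_LIMSEQ[OF assms(1)]]])
    (use assms in \<open>auto intro!: padic_norm_sum_le\<close>)

lemma padic_suminf_mult:
  assumes "summable (a :: nat \<Rightarrow> 'p::prime_card padic)"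
  shows "(\<Sum>n. c * a n) = c * suminf a"
proof (rule sums_unique[symmetric])
  show "(\<lambda>n. c * a n) sums (c * suminf a)"
    using padic_tendsto_mult_left[OF summable_LIMSEQ[OF assms]]
    by (simp add: sums_def sum_distrib_left)
qed

section \<open>The Tate algebra\<close>

lemma tate_iff: "f \<in> tate \<longleftrightarrow> (\<forall>e>0. \<exists>N. \<forall>n\<ge>N. padic_norm (fps_nth f n) < e)"
  for f :: "'p::prime_card padic fps"
  by (simp add: tate_def padic_tendsto_0_iff)

lemma tate_bounded:
  assumes "f \<in> (tate :: 'p::prime_card padic fps set)"
  shows "bdd_above (range (\<lambda>n. padic_norm (fps_nth f n)))"
proof -
  have "(\<lambda>n. padic_norm (fps_nth f n)) \<longlonglongrightarrow> 0"
    using assms tendsto_padic_norm[of "fps_nth f" 0] by (simp add: tate_def)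
  hence "Bseq (\<lambda>n. padic_norm (fps_nth f n))" by (rule convergent_imp_Bseq[OF convergentI])
  thus ?thesis by (auto simp: Bseq_def bdd_above_def)
qed

lemma coeff_le_gauss_norm:
  "f \<in> (tate :: 'p::prime_card padic fps set) \<Longrightarrow> padic_norm (fps_nth f n) \<le> gauss_norm f"
  unfolding gauss_norm_def by (rule cSUP_upper[OF UNIV_I tate_bounded])

lemma gauss_norm_le:
  "(\<And>n. padic_norm (fps_nth f n) \<le> C) \<Longrightarrow> gauss_norm (f :: 'p::prime_card padic fps) \<le> C"
  unfolding gauss_norm_def by (rule cSUP_least) auto

lemma gauss_norm_nonneg: "f \<in> (tate :: 'p::prime_card padic fps set) \<Longrightarrow> 0 \<le> gauss_norm f"
  using coeff_le_gauss_norm[of f 0] padic_norm_nonneg[of "fps_nth f 0"] by linarith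

lemma gauss_norm_eq_0: "f \<in> (tate :: 'p::prime_card padic fps set) \<Longrightarrow> gauss_norm f = 0 \<Longrightarrow> f = 0"
  using coeff_le_gauss_norm[of f] by (intro fps_ext) (simp add: padic_norm_eq_0_iff[symmetric] antisym)

lemma gauss_norm_0 [simp]: "gauss_norm (0 :: 'p::prime_card padic fps) = 0"
  by (simp add: gauss_norm_def)

lemma tate_add: "f \<in> tate \<Longrightarrow> g \<in> tate \<Longrightarrow> f + g \<in> (tate :: 'p::prime_card padic fps set)"
proof -
  assume "f \<in> tate" "g \<in> tate"
  moreover have "fps_nth (f + g) = (\<lambda>n. fps_nth f n + fps_nth g n)" by auto
  ultimately show ?thesis
    using tendsto_add[of "fps_nth f" 0 sequentially "fps_nth g" 0] by (simp add: tate_def)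
qed

lemma tate_const_mult: "f \<in> tate \<Longrightarrow> fps_const c * f \<in> (tate :: 'p::prime_card padic fps set)"
proof -
  assume "f \<in> tate"
  moreover have "fps_nth (fps_const c * f) = (\<lambda>n. c * fps_nth f n)" by auto
  ultimately show ?thesis
    using padic_tendsto_mult_left[of "fps_nth f" 0 c] by (simp add: tate_def)
qed

lemma tate_minus: "f \<in> tate \<Longrightarrow> - f \<in> (tate :: 'p::prime_card padic fps set)"
  by (simp add: tate_iff)

lemma tate_diff: "f \<in> tate \<Longrightarrow> g \<in> tate \<Longrightarrow> f - g \<in> (tate :: 'p::prime_card padic fps set)"
  using tate_add[OF _ tate_minus, of f g] by simp

lemma tate_finite_support:
  assumes "\<And>n. n \<ge> N \<Longrightarrow> fps_nth f n = 0"
  shows "f \<in> (tate :: 'p::prime_card padic fps set)"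
  using assms by (auto simp: tate_iff intro!: exI[of _ N])

lemma tate_0 [simp]: "0 \<in> (tate :: 'p::prime_card padic fps set)"
  by (rule tate_finite_support[of 0]) auto

lemma tate_const [simp]: "fps_const c \<in> (tate :: 'p::prime_card padic fps set)"
  by (rule tate_finite_support[of 1]) auto

lemma tate_1 [simp]: "1 \<in> (tate :: 'p::prime_card padic fps set)"
  using tate_const[of 1] by simp

lemma tate_X_power [simp]: "fps_X ^ n \<in> (tate :: 'p::prime_card padic fps set)"
  by (rule tate_finite_support[of "Suc n"]) (auto simp: fps_X_power_iff)

lemma tate_X [simp]: "fps_X \<in> (tate :: 'p::prime_card padic fps set)"
  using tate_X_power[of 1] by simp

lemma tate_poly [simp]: "fps_of_poly P \<in> (tate :: 'p::prime_card padic fps set)"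
  by (rule tate_finite_support[of "Suc (Polynomial.degree P)"]) (auto simp: coeff_eq_0)

lemma tate_cutoff [simp]: "fps_cutoff N f \<in> (tate :: 'p::prime_card padic fps set)"
  by (rule tate_finite_support[of N]) auto

lemma gauss_norm_const_mult:
  assumes "f \<in> (tate :: 'p::prime_card padic fps set)"
  shows "gauss_norm (fps_const c * f) \<le> padic_norm c * gauss_norm f"
  by (rule gauss_norm_le) (simp add: padic_norm_mult mult_left_mono coeff_le_gauss_norm[OF assms])

lemma gauss_norm_mult:
  assumes "f \<in> (tate :: 'p::prime_card padic fps set)" "g \<in> tate"
  shows "gauss_norm (f * g) \<le> gauss_norm f * gauss_norm g"
proof (rule gauss_norm_le)
  fix n
  show "padic_norm (fps_nth (f * g) n) \<le> gauss_norm f * gauss_norm g"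
    unfolding fps_mult_nth using assms
    by (intro padic_norm_sum_le)
      (auto simp: padic_norm_mult intro!: mult_mono mult_nonneg_nonneg coeff_le_gauss_norm gauss_norm_nonneg)
qed

lemma tate_mult:
  assumes "f \<in> (tate :: 'p::prime_card padic fps set)" "g \<in> tate"
  shows "f * g \<in> tate"
  unfolding tate_iff
proof (intro allI impI)
  fix e :: real assume e: "e > 0"
  define K where "K = max (gauss_norm f) (gauss_norm g) + 1"
  have K: "K > 0" "gauss_norm f \<le> K" "gauss_norm g \<le> K"
    using gauss_norm_nonneg[OF assms(1)] by (auto simp: K_def)
  define d where "d = e / (2 * K)"
  have d: "d > 0" "K * d = e / 2" using e K by (auto simp: d_def)
  obtain M where M: "\<forall>n\<ge>M. padic_norm (fps_nth f n) < d" using assms(1) d unfolding tate_iff by blast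
  obtain N where N: "\<forall>n\<ge>N. padic_norm (fps_nth g n) < d" using assms(2) d unfolding tate_iff by blast
  show "\<exists>N. \<forall>n\<ge>N. padic_norm (fps_nth (f * g) n) < e"
  proof (intro exI[of _ "M + N"] allI impI)
    fix n assume n: "M + N \<le> n"
    have "padic_norm (fps_nth f i * fps_nth g (n - i)) \<le> e / 2" if i: "i \<in> {0..n}" for i
    proof (cases "i \<ge> M")
      case True
      hence "padic_norm (fps_nth f i) * padic_norm (fps_nth g (n - i)) \<le> d * K"
        using M d K coeff_le_gauss_norm[OF assms(2), of "n - i"]
        by (intro mult_mono) (auto intro: less_imp_le)
      thus ?thesis using d by (simp add: padic_norm_mult mult.commute)
    next
      case False
      hence "n - i \<ge> N" using n by simp
      hence "padic_norm (fps_nth f i) * padic_norm (fps_nth g (n - i)) \<le> K * d"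
        using N d K coeff_le_gauss_norm[OF assms(1), of i]
        by (intro mult_mono) (auto intro: less_imp_le)
      thus ?thesis using d by (simp add: padic_norm_mult)
    qed
    hence "padic_norm (fps_nth (f * g) n) \<le> e / 2"
      unfolding fps_mult_nth using e by (intro padic_norm_sum_le) auto
    thus "padic_norm (fps_nth (f * g) n) < e" using e by simp
  qed
qed

lemma tate_power: "f \<in> (tate :: 'p::prime_card padic fps set) \<Longrightarrow> f ^ n \<in> tate"
  by (induction n) (auto intro: tate_mult)

lemma gauss_norm_const: "gauss_norm (fps_const c :: 'p::prime_card padic fps) \<le> padic_norm c"
  by (rule gauss_norm_le) (simp add: fps_nth_fps_const)

lemma gauss_norm_power:
  assumes "f \<in> (tate :: 'p::prime_card padic fps set)"
  shows "gauss_norm (f ^ n) \<le> gauss_norm f ^ n"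
proof (induction n)
  case 0
  show ?case using gauss_norm_const[of 1] by simp
next
  case (Suc n)
  have "gauss_norm (f * f ^ n) \<le> gauss_norm f * gauss_norm (f ^ n)"
    by (intro gauss_norm_mult tate_power assms)
  also have "\<dots> \<le> gauss_norm f * gauss_norm f ^ n"
    by (intro mult_left_mono Suc gauss_norm_nonneg assms)
  finally show ?case by simp
qed

text \<open>Monomials span a dense subspace, so a bounded additive map is determined by its values there.\<close>

lemma tate_functional_eq_0:
  fixes L :: "'p::prime_card padic fps \<Rightarrow> 'p padic"
  assumes add: "\<And>f g. f \<in> tate \<Longrightarrow> g \<in> tate \<Longrightarrow> L (f + g) = L f + L g"
    and bound: "\<And>f. f \<in> tate \<Longrightarrow> padic_norm (L f) \<le> C * gauss_norm f"
    and mono: "\<And>c n. L (fps_const c * fps_X ^ n) = 0"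
    and f: "f \<in> tate"
  shows "L f = 0"
proof -
  have cut: "L (fps_cutoff N f) = 0" for N
  proof (induction N)
    case 0
    show ?case using bound[of 0] by (simp add: padic_norm_eq_0_iff[symmetric] antisym)
  next
    case (Suc N)
    have "fps_cutoff (Suc N) f = fps_cutoff N f + fps_const (fps_nth f N) * fps_X ^ N"
      by (rule fps_ext) (auto simp: fps_X_power_iff less_Suc_eq)
    thus ?case
      using Suc mono[of "fps_nth f N" N] add[OF tate_cutoff tate_const_mult[OF tate_X_power], of N f "fps_nth f N" N]
      by simp
  qed
  have "padic_norm (L f) \<le> \<bar>C\<bar> * e" if e: "e > 0" for e
  proof -
    obtain N where N: "\<forall>n\<ge>N. padic_norm (fps_nth f n) < e" using f e unfolding tate_iff by blast
    let ?t = "f - fps_cutoff N f"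
    have t: "?t \<in> tate" by (intro tate_diff f tate_cutoff)
    have "gauss_norm ?t \<le> e" using N e by (intro gauss_norm_le) (auto intro: less_imp_le)
    hence "\<bar>C\<bar> * gauss_norm ?t \<le> \<bar>C\<bar> * e" by (intro mult_left_mono) auto
    moreover have "C * gauss_norm ?t \<le> \<bar>C\<bar> * gauss_norm ?t"
      using gauss_norm_nonneg[OF t] by (intro mult_right_mono) auto
    moreover have "L f = L ?t" using add[OF tate_cutoff[of N f] t] cut[of N] by simp
    ultimately have "padic_norm (L f) \<le> C * gauss_norm ?t" "C * gauss_norm ?t \<le> \<bar>C\<bar> * e"
      using bound[OF t] by simp_all
    thus ?thesis by (rule order_trans)
  qed
  from this[of "padic_norm (L f) / (2 * (\<bar>C\<bar> + 1))"] show ?thesis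
    using padic_norm_pos[of "L f"] mult_nonneg_nonneg[OF abs_ge_zero padic_norm_nonneg, of C "L f"]
    by (cases "L f = 0") (auto simp: field_simps)
qed

section \<open>Substitution\<close>

definition unit_ball :: "'p::prime_card padic fps set" where
  "unit_ball = {h \<in> tate. gauss_norm h \<le> 1}"

lemma unit_ball_power: "h \<in> unit_ball \<Longrightarrow> h ^ n \<in> unit_ball"
  using gauss_norm_power[of h n] power_le_one[OF gauss_norm_nonneg, of h n]
  by (force simp: unit_ball_def tate_power)

lemma unit_ball_coeff: "h \<in> unit_ball \<Longrightarrow> padic_norm (fps_nth (h ^ n) m) \<le> 1"
  using unit_ball_power[of h n] coeff_le_gauss_norm[of "h ^ n" m] by (auto simp: unit_ball_def)

lemma subst_term_le:
  assumes "h \<in> unit_ball"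
  shows "padic_norm (fps_nth f n * fps_nth (h ^ n) m) \<le> padic_norm (fps_nth f n)"
  using unit_ball_coeff[OF assms, of n m] by (simp add: padic_norm_mult mult_left_le)

lemma subst_summable:
  assumes "f \<in> tate" "h \<in> unit_ball"
  shows "summable (\<lambda>n. fps_nth f n * fps_nth (h ^ n) m)"
proof (rule padic_summable, unfold padic_tendsto_0_iff, intro allI impI)
  fix e :: real assume "e > 0"
  thus "\<exists>N. \<forall>n\<ge>N. padic_norm (fps_nth f n * fps_nth (h ^ n) m) < e"
    using assms(1) subst_term_le[OF assms(2)] unfolding tate_iff by (meson le_less_trans)
qed

lemma subst_nth: "fps_nth (fps_subst f h) m = (\<Sum>n. fps_nth f n * fps_nth (h ^ n) m)"
  by (simp add: fps_subst_def)

lemma subst_norm: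
  assumes "f \<in> tate" "h \<in> unit_ball"
  shows "gauss_norm (fps_subst f h) \<le> gauss_norm f"
  by (rule gauss_norm_le, unfold subst_nth, rule padic_suminf_norm_le[OF subst_summable[OF assms]])
    (use assms in \<open>auto intro: order_trans[OF subst_term_le coeff_le_gauss_norm] gauss_norm_nonneg\<close>)

lemma subst_tate:
  assumes "f \<in> tate" "h \<in> unit_ball"
  shows "fps_subst f h \<in> tate"
  unfolding tate_iff
proof (intro allI impI)
  fix e :: real assume e: "e > 0"
  obtain N where N: "\<forall>n\<ge>N. padic_norm (fps_nth f n) < e / 2"
    using assms(1) e unfolding tate_iff by (meson half_gt_zero)
  have "\<exists>M. \<forall>m\<ge>M. padic_norm (fps_nth f n * fps_nth (h ^ n) m) < e / 2" for n
  proof -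
    have "fps_const (fps_nth f n) * h ^ n \<in> tate"
      using assms(2) by (intro tate_const_mult tate_power) (simp add: unit_ball_def)
    thus ?thesis using e unfolding tate_iff
      by (metis fps_mult_left_const_nth half_gt_zero)
  qed
  then obtain M where M: "\<And>n m. m \<ge> M n \<Longrightarrow> padic_norm (fps_nth f n * fps_nth (h ^ n) m) < e / 2" by metis
  show "\<exists>N. \<forall>n\<ge>N. padic_norm (fps_nth (fps_subst f h) n) < e"
  proof (intro exI[of _ "\<Sum>n<N. M n"] allI impI)
    fix m assume m: "(\<Sum>n<N. M n) \<le> m"
    have "padic_norm (fps_nth f n * fps_nth (h ^ n) m) \<le> e / 2" for n
    proof (cases "n < N")
      case True
      hence "M n \<le> (\<Sum>n<N. M n)" by (intro member_le_sum) auto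
      thus ?thesis using M[of n m] m by simp
    next
      case False
      thus ?thesis using N[rule_format, of n] subst_term_le[OF assms(2), of f n m] by simp
    qed
    hence "padic_norm (fps_nth (fps_subst f h) m) \<le> e / 2"
      unfolding subst_nth using e by (intro padic_suminf_norm_le subst_summable assms) auto
    thus "padic_norm (fps_nth (fps_subst f h) m) < e" using e by simp
  qed
qed

lemma subst_add:
  assumes "f \<in> tate" "g \<in> tate" "h \<in> unit_ball"
  shows "fps_subst (f + g) h = fps_subst f h + fps_subst g h"
  by (rule fps_ext) (simp add: subst_nth distrib_right suminf_add[symmetric] subst_summable assms)

lemma subst_const_mult:
  assumes "f \<in> tate" "h \<in> unit_ball"
  shows "fps_subst (fps_const c * f) h = fps_const c * fps_subst f h"
  by (rule fps_ext) (simp add: subst_nth mult.assoc padic_suminf_mult[OF subst_summable[OF assms]])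

lemma subst_poly:
  assumes "Polynomial.degree P \<le> k"
  shows "fps_subst (fps_of_poly P) h = (\<Sum>i\<le>k. fps_const (poly.coeff P i) * h ^ i)"
proof (rule fps_ext)
  fix m
  have "(\<Sum>n. poly.coeff P n * fps_nth (h ^ n) m) = (\<Sum>n\<le>k. poly.coeff P n * fps_nth (h ^ n) m)"
    using assms by (intro suminf_finite) (auto simp: coeff_eq_0)
  thus "fps_nth (fps_subst (fps_of_poly P) h) m = fps_nth (\<Sum>i\<le>k. fps_const (poly.coeff P i) * h ^ i) m"
    by (simp add: subst_nth fps_sum_nth)
qed

lemma subst_monomial: "fps_subst (fps_const c * fps_X ^ n) h = fps_const c * h ^ n"
proof -
  have "fps_subst (fps_of_poly (Polynomial.monom c n)) h = (\<Sum>i\<le>n. fps_const (poly.coeff (Polynomial.monom c n) i) * h ^ i)"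
    by (rule subst_poly) (simp add: degree_monom_le)
  also have "\<dots> = (\<Sum>i\<le>n. if i = n then fps_const c * h ^ n else 0)"
    by (intro sum.cong) auto
  finally show ?thesis by (simp add: fps_of_poly_monom)
qed

lemma subst_const [simp]: "fps_subst (fps_const c) h = fps_const c"
  using subst_monomial[of c 0 h] by simp

lemma subst_X [simp]: "fps_subst fps_X h = h"
  using subst_monomial[of 1 1 h] by simp

text \<open>Both sides are bounded and additive in each factor, and they agree on pairs of monomials. Density is
  applied to one factor at a time.\<close>

lemma subst_mult:
  assumes f: "f \<in> tate" and g: "g \<in> tate" and h: "h \<in> unit_ball"
  shows "fps_subst (f * g) h = fps_subst f h * fps_subst g h"
proof -
  have one: "fps_subst (F * G) h = fps_subst F h * fps_subst G h"
    if F: "F \<in> tate" and G: "G \<in> tate"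
      and mono: "\<And>c n. fps_subst (F * (fps_const c * fps_X ^ n)) h = fps_subst F h * (fps_const c * h ^ n)" for F G
  proof (rule fps_ext)
    fix m
    let ?L = "\<lambda>G. fps_nth (fps_subst (F * G) h - fps_subst F h * fps_subst G h) m"
    have "?L G = 0"
    proof (rule tate_functional_eq_0[where L = ?L and C = "gauss_norm F"])
      fix u v :: "'a padic fps" assume uv: "u \<in> tate" "v \<in> tate"
      show "?L (u + v) = ?L u + ?L v"
        using uv by (simp add: distrib_left subst_add tate_mult F h)
    next
      fix u :: "'a padic fps" assume u: "u \<in> tate"
      have "padic_norm (fps_nth (fps_subst (F * u) h) m) \<le> gauss_norm F * gauss_norm u"
        using coeff_le_gauss_norm[OF subst_tate[OF tate_mult[OF F u] h], of m]
          subst_norm[OF tate_mult[OF F u] h] gauss_norm_mult[OF F u] by linarith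
      moreover have "padic_norm (fps_nth (fps_subst F h * fps_subst u h) m) \<le> gauss_norm F * gauss_norm u"
      proof -
        have "gauss_norm (fps_subst F h) * gauss_norm (fps_subst u h) \<le> gauss_norm F * gauss_norm u"
          by (intro mult_mono subst_norm gauss_norm_nonneg subst_tate F u h)
        thus ?thesis
          using coeff_le_gauss_norm[OF tate_mult[OF subst_tate[OF F h] subst_tate[OF u h]], of m]
            gauss_norm_mult[OF subst_tate[OF F h] subst_tate[OF u h]] by linarith
      qed
      ultimately show "padic_norm (?L u) \<le> gauss_norm F * gauss_norm u"
        using padic_norm_diff[of "fps_nth (fps_subst (F * u) h) m" "fps_nth (fps_subst F h * fps_subst u h) m"]
        by (simp add: fps_sub_nth)
    qed (use mono G in \<open>simp_all add: subst_monomial\<close>)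
    thus "fps_nth (fps_subst (F * G) h) m = fps_nth (fps_subst F h * fps_subst G h) m" by simp
  qed
  have mm: "fps_subst ((fps_const d * fps_X ^ i) * G) h = (fps_const d * h ^ i) * fps_subst G h" if "G \<in> tate" for d i G
  proof -
    have "fps_subst ((fps_const d * fps_X ^ i) * (fps_const c * fps_X ^ n)) h = (fps_const d * h ^ i) * (fps_const c * h ^ n)" for c n
    proof -
      have "(fps_const d * fps_X ^ i) * (fps_const c * fps_X ^ n) = fps_const (d * c) * fps_X ^ (i + n)"
        by (simp only: fps_const_mult[symmetric] power_add mult_ac)
      also have "fps_subst \<dots> h = fps_const (d * c) * h ^ (i + n)" by (rule subst_monomial)
      finally show ?thesis by (simp only: fps_const_mult[symmetric] power_add mult_ac)
    qed
    thus ?thesis using one[OF tate_const_mult[OF tate_X_power] that, of d i] by (simp only: subst_monomial)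
  qed
  show ?thesis
  proof (rule one[OF f g])
    fix c n
    show "fps_subst (f * (fps_const c * fps_X ^ n)) h = fps_subst f h * (fps_const c * h ^ n)"
      using mm[OF f, of c n] by (simp only: mult.commute)
  qed
qed

lemma subst_power:
  assumes "f \<in> tate" "h \<in> unit_ball"
  shows "fps_subst (f ^ n) h = fps_subst f h ^ n"
proof (induction n)
  case 0
  show ?case using subst_const[of 1 h] by simp
qed (simp add: subst_mult tate_power assms)

lemma subst_unit_ball: "f \<in> unit_ball \<Longrightarrow> h \<in> unit_ball \<Longrightarrow> fps_subst f h \<in> unit_ball"
  using subst_norm[of f h] subst_tate[of f h] by (auto simp: unit_ball_def)

text \<open>Both sides are bounded and additive in \<open>f\<close> and agree on monomials, by multiplicativity.\<close>

lemma subst_subst: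
  assumes f: "f \<in> tate" and g: "g \<in> unit_ball" and h: "h \<in> unit_ball"
  shows "fps_subst (fps_subst f g) h = fps_subst f (fps_subst g h)"
proof (rule fps_ext)
  fix m
  note gh = subst_unit_ball[OF g h]
  have gt: "g \<in> tate" using g by (simp add: unit_ball_def)
  let ?L = "\<lambda>f. fps_nth (fps_subst (fps_subst f g) h - fps_subst f (fps_subst g h)) m"
  have "?L f = 0"
  proof (rule tate_functional_eq_0[where L = ?L and C = 1])
    fix u v :: "'a padic fps" assume uv: "u \<in> tate" "v \<in> tate"
    show "?L (u + v) = ?L u + ?L v" using uv g h gh by (simp add: subst_add subst_tate)
  next
    fix u :: "'a padic fps" assume u: "u \<in> tate"
    have "padic_norm (fps_nth (fps_subst (fps_subst u g) h) m) \<le> gauss_norm u"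
      using coeff_le_gauss_norm[OF subst_tate[OF subst_tate[OF u g] h], of m]
        subst_norm[OF subst_tate[OF u g] h] subst_norm[OF u g] by linarith
    moreover have "padic_norm (fps_nth (fps_subst u (fps_subst g h)) m) \<le> gauss_norm u"
      using coeff_le_gauss_norm[OF subst_tate[OF u gh], of m] subst_norm[OF u gh] by linarith
    ultimately show "padic_norm (?L u) \<le> 1 * gauss_norm u"
      using padic_norm_diff[of "fps_nth (fps_subst (fps_subst u g) h) m" "fps_nth (fps_subst u (fps_subst g h)) m"]
      by (simp add: fps_sub_nth)
  next
    fix c n
    have "g ^ n \<in> tate" by (rule tate_power[OF gt])
    thus "?L (fps_const c * fps_X ^ n) = 0"
      by (simp add: subst_monomial subst_const_mult subst_power gt h)
  qed (rule f)
  thus "fps_nth (fps_subst (fps_subst f g) h) m = fps_nth (fps_subst f (fps_subst g h)) m" by simp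
qed

section \<open>Two by two matrices\<close>

lemma mat2_eqI:
  fixes A B :: "'a ^ 2 ^ 2"
  assumes "A $ 1 $ 1 = B $ 1 $ 1" "A $ 1 $ 2 = B $ 1 $ 2" "A $ 2 $ 1 = B $ 2 $ 1" "A $ 2 $ 2 = B $ 2 $ 2"
  shows "A = B"
  using assms by (simp add: vec_eq_iff forall_2)

lemma mat2_mult_nth: "(A ** B) $ i $ j = A $ i $ 1 * B $ 1 $ j + A $ i $ 2 * B $ 2 $ j"
  for A B :: "'a::semiring_1 ^ 2 ^ 2"
  by (simp add: matrix_matrix_mult_def sum_2)

lemma mat2_scalar_nth: "(mat c :: 'a::semiring_1 ^ 2 ^ 2) $ i $ j = (if i = j then c else 0)"
  by (simp add: mat_def)

lemmas mat2_simps = mat2_mult_nth mat2_scalar_nth det_2 vector_2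

lemma matrix_inv_eqI:
  fixes A B :: "'a::field ^ 2 ^ 2"
  assumes "A ** B = mat 1"
  shows "matrix_inv A = B"
proof -
  have BA: "B ** A = mat 1" using assms by (simp add: matrix_left_right_inverse)
  have "A ** matrix_inv A = mat 1 \<and> matrix_inv A ** A = mat 1"
    unfolding matrix_inv_def by (rule someI[of _ B]) (use assms BA in simp)
  hence "B ** (A ** matrix_inv A) = B" by simp
  thus ?thesis by (simp add: matrix_mul_assoc BA)
qed

lemma matrix_inv_right: "det A \<noteq> 0 \<Longrightarrow> A ** matrix_inv A = mat 1"
  and matrix_inv_left: "det A \<noteq> 0 \<Longrightarrow> matrix_inv A ** A = mat 1"
  for A :: "'a::field ^ 2 ^ 2"
proof -
  assume "det A \<noteq> 0"
  then obtain B where "A ** B = mat 1" by (auto simp: invertible_det_nz[symmetric] invertible_right_inverse)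
  thus "A ** matrix_inv A = mat 1" "matrix_inv A ** A = mat 1"
    using matrix_inv_eqI[of A B] by (auto simp: matrix_left_right_inverse)
qed

lemma matrix_inv_2:
  fixes A :: "'a::field ^ 2 ^ 2"
  assumes "det A \<noteq> 0"
  shows "matrix_inv A = vector [vector [A $ 2 $ 2 / det A, - A $ 1 $ 2 / det A],
    vector [- A $ 2 $ 1 / det A, A $ 1 $ 1 / det A]]"
  by (rule matrix_inv_eqI, rule mat2_eqI)
    (use assms in \<open>simp_all add: mat2_mult_nth mat2_scalar_nth vector_2 divide_simps\<close>,
     simp_all add: det_2 algebra_simps)

lemma mat2_smult_nth: "(mat c ** A) $ i $ j = c * A $ i $ j" for A :: "'a::semiring_1 ^ 2 ^ 2"
  using exhaust_2[of i] by (auto simp: mat2_simps)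

lemma mat2_smult_commute: "A ** mat c = mat c ** A" for A :: "'a::comm_semiring_1 ^ 2 ^ 2"
  by (rule mat2_eqI) (simp_all add: mat2_simps mult.commute)

lemma det_scalar_2: "det (mat c :: 'a::comm_ring_1 ^ 2 ^ 2) = c\<^sup>2"
  by (simp add: mat2_simps power2_eq_square)

section \<open>The action on the Tate algebra\<close>

text \<open>This is the monoid \<open>\<rat>\<^sub>p\<^sup>\<times>\<Sigma>\<^sub>0(p)\<close>, described by inequalities of norms.\<close>

definition scaled_Sigma0 :: "('p::prime_card padic ^ 2 ^ 2) set" where
  "scaled_Sigma0 = {s. s $ 1 $ 1 \<noteq> 0 \<and> det s \<noteq> 0 \<and> padic_norm (s $ 1 $ 2) \<le> padic_norm (s $ 1 $ 1) \<and>
     padic_norm (s $ 2 $ 2) \<le> padic_norm (s $ 1 $ 1) \<and> padic_norm (s $ 2 $ 1) < padic_norm (s $ 1 $ 1)}"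

definition mob_den :: "'p::prime_card padic ^ 2 ^ 2 \<Rightarrow> 'p padic fps" where
  "mob_den s = - fps_const (s $ 2 $ 1) * fps_X + fps_const (s $ 1 $ 1)"

definition mob_num :: "'p::prime_card padic ^ 2 ^ 2 \<Rightarrow> 'p padic fps" where
  "mob_num s = fps_const (s $ 2 $ 2) * fps_X - fps_const (s $ 1 $ 2)"

definition mob :: "'p::prime_card padic ^ 2 ^ 2 \<Rightarrow> 'p padic fps" where
  "mob s = mob_num s * inverse (mob_den s)"

lemma tate_act_mob:
  "tate_act k s f = fps_const (det s powi (- int (k div 2))) * mob_den s ^ k * fps_subst f (mob s)"
  by (simp only: tate_act_def mob_def mob_num_def mob_den_def Let_def)

lemma mob_den_tate [simp]: "mob_den s \<in> tate"
  unfolding mob_den_def by (intro tate_add tate_const) (simp only: fps_const_neg tate_const_mult tate_X)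

lemma mob_num_tate [simp]: "mob_num s \<in> tate"
  unfolding mob_num_def by (intro tate_diff tate_const tate_const_mult tate_X)

lemma mob_den_nth: "fps_nth (mob_den s) n = (if n = 0 then s $ 1 $ 1 else if n = 1 then - s $ 2 $ 1 else 0)"
proof -
  have "fps_nth (fps_const (- s $ 2 $ 1) * fps_X + fps_const (s $ 1 $ 1)) n
    = (if n = 0 then s $ 1 $ 1 else if n = 1 then - s $ 2 $ 1 else 0)"
    by (cases n) (auto simp: fps_X_def)
  thus ?thesis by (simp add: mob_den_def)
qed

lemma mob_num_nth: "fps_nth (mob_num s) n = (if n = 0 then - s $ 1 $ 2 else if n = 1 then s $ 2 $ 2 else 0)"
  by (cases n) (auto simp: mob_num_def fps_X_def)

lemma mob_den_norm:
  assumes "s \<in> scaled_Sigma0"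
  shows "gauss_norm (mob_den s) \<le> padic_norm (s $ 1 $ 1)"
  by (rule gauss_norm_le) (use assms in \<open>auto simp: mob_den_nth scaled_Sigma0_def\<close>)

lemma mob_num_norm:
  assumes "s \<in> scaled_Sigma0"
  shows "gauss_norm (mob_num s) \<le> padic_norm (s $ 1 $ 1)"
  by (rule gauss_norm_le) (use assms in \<open>auto simp: mob_num_nth scaled_Sigma0_def\<close>)

text \<open>The geometric series \<open>1/(a - cx) = \<Sum>\<^sub>n c\<^sup>n x\<^sup>n / a\<^sup>n\<^sup>+\<^sup>1\<close> converges on the unit disc because \<open>\<bar>c\<bar> < \<bar>a\<bar>\<close>.\<close>

lemma mob_den_inverse:
  assumes s: "s \<in> scaled_Sigma0"
  shows "mob_den s * inverse (mob_den s) = 1" "inverse (mob_den s) \<in> tate"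
    "gauss_norm (inverse (mob_den s)) \<le> 1 / padic_norm (s $ 1 $ 1)"
proof -
  let ?a = "s $ 1 $ 1" and ?c = "s $ 2 $ 1"
  have a: "?a \<noteq> 0" and ca: "padic_norm ?c < padic_norm ?a" using s by (auto simp: scaled_Sigma0_def)
  define r where "r = padic_norm ?c / padic_norm ?a"
  have r: "0 \<le> r" "r < 1" using ca padic_norm_pos[OF a] by (auto simp: r_def)
  define g where "g = Abs_fps (\<lambda>n. (?c / ?a) ^ n / ?a)"
  have gn: "padic_norm (fps_nth g n) = r ^ n / padic_norm ?a" for n
    by (simp add: g_def padic_norm_divide padic_norm_power r_def)
  have "mob_den s * g = 1"
  proof (rule fps_ext)
    fix n
    have "mob_den s * g = fps_const (- ?c) * (fps_X * g) + fps_const ?a * g"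
      by (simp add: mob_den_def distrib_right mult.assoc)
    thus "fps_nth (mob_den s * g) n = fps_nth 1 n"
      using a by (cases n) (simp_all add: g_def)
  qed
  hence inv: "inverse (mob_den s) = g" by (rule fps_inverse_unique)
  show "mob_den s * inverse (mob_den s) = 1" using \<open>mob_den s * g = 1\<close> inv by simp
  show "gauss_norm (inverse (mob_den s)) \<le> 1 / padic_norm ?a"
    unfolding inv by (rule gauss_norm_le) (use r in \<open>simp add: gn divide_right_mono power_le_one\<close>)
  have "(\<lambda>n. r ^ n / padic_norm ?a) \<longlonglongrightarrow> 0 / padic_norm ?a"
    by (intro tendsto_divide LIMSEQ_power_zero tendsto_const) (use r padic_norm_pos[OF a] in auto)
  hence "(\<lambda>n. padic_norm (fps_nth g n - 0)) \<longlonglongrightarrow> 0" by (simp add: gn)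
  hence "fps_nth g \<longlonglongrightarrow> 0" by (simp only: padic_tendsto_iff)
  thus "inverse (mob_den s) \<in> tate" by (simp add: inv tate_def)
qed

lemma mob_unit_ball:
  assumes s: "s \<in> scaled_Sigma0"
  shows "mob s \<in> unit_ball"
proof -
  note i = mob_den_inverse[OF s]
  have a: "padic_norm (s $ 1 $ 1) > 0" using s by (auto simp: scaled_Sigma0_def intro: padic_norm_pos)
  have "gauss_norm (mob s) \<le> gauss_norm (mob_num s) * gauss_norm (inverse (mob_den s))"
    unfolding mob_def by (intro gauss_norm_mult i mob_num_tate)
  also have "\<dots> \<le> padic_norm (s $ 1 $ 1) * (1 / padic_norm (s $ 1 $ 1))"
    by (intro mult_mono mob_num_norm[OF s] i gauss_norm_nonneg) auto
  also have "\<dots> = 1" using a by simp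
  finally show ?thesis unfolding unit_ball_def mob_def by (simp add: tate_mult i)
qed

lemma tate_act_tate:
  assumes "s \<in> scaled_Sigma0" "f \<in> tate"
  shows "tate_act k s f \<in> tate"
  unfolding tate_act_mob
  by (intro tate_mult tate_const tate_power mob_den_tate subst_tate mob_unit_ball assms)

lemma tate_act_add:
  assumes "s \<in> scaled_Sigma0" "f \<in> tate" "g \<in> tate"
  shows "tate_act k s (f + g) = tate_act k s f + tate_act k s g"
  by (simp add: tate_act_mob subst_add mob_unit_ball assms distrib_left)

lemma tate_act_const_mult:
  assumes "s \<in> scaled_Sigma0" "f \<in> tate"
  shows "tate_act k s (fps_const c * f) = fps_const c * tate_act k s f"
  by (simp only: tate_act_mob subst_const_mult[OF assms(2) mob_unit_ball[OF assms(1)]]) (simp only: mult_ac)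

lemma tate_act_norm:
  assumes s: "s \<in> scaled_Sigma0" and f: "f \<in> tate"
  shows "gauss_norm (tate_act k s f)
    \<le> padic_norm (det s) powi (- int (k div 2)) * padic_norm (s $ 1 $ 1) ^ k * gauss_norm f"
proof -
  let ?d = "fps_const (det s powi (- int (k div 2)))"
  have d: "gauss_norm ?d \<le> padic_norm (det s) powi (- int (k div 2))"
    using gauss_norm_const[of "det s powi (- int (k div 2))"] by (simp add: padic_norm_power_int)
  have den: "gauss_norm (mob_den s ^ k) \<le> padic_norm (s $ 1 $ 1) ^ k"
    using gauss_norm_power[OF mob_den_tate, of s k] power_mono[OF mob_den_norm[OF s] gauss_norm_nonneg[OF mob_den_tate], of k]
    by linarith
  have "gauss_norm (?d * mob_den s ^ k) \<le> gauss_norm ?d * gauss_norm (mob_den s ^ k)"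
    by (intro gauss_norm_mult tate_const tate_power mob_den_tate)
  also have "\<dots> \<le> padic_norm (det s) powi (- int (k div 2)) * padic_norm (s $ 1 $ 1) ^ k"
    by (intro mult_mono d den gauss_norm_nonneg tate_power mob_den_tate) (auto intro!: zero_le_power_int)
  finally have 1: "gauss_norm (?d * mob_den s ^ k) \<le> padic_norm (det s) powi (- int (k div 2)) * padic_norm (s $ 1 $ 1) ^ k" .
  have "gauss_norm (tate_act k s f) \<le> gauss_norm (?d * mob_den s ^ k) * gauss_norm (fps_subst f (mob s))"
    unfolding tate_act_mob
    by (intro gauss_norm_mult tate_mult tate_const tate_power mob_den_tate subst_tate mob_unit_ball s f)
  also have "\<dots> \<le> padic_norm (det s) powi (- int (k div 2)) * padic_norm (s $ 1 $ 1) ^ k * gauss_norm f"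
    by (intro mult_mono 1 subst_norm mob_unit_ball gauss_norm_nonneg subst_tate s f)
      (auto intro!: zero_le_power_int mult_nonneg_nonneg)
  finally show ?thesis .
qed

text \<open>Multiplying numerator and denominator of \<open>(d x - b)/(a - c x)\<close> after substitution by the denominator of
  the inner transformation gives the entries of the matrix product; the denominators form a cocycle.\<close>

lemma mob_compose:
  assumes s: "s \<in> scaled_Sigma0" and t: "t \<in> scaled_Sigma0"
  shows "mob_den (s ** t) = mob_den s * fps_subst (mob_den t) (mob s)"
    and "mob (s ** t) = fps_subst (mob t) (mob s)"
proof -
  note b = mob_unit_ball[OF s] and i = mob_den_inverse[OF s]
  have lin: "fps_subst (fps_const u * fps_X + fps_const v) (mob s) = fps_const u * mob s + fps_const v" for u v
    using b by (simp add: subst_add subst_const_mult tate_const_mult)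
  have den: "fps_subst (mob_den t) (mob s) = fps_const (- t $ 2 $ 1) * mob s + fps_const (t $ 1 $ 1)"
    using lin[of "- t $ 2 $ 1" "t $ 1 $ 1"] by (simp add: mob_den_def)
  have num: "fps_subst (mob_num t) (mob s) = fps_const (t $ 2 $ 2) * mob s + fps_const (- t $ 1 $ 2)"
  proof -
    have "mob_num t = fps_const (t $ 2 $ 2) * fps_X + fps_const (- t $ 1 $ 2)"
      unfolding mob_num_def by (simp only: fps_const_neg[symmetric] add_uminus_conv_diff)
    thus ?thesis using lin[of "t $ 2 $ 2" "- t $ 1 $ 2"] by simp
  qed
  have dm: "mob_den s * mob s = mob_num s"
    using i(1) by (simp add: mob_def mult.left_commute[of "mob_den s"])
  have D: "mob_den s * (fps_const u * mob s + fps_const v) = fps_const u * mob_num s + fps_const v * mob_den s" for u v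
    using dm by (simp add: algebra_simps)
  show den': "mob_den (s ** t) = mob_den s * fps_subst (mob_den t) (mob s)"
    unfolding den D by (rule fps_ext) (simp add: mob_den_nth mob_num_nth mat2_mult_nth algebra_simps)
  have num': "mob_num (s ** t) = mob_den s * fps_subst (mob_num t) (mob s)"
    unfolding num D by (rule fps_ext) (simp add: mob_den_nth mob_num_nth mat2_mult_nth algebra_simps)
  let ?u = "fps_subst (mob_den t) (mob s)" and ?v = "fps_subst (inverse (mob_den t)) (mob s)"
  have uv: "?u * ?v = 1"
    using mob_den_inverse[OF t] subst_mult[OF mob_den_tate _ b, of "inverse (mob_den t)" t] subst_const[of 1 "mob s"]
    by simp
  have "mob_den s * ?u * (inverse (mob_den s) * ?v) = (mob_den s * inverse (mob_den s)) * (?u * ?v)"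
    by (simp only: mult_ac)
  hence "inverse (mob_den s * ?u) = inverse (mob_den s) * ?v"
    by (intro fps_inverse_unique) (simp add: i uv)
  hence "mob (s ** t) = (mob_den s * fps_subst (mob_num t) (mob s)) * (inverse (mob_den s) * ?v)"
    by (simp only: mob_def num' den')
  also have "\<dots> = (mob_den s * inverse (mob_den s)) * (fps_subst (mob_num t) (mob s) * ?v)"
    by (simp only: mult_ac)
  also have "\<dots> = fps_subst (mob t) (mob s)"
    by (simp only: i(1) mult_1_left mob_def[of t] subst_mult[OF mob_num_tate mob_den_inverse(2)[OF t] b])
  finally show "mob (s ** t) = fps_subst (mob t) (mob s)" .
qed

lemma tate_act_mult:
  assumes s: "s \<in> scaled_Sigma0" and t: "t \<in> scaled_Sigma0" and f: "f \<in> tate"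
  shows "tate_act k (s ** t) f = tate_act k s (tate_act k t f)"
proof -
  note b = mob_unit_ball[OF s] and b' = mob_unit_ball[OF t]
  let ?e = "- int (k div 2)"
  have sub: "fps_subst (tate_act k t f) (mob s)
    = fps_const (det t powi ?e) * fps_subst (mob_den t) (mob s) ^ k * fps_subst f (mob (s ** t))"
    unfolding tate_act_mob[of k t]
    by (simp add: subst_mult subst_power subst_const_mult subst_subst mob_compose(2)[OF s t]
        tate_mult tate_power tate_const_mult subst_tate b b' f)
  have "fps_const (det (s ** t) powi ?e) = fps_const (det s powi ?e) * fps_const (det t powi ?e)"
    by (simp add: det_mul power_int_mult_distrib)
  thus ?thesis
    unfolding tate_act_mob[of k "s ** t"] tate_act_mob[of k s] sub mob_compose(1)[OF s t] power_mult_distrib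
    by (simp only: mult_ac)
qed

text \<open>Passing to the inverse matrix divides all entries by the determinant. The sum is homogeneous of degree
  \<open>k\<close> in them, and \<open>k/2 - k = - k/2\<close>.\<close>

lemma poly_lact_coeffs:
  assumes k: "even k" and d: "det s \<noteq> 0"
  shows "poly_lact k s P = Polynomial.smult (det s powi (- int (k div 2)))
     (\<Sum>i\<le>k. Polynomial.smult (poly.coeff P i)
        ([:- s $ 1 $ 2, s $ 2 $ 2:] ^ i * [:s $ 1 $ 1, - s $ 2 $ 1:] ^ (k - i)))"
proof -
  let ?d = "det s" and ?t = "matrix_inv s"
  have dt: "det ?t = inverse ?d"
  proof -
    have "?d * det ?t = 1" using matrix_inv_right[OF d] by (simp add: det_mul[symmetric])
    thus ?thesis by (metis inverse_unique)
  qed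
  have lin: "[:x / ?d, y / ?d:] = Polynomial.smult (inverse ?d) [:x, y:]" for x y
    by (simp add: field_simps)
  obtain m where m: "k = 2 * m" using k by blast
  have sc: "inverse ?d powi (- int (k div 2)) * inverse ?d ^ k = ?d powi (- int (k div 2))"
    using d by (simp add: m power_int_minus mult_2 mult_2_right power_add power_inverse field_simps)
  have "poly_lact k s P = Polynomial.smult (inverse ?d powi (- int (k div 2)))
     (\<Sum>i\<le>k. Polynomial.smult (poly.coeff P i)
        (Polynomial.smult (inverse ?d) [:- s $ 1 $ 2, s $ 2 $ 2:] ^ i
          * Polynomial.smult (inverse ?d) [:s $ 1 $ 1, - s $ 2 $ 1:] ^ (k - i)))"
    unfolding poly_lact_def poly_ract_def matrix_inv_2[OF d] dt[unfolded matrix_inv_2[OF d]] vector_2 lin ..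
  also have "\<dots> = Polynomial.smult (inverse ?d powi (- int (k div 2)))
     (\<Sum>i\<le>k. Polynomial.smult (inverse ?d ^ k) (Polynomial.smult (poly.coeff P i)
        ([:- s $ 1 $ 2, s $ 2 $ 2:] ^ i * [:s $ 1 $ 1, - s $ 2 $ 1:] ^ (k - i))))"
  proof (intro arg_cong[where f = "Polynomial.smult _"] sum.cong refl)
    fix i assume "i \<in> {..k}"
    hence ik: "i + (k - i) = k" by simp
    have "Polynomial.smult c (Polynomial.smult u A ^ i * Polynomial.smult u B ^ j)
      = Polynomial.smult (u ^ (i + j)) (Polynomial.smult c (A ^ i * B ^ j))" for c u :: 'a and A B i j
      by (simp add: smult_power power_add ac_simps)
    from this[of _ _ _ i _ "k - i", unfolded ik] show "Polynomial.smult (poly.coeff P i)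
        (Polynomial.smult (inverse ?d) [:- s $ 1 $ 2, s $ 2 $ 2:] ^ i
          * Polynomial.smult (inverse ?d) [:s $ 1 $ 1, - s $ 2 $ 1:] ^ (k - i))
      = Polynomial.smult (inverse ?d ^ k) (Polynomial.smult (poly.coeff P i)
        ([:- s $ 1 $ 2, s $ 2 $ 2:] ^ i * [:s $ 1 $ 1, - s $ 2 $ 1:] ^ (k - i)))" .
  qed
  also have "\<dots> = Polynomial.smult (?d powi (- int (k div 2)))
     (\<Sum>i\<le>k. Polynomial.smult (poly.coeff P i)
        ([:- s $ 1 $ 2, s $ 2 $ 2:] ^ i * [:s $ 1 $ 1, - s $ 2 $ 1:] ^ (k - i)))"
    by (subst smult_sum2[symmetric], subst smult_smult, subst sc) (rule refl)
  finally show ?thesis .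
qed

lemma poly_lact_space:
  assumes "even k" "det s \<noteq> 0"
  shows "poly_lact k s P \<in> poly_space k"
proof -
  have "Polynomial.degree ([:u, v:] ^ i * [:x, y:] ^ (k - i)) \<le> k" if "i \<le> k" for i and u v x y :: 'a
  proof -
    have "Polynomial.degree ([:u, v:] ^ i * [:x, y:] ^ (k - i)) \<le> Polynomial.degree [:u, v:] * i + Polynomial.degree [:x, y:] * (k - i)"
      by (rule order_trans[OF degree_mult_le add_mono[OF degree_power_le degree_power_le]])
    also have "\<dots> \<le> 1 * i + 1 * (k - i)" by (intro add_mono mult_right_mono) auto
    finally show ?thesis using that by simp
  qed
  thus ?thesis unfolding poly_lact_coeffs[OF assms] poly_space_def
    by (auto intro!: order_trans[OF degree_smult_le] degree_sum_le)
qed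

text \<open>The factor \<open>(a - cx)\<^sup>k\<close> clears the denominators of \<open>P((dx - b)/(a - cx))\<close> when \<open>P\<close> has degree at most \<open>k\<close>.\<close>

lemma tate_act_poly:
  assumes k: "even k" and s: "s \<in> scaled_Sigma0" and P: "P \<in> poly_space k"
  shows "tate_act k s (fps_of_poly P) = fps_of_poly (poly_lact k s P)"
proof -
  have d: "det s \<noteq> 0" using s by (simp add: scaled_Sigma0_def)
  have num: "fps_of_poly [:- s $ 1 $ 2, s $ 2 $ 2:] = mob_num s"
    by (rule fps_ext) (auto simp: mob_num_nth coeff_pCons split: nat.splits)
  have den: "fps_of_poly [:s $ 1 $ 1, - s $ 2 $ 1:] = mob_den s"
    by (rule fps_ext) (auto simp: mob_den_nth coeff_pCons split: nat.splits)
  have pw: "mob_den s ^ k * mob s ^ i = mob_num s ^ i * mob_den s ^ (k - i)" if "i \<le> k" for i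
  proof -
    have "mob_den s * mob s = mob_num s * (mob_den s * inverse (mob_den s))"
      unfolding mob_def by (simp only: mult_ac)
    hence dm: "mob_den s * mob s = mob_num s" using mob_den_inverse(1)[OF s] by simp
    have "mob_den s ^ k = mob_den s ^ i * mob_den s ^ (k - i)" using that by (simp add: power_add[symmetric])
    hence "mob_den s ^ k * mob s ^ i = (mob_den s * mob s) ^ i * mob_den s ^ (k - i)"
      by (simp only: power_mult_distrib mult_ac)
    thus ?thesis by (simp only: dm)
  qed
  have "tate_act k s (fps_of_poly P) = fps_const (det s powi (- int (k div 2))) *
    (\<Sum>i\<le>k. mob_den s ^ k * (fps_const (poly.coeff P i) * mob s ^ i))"
    using P by (simp only: tate_act_mob subst_poly[of P k] poly_space_def mem_Collect_eq mult.assoc sum_distrib_left)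
  also have "(\<Sum>i\<le>k. mob_den s ^ k * (fps_const (poly.coeff P i) * mob s ^ i))
    = (\<Sum>i\<le>k. fps_const (poly.coeff P i) * (mob_num s ^ i * mob_den s ^ (k - i)))"
  proof (rule sum.cong[OF refl])
    fix i assume "i \<in> {..k}"
    hence "mob_den s ^ k * mob s ^ i = mob_num s ^ i * mob_den s ^ (k - i)" by (intro pw) simp
    thus "mob_den s ^ k * (fps_const (poly.coeff P i) * mob s ^ i)
      = fps_const (poly.coeff P i) * (mob_num s ^ i * mob_den s ^ (k - i))"
      by (simp only: mult.left_commute[of "mob_den s ^ k"])
  qed
  finally show ?thesis
    unfolding poly_lact_coeffs[OF k d]
    by (simp only: fps_of_poly_smult fps_of_poly_sum fps_of_poly_mult fps_of_poly_power num den)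
qed

section \<open>Bounded functionals\<close>

text \<open>Continuity at zero bounds \<open>\<omega>\<close> on a small ball, and every \<open>f\<close> is moved into that ball by a scalar built
  from one of its coefficients.\<close>

lemma distributions_bounded:
  assumes w: "\<omega> \<in> (distributions :: ('p::prime_card padic fps \<Rightarrow> 'p padic) set)"
  obtains K where "K \<ge> 0" "\<And>f. f \<in> tate \<Longrightarrow> padic_norm (\<omega> f) \<le> K * gauss_norm f"
proof -
  let ?p = "real CARD('p)"
  have p: "?p > 1" by (rule CARD_gt_1_real)
  have sc: "\<And>c f. f \<in> tate \<Longrightarrow> \<omega> (fps_const c * f) = c * \<omega> f"
    using w by (simp add: distributions_def)
  have w0: "\<omega> 0 = 0" using sc[of 0 0] by simp
  obtain d where d: "d > 0" "\<And>g. g \<in> tate \<Longrightarrow> gauss_norm g < d \<Longrightarrow> padic_norm (\<omega> g) < 1"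
  proof -
    have "\<forall>f\<in>tate. \<forall>e>0. \<exists>d>0. \<forall>g\<in>tate. gauss_norm (g - f) < d \<longrightarrow> dist (\<omega> g) (\<omega> f) < e"
      using w by (simp add: distributions_def)
    from this[rule_format, of 0 1] show thesis using that by (auto simp: w0 dist_padic_def)
  qed
  obtain N where N: "2 / d < ?p ^ N" using real_arch_pow[OF p] by blast
  have K: "?p ^ N \<ge> 0" using p by simp
  show thesis
  proof (rule that[OF K])
    fix f :: "'p padic fps" assume f: "f \<in> tate"
    show "padic_norm (\<omega> f) \<le> ?p ^ N * gauss_norm f"
    proof (cases "f = 0")
      case False
      hence G: "gauss_norm f > 0" using gauss_norm_nonneg[OF f] gauss_norm_eq_0[OF f] by fastforce
      hence "gauss_norm f / 2 < gauss_norm f" by simp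
      (* The supremum is attained, but a coefficient of at least half that size is enough. *)
      then obtain n where n: "gauss_norm f / 2 < padic_norm (fps_nth f n)"
        unfolding gauss_norm_def using less_cSUP_iff[OF UNIV_not_empty tate_bounded[OF f]] by blast
      let ?a = "fps_nth f n" and ?c = "of_nat CARD('p) ^ N / fps_nth f n"
      have a: "padic_norm ?a > 0" using n G by linarith
      hence a0: "?a \<noteq> 0" by auto
      have nc: "padic_norm ?c = 1 / (?p ^ N * padic_norm ?a)"
        by (simp add: padic_norm_divide padic_norm_p_power)
      have "gauss_norm (fps_const ?c * f) \<le> padic_norm ?c * gauss_norm f" by (rule gauss_norm_const_mult[OF f])
      also have "\<dots> < 2 / ?p ^ N" using n a p unfolding nc by (simp add: field_simps)
      also have "\<dots> < d" using N d p by (simp add: field_simps)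
      finally have "padic_norm (\<omega> (fps_const ?c * f)) < 1" by (intro d tate_const_mult f)
      hence "padic_norm ?c * padic_norm (\<omega> f) < 1" by (simp only: sc[OF f] padic_norm_mult)
      hence "padic_norm (\<omega> f) < ?p ^ N * padic_norm ?a" using a p unfolding nc by (simp add: field_simps)
      also have "\<dots> \<le> ?p ^ N * gauss_norm f" using p by (intro mult_left_mono coeff_le_gauss_norm f) auto
      finally show ?thesis by simp
    qed (simp add: w0)
  qed
qed

lemma distributionsI:
  fixes \<omega> :: "'p::prime_card padic fps \<Rightarrow> 'p padic"
  assumes "\<And>f g. f \<in> tate \<Longrightarrow> g \<in> tate \<Longrightarrow> \<omega> (f + g) = \<omega> f + \<omega> g"
    and "\<And>c f. f \<in> tate \<Longrightarrow> \<omega> (fps_const c * f) = c * \<omega> f"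
    and bound: "\<And>f. f \<in> tate \<Longrightarrow> padic_norm (\<omega> f) \<le> K * gauss_norm f"
    and "\<And>f. f \<notin> tate \<Longrightarrow> \<omega> f = 0"
  shows "\<omega> \<in> distributions"
proof -
  have "\<exists>d>0. \<forall>g\<in>tate. gauss_norm (g - f) < d \<longrightarrow> dist (\<omega> g) (\<omega> f) < e"
    if f: "f \<in> tate" and e: "e > 0" for f :: "'p padic fps" and e :: real
  proof (intro exI[of _ "e / (\<bar>K\<bar> + 1)"] conjI ballI impI)
    show "e / (\<bar>K\<bar> + 1) > 0" using e by (intro divide_pos_pos) auto
    fix g :: "'p padic fps" assume g: "g \<in> tate" and l: "gauss_norm (g - f) < e / (\<bar>K\<bar> + 1)"
    have gf: "g - f \<in> tate" by (intro tate_diff g f)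
    have "\<omega> g = \<omega> (g - f) + \<omega> f" using assms(1)[OF gf f] by simp
    hence "dist (\<omega> g) (\<omega> f) = padic_norm (\<omega> (g - f))" by (simp add: dist_padic_def)
    also have "\<dots> \<le> K * gauss_norm (g - f)" by (rule bound[OF gf])
    also have "\<dots> \<le> (\<bar>K\<bar> + 1) * gauss_norm (g - f)" by (intro mult_right_mono gauss_norm_nonneg gf) auto
    also have "\<dots> < e" using l by (simp add: field_simps)
    finally show "dist (\<omega> g) (\<omega> f) < e" .
  qed
  thus ?thesis using assms unfolding distributions_def by blast
qed

section \<open>Integral matrices\<close>

lemma padic_units_iff: "x \<in> padic_units \<longleftrightarrow> padic_norm (x :: 'p::prime_card padic) = 1"
proof
  assume "x \<in> padic_units"
  then obtain y where y: "padic_norm x \<le> 1" "padic_norm y \<le> 1" "x * y = 1"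
    by (auto simp: padic_units_def padic_ints_def)
  have "1 = padic_norm x * padic_norm y" using arg_cong[OF y(3), of padic_norm] by (simp add: padic_norm_mult)
  also have "\<dots> \<le> padic_norm x * 1" using y by (intro mult_left_mono) auto
  finally show "padic_norm x = 1" using y by simp
next
  assume x: "padic_norm x = 1"
  hence "x \<noteq> 0" by auto
  thus "x \<in> padic_units" using x
    by (auto simp: padic_units_def padic_ints_def padic_norm_inverse intro!: exI[of _ "inverse x"])
qed

lemma padic_p_multiple_iff:
  "(\<exists>z\<in>padic_ints. x = of_nat CARD('p) * z) \<longleftrightarrow> padic_norm (x :: 'p::prime_card padic) < 1"
proof
  assume "\<exists>z\<in>padic_ints. x = of_nat CARD('p) * z"
  thus "padic_norm x < 1" using CARD_gt_1_real[where 'p='p]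
    by (auto simp: padic_ints_def padic_norm_mult padic_norm_p field_simps)
next
  assume "padic_norm x < 1"
  hence "padic_norm (x / of_nat CARD('p)) \<le> 1" using padic_norm_less_1[of x] CARD_gt_1_real[where 'p='p]
    by (simp add: padic_norm_divide padic_norm_p field_simps)
  moreover have "x = of_nat CARD('p) * (x / of_nat CARD('p))" using CARD_gt_1[where 'p='p] by simp
  ultimately show "\<exists>z\<in>padic_ints. x = of_nat CARD('p) * z" by (auto simp: padic_ints_def)
qed

lemma mat2_ints_iff: "g \<in> mat2_ints \<longleftrightarrow> (\<forall>i j. padic_norm (g $ i $ j) \<le> 1)"
  by (simp add: mat2_ints_def padic_ints_def)

lemma Gamma0_iff: "g \<in> Gamma0 \<longleftrightarrow> g \<in> mat2_ints \<and> padic_norm (det g) = 1 \<and> padic_norm (g $ 2 $ 1) < 1"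
  by (simp add: Gamma0_def padic_units_iff padic_p_multiple_iff)

lemma padic_norm_mult_le_1:
  "padic_norm x \<le> 1 \<Longrightarrow> padic_norm y \<le> 1 \<Longrightarrow> padic_norm (x * y :: 'p::prime_card padic) \<le> 1"
  by (simp add: padic_norm_mult mult_le_one)

lemma padic_norm_add_le: "padic_norm x \<le> C \<Longrightarrow> padic_norm y \<le> C \<Longrightarrow> padic_norm (x + y :: 'p::prime_card padic) \<le> C"
  using padic_norm_add[of x y] by linarith

lemma padic_norm_diff_le: "padic_norm x \<le> C \<Longrightarrow> padic_norm y \<le> C \<Longrightarrow> padic_norm (x - y :: 'p::prime_card padic) \<le> C"
  using padic_norm_diff[of x y] by linarith

lemma mat2_ints_det: "g \<in> mat2_ints \<Longrightarrow> padic_norm (det g) \<le> 1"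
  by (auto simp: mat2_ints_iff det_2 intro!: padic_norm_diff_le padic_norm_mult_le_1)

lemma Gamma0_near_1:
  fixes s :: "'p::prime_card padic ^ 2 ^ 2"
  assumes "\<And>i j. padic_norm (s $ i $ j - (if i = j then 1 else 0)) < 1"
  shows "s \<in> Gamma0"
proof -
  have d: "padic_norm (s $ i $ i) = 1" for i
    using padic_norm_close[of 1 "s $ i $ i"] assms[of i i] by (simp add: padic_norm_minus_commute)
  have o: "padic_norm (s $ i $ j) < 1" if "i \<noteq> j" for i j using assms[of i j] that by simp
  have ints: "padic_norm (s $ i $ j) \<le> 1" for i j using d[of i] o[of i j] by (cases "i = j") auto
  have "padic_norm (s $ 1 $ 2) * padic_norm (s $ 2 $ 1) < 1"
    using o[of 1 2] o[of 2 1] by (simp add: mult_less_le_imp_less mult_strict_mono' le_less_trans[OF mult_left_le])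
  hence "padic_norm (s $ 1 $ 1 * s $ 2 $ 2 - det s) < padic_norm (s $ 1 $ 1 * s $ 2 $ 2)"
    by (simp add: det_2 padic_norm_mult d)
  from padic_norm_close[OF this] have "padic_norm (det s) = 1" by (simp add: padic_norm_mult d)
  thus ?thesis using ints o[of 2 1] by (simp add: Gamma0_iff mat2_ints_iff)
qed

text \<open>Cramer's rule: one row of the adjugate of a primitive matrix \<open>g\<close> decides divisibility by \<open>g\<close>,
  so that \<open>M\<^sub>2(\<int>\<^sub>p) / g M\<^sub>2(\<int>\<^sub>p)\<close> has at most \<open>\<bar>det g\<bar>\<^sup>-\<^sup>2\<close> elements.\<close>

lemma primitive_divisibility_row:
  fixes g :: "'p::prime_card padic ^ 2 ^ 2"
  assumes g: "g \<in> mat2_ints" and i: "g $ i $ j = 1" and d: "det g \<noteq> 0"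
  obtains r s where "padic_norm r \<le> 1" "padic_norm s \<le> 1"
    "\<And>X. X \<in> mat2_ints \<Longrightarrow> (\<And>c. padic_norm (r * X $ 1 $ c + s * X $ 2 $ c) \<le> padic_norm (det g)) \<Longrightarrow>
      matrix_inv g ** X \<in> mat2_ints"
proof -
  let ?a = "g $ 1 $ 1" and ?b = "g $ 1 $ 2" and ?c = "g $ 2 $ 1" and ?d = "g $ 2 $ 2"
  let ?D = "padic_norm (det g)"
  have n: "padic_norm ?a \<le> 1" "padic_norm ?b \<le> 1" "padic_norm ?c \<le> 1" "padic_norm ?d \<le> 1"
    using g by (auto simp: mat2_ints_iff)
  have det: "det g = ?a * ?d - ?b * ?c" by (simp add: det_2)
  have inv: "matrix_inv g ** X \<in> mat2_ints"
    if 1: "\<And>c. padic_norm (?d * X $ 1 $ c - ?b * X $ 2 $ c) \<le> ?D"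
      and 2: "\<And>c. padic_norm (- ?c * X $ 1 $ c + ?a * X $ 2 $ c) \<le> ?D" for X
  proof -
    have "padic_norm ((matrix_inv g ** X) $ i $ c) \<le> 1" for i c
    proof -
      have "(matrix_inv g ** X) $ 1 $ c = (?d * X $ 1 $ c - ?b * X $ 2 $ c) / det g"
        "(matrix_inv g ** X) $ 2 $ c = (- ?c * X $ 1 $ c + ?a * X $ 2 $ c) / det g"
        using d by (simp_all add: mat2_mult_nth matrix_inv_2[OF d] vector_2 diff_divide_distrib add_divide_distrib)
      hence "padic_norm ((matrix_inv g ** X) $ 1 $ c) \<le> 1" "padic_norm ((matrix_inv g ** X) $ 2 $ c) \<le> 1"
        using 1[of c] 2[of c] padic_norm_pos[OF d] by (simp_all only: padic_norm_divide divide_le_eq_1_pos)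
      thus ?thesis using exhaust_2[of i] by auto
    qed
    thus ?thesis by (simp add: mat2_ints_iff)
  qed
  have other: "padic_norm (r' * x + s' * y) \<le> ?D"
    if "r = 1 \<or> s = 1" "padic_norm (r * x + s * y) \<le> ?D" "padic_norm (r * s' - s * r') \<le> ?D"
      "padic_norm r' \<le> 1" "padic_norm s' \<le> 1" "padic_norm x \<le> 1" "padic_norm y \<le> 1" for r s r' s' x y
  proof -
    have comb: "padic_norm (z * u + v * w) \<le> ?D"
      if "padic_norm z \<le> 1" "padic_norm w \<le> 1" "padic_norm u \<le> ?D" "padic_norm v \<le> ?D" for u v w z
      using that mult_mono[of "padic_norm z" 1 "padic_norm u" ?D] mult_mono[of "padic_norm v" ?D "padic_norm w" 1]
      by (intro padic_norm_add_le) (simp_all add: padic_norm_mult)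
    have "r = 1 \<Longrightarrow> r' * x + s' * y = r' * (r * x + s * y) + (r * s' - s * r') * y"
      "s = 1 \<Longrightarrow> r' * x + s' * y = s' * (r * x + s * y) + (- (r * s' - s * r')) * x"
      by (simp_all add: algebra_simps)
    moreover have "padic_norm (- (r * s' - s * r')) \<le> ?D" using that(3) by (simp only: padic_norm_minus)
    ultimately show ?thesis using that comb by metis
  qed
  show thesis
  proof (cases "?b = 1 \<or> ?d = 1")
    case True
    show thesis
    proof (rule that[of ?d "- ?b"])
      fix X :: "'p padic ^ 2 ^ 2"
      assume X: "X \<in> mat2_ints" and r: "\<And>c. padic_norm (?d * X $ 1 $ c + - ?b * X $ 2 $ c) \<le> ?D"
      show "matrix_inv g ** X \<in> mat2_ints"
      proof (rule inv)
        fix c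
        show "padic_norm (?d * X $ 1 $ c - ?b * X $ 2 $ c) \<le> ?D" using r[of c] by simp
        have 1: "?d = 1 \<or> ?b = 1" using True by auto
        have 2: "padic_norm (?d * X $ 1 $ c + ?b * (- X $ 2 $ c)) \<le> ?D" using r[of c] by simp
        have 3: "padic_norm (?d * - ?a - ?b * - ?c) \<le> ?D" using padic_norm_minus[of "det g"] by (simp add: det algebra_simps)
        show "padic_norm (- ?c * X $ 1 $ c + ?a * X $ 2 $ c) \<le> ?D"
          using other[OF 1 2 3] n X by (simp add: mat2_ints_iff)
      qed
    qed (use n in auto)
  next
    case False
    show thesis
    proof (rule that[of "- ?c" ?a])
      fix X :: "'p padic ^ 2 ^ 2"
      assume X: "X \<in> mat2_ints" and r: "\<And>c. padic_norm (- ?c * X $ 1 $ c + ?a * X $ 2 $ c) \<le> ?D"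
      show "matrix_inv g ** X \<in> mat2_ints"
      proof (rule inv)
        fix c
        show "padic_norm (- ?c * X $ 1 $ c + ?a * X $ 2 $ c) \<le> ?D" by (rule r)
        have 1: "?c = 1 \<or> ?a = 1" using i False exhaust_2[of i] exhaust_2[of j] by auto
        have 2: "padic_norm (?c * (- X $ 1 $ c) + ?a * X $ 2 $ c) \<le> ?D" using r[of c] by simp
        have 3: "padic_norm (?c * - ?b - ?a * - ?d) \<le> ?D" by (simp add: det algebra_simps)
        show "padic_norm (?d * X $ 1 $ c - ?b * X $ 2 $ c) \<le> ?D"
          using other[OF 1 2 3] n X by (simp add: mat2_ints_iff)
      qed
    qed (use n in auto)
  qed
qed

lemma primitive_scaling:
  fixes g :: "'p::prime_card padic ^ 2 ^ 2"
  assumes "det g \<noteq> 0"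
  obtains w i j where "w \<noteq> 0" "mat w ** g \<in> mat2_ints" "(mat w ** g) $ i $ j = 1"
proof -
  let ?S = "(\<lambda>(i, j). padic_norm (g $ i $ j)) ` (UNIV :: (2 \<times> 2) set)"
  have "Max ?S \<in> ?S" by (intro Max_in) auto
  then obtain z where z: "Max ?S = (\<lambda>(i, j). padic_norm (g $ i $ j)) z" by (rule imageE)
  obtain i j where "z = (i, j)" by (cases z)
  with z have ij: "padic_norm (g $ i $ j) = Max ?S" by simp
  have le: "padic_norm (g $ k $ l) \<le> padic_norm (g $ i $ j)" for k l
    unfolding ij by (intro Max_ge) auto
  have nz: "g $ i $ j \<noteq> 0"
  proof
    assume "g $ i $ j = 0"
    hence "g $ k $ l = 0" for k l using le[of k l] by (simp add: padic_norm_eq_0_iff[symmetric] antisym)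
    thus False using assms by (simp add: det_2)
  qed
  have "padic_norm ((mat (inverse (g $ i $ j)) ** g) $ k $ l) \<le> 1" for k l
    using le[of k l] padic_norm_pos[OF nz]
    by (simp add: mat2_smult_nth padic_norm_mult padic_norm_inverse padic_norm_divide divide_simps)
  thus thesis using nz by (intro that[of "inverse (g $ i $ j)" i j]) (auto simp: mat2_ints_iff mat2_smult_nth)
qed

section \<open>Quaternions\<close>

lemma quat_alg_simps:
  fixes a b :: "'a::comm_ring_1"
  shows "carrier (quat_alg type_ring a b) = UNIV"
    "(x0, x1, x2, x3) \<otimes>\<^bsub>quat_alg type_ring a b\<^esub> (y0, y1, y2, y3) =
      (x0 * y0 + a * x1 * y1 + b * x2 * y2 - a * b * x3 * y3,
       x0 * y1 + x1 * y0 - b * x2 * y3 + b * x3 * y2,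
       x0 * y2 + x2 * y0 + a * x1 * y3 - a * x3 * y1,
       x0 * y3 + x3 * y0 + x1 * y2 - x2 * y1)"
    "(x0, x1, x2, x3) \<oplus>\<^bsub>quat_alg type_ring a b\<^esub> (y0, y1, y2, y3) = (x0 + y0, x1 + y1, x2 + y2, x3 + y3)"
    "\<one>\<^bsub>quat_alg type_ring a b\<^esub> = (1, 0, 0, 0)" "\<zero>\<^bsub>quat_alg type_ring a b\<^esub> = (0, 0, 0, 0)"
  by (simp_all add: quat_alg_def type_ring_simps)

lemma quat_nsmult:
  fixes a b :: "'a::comm_ring_1"
  shows "[(n::nat)] \<cdot>\<^bsub>quat_alg type_ring a b\<^esub> (x0, x1, x2, x3) = (of_nat n * x0, of_nat n * x1, of_nat n * x2, of_nat n * x3)"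
proof -
  let ?M = "add_monoid (quat_alg type_ring a b)"
  have "(x0, x1, x2, x3) [^]\<^bsub>?M\<^esub> n = (of_nat n * x0, of_nat n * x1, of_nat n * x2, of_nat n * x3)"
    by (induction n) (simp_all add: nat_pow_def quat_alg_simps algebra_simps)
  thus ?thesis by (simp add: add_pow_def)
qed

text \<open>If \<open>a > 0\<close> then \<open>\<surd>a + i\<close> divides zero in the real quaternion algebra, and likewise for \<open>b\<close> and \<open>j\<close>.\<close>

lemma definite_quat_negative:
  assumes "definite_quat a b" "a \<noteq> 0" "b \<noteq> 0"
  shows "a < 0" "b < 0"
proof -
  define A B :: real where "A = of_rat a" and "B = of_rat b"
  have u: "\<exists>y. y \<otimes>\<^bsub>quat_alg type_ring A B\<^esub> x = (1, 0, 0, 0)" if "x \<noteq> (0, 0, 0, 0)" for x :: "real \<times> real \<times> real \<times> real"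
  proof -
    have "x \<in> Units (quat_alg type_ring A B)"
      using assms(1) that unfolding definite_quat_def is_division_ring_def A_def B_def by (simp add: quat_alg_simps)
    thus ?thesis by (auto simp: Units_def quat_alg_simps)
  qed
  have "\<not> 0 < A"
  proof
    assume A: "0 < A"
    define s where "s = sqrt A"
    have s: "s * s = A" using A by (simp add: s_def)
    obtain y0 y1 y2 y3 where y: "(y0, y1, y2, y3) \<otimes>\<^bsub>quat_alg type_ring A B\<^esub> (s, 1, 0, 0) = (1, 0, 0, 0)"
      using u[of "(s, 1, 0, 0)"] by (metis prod.exhaust zero_neq_one prod.inject)
    hence "y0 = - y1 * s" "y0 * s + A * y1 = 1" by (simp_all add: quat_alg_simps)
    thus False by (simp add: s[symmetric])
  qed
  moreover have "\<not> 0 < B"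
  proof
    assume B: "0 < B"
    define s where "s = sqrt B"
    have s: "s * s = B" using B by (simp add: s_def)
    obtain y0 y1 y2 y3 where y: "(y0, y1, y2, y3) \<otimes>\<^bsub>quat_alg type_ring A B\<^esub> (s, 0, 1, 0) = (1, 0, 0, 0)"
      using u[of "(s, 0, 1, 0)"] by (metis prod.exhaust zero_neq_one prod.inject)
    hence "y0 = - y2 * s" "y0 * s + B * y2 = 1" by (simp_all add: quat_alg_simps)
    thus False by (simp add: s[symmetric])
  qed
  ultimately show "a < 0" "b < 0" using assms(2,3) by (auto simp: A_def B_def)
qed

fun quat_conj :: "rat \<times> rat \<times> rat \<times> rat \<Rightarrow> rat \<times> rat \<times> rat \<times> rat" where
  "quat_conj (x0, x1, x2, x3) = (x0, - x1, - x2, - x3)"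

lemma quat_nrd_mult: "quat_nrd a b (x \<otimes>\<^bsub>rat_quat a b\<^esub> y) = quat_nrd a b x * quat_nrd a b y"
  by (cases x; cases y) (simp add: quat_alg_simps power2_eq_square algebra_simps)

lemma quat_nrd_conj: "quat_nrd a b (quat_conj x) = quat_nrd a b x"
  by (cases x) simp

lemma quat_nrd_pos:
  assumes "a < 0" "b < 0" "x \<noteq> (0, 0, 0, 0)"
  shows "quat_nrd a b x > 0"
proof -
  obtain x0 x1 x2 x3 where x: "x = (x0, x1, x2, x3)" by (cases x)
  have t: "x0\<^sup>2 \<ge> 0" "- a * x1\<^sup>2 \<ge> 0" "- b * x2\<^sup>2 \<ge> 0" "a * b * x3\<^sup>2 \<ge> 0"
    using assms(1,2) by (simp_all add: mult_nonpos_nonneg mult_nonpos_nonpos)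
  have "x0 \<noteq> 0 \<Longrightarrow> x0\<^sup>2 > 0" "x1 \<noteq> 0 \<Longrightarrow> - a * x1\<^sup>2 > 0" "x2 \<noteq> 0 \<Longrightarrow> - b * x2\<^sup>2 > 0" "x3 \<noteq> 0 \<Longrightarrow> a * b * x3\<^sup>2 > 0"
    using assms(1,2) by (simp_all add: mult_neg_pos mult_neg_neg)
  thus ?thesis using assms(3) t unfolding x by fastforce
qed

locale quat_splitting =
  fixes a b :: rat and \<iota> :: "'p padic \<times> 'p padic \<times> 'p padic \<times> 'p::prime_card padic \<Rightarrow> 'p padic ^ 2 ^ 2"
  assumes splitting: "is_splitting a b \<iota>"
begin

definition emb :: "rat \<times> rat \<times> rat \<times> rat \<Rightarrow> 'p padic ^ 2 ^ 2" where
  "emb x = \<iota> (quat_of_rat x)"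

lemma iota_hom: "\<iota> \<in> Ring.ring_hom (padic_quat a b) mat2_ring" and iota_inj: "inj \<iota>"
  using splitting by (auto simp: is_splitting_def ring_iso_def bij_betw_def quat_alg_simps)

lemma emb_mult: "emb (x \<otimes>\<^bsub>rat_quat a b\<^esub> y) = emb x ** emb y"
proof -
  have "quat_of_rat (x \<otimes>\<^bsub>rat_quat a b\<^esub> y) = quat_of_rat x \<otimes>\<^bsub>padic_quat a b\<^esub> (quat_of_rat y :: 'p padic \<times> 'p padic \<times> 'p padic \<times> 'p padic)"
    by (cases x; cases y) (simp add: quat_alg_simps of_rat_add of_rat_mult of_rat_diff)
  thus ?thesis using ring_hom_mult[OF iota_hom, of "quat_of_rat x" "quat_of_rat y"]
    by (simp add: emb_def quat_alg_simps mat2_ring_def)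
qed

lemma emb_add: "emb (x \<oplus>\<^bsub>rat_quat a b\<^esub> y) = emb x + emb y"
proof -
  have "quat_of_rat (x \<oplus>\<^bsub>rat_quat a b\<^esub> y) = quat_of_rat x \<oplus>\<^bsub>padic_quat a b\<^esub> (quat_of_rat y :: 'p padic \<times> 'p padic \<times> 'p padic \<times> 'p padic)"
    by (cases x; cases y) (simp add: quat_alg_simps of_rat_add)
  thus ?thesis using ring_hom_add[OF iota_hom, of "quat_of_rat x" "quat_of_rat y"]
    by (simp add: emb_def quat_alg_simps mat2_ring_def)
qed

lemma emb_scalar: "emb (c, 0, 0, 0) = mat (of_rat c)"
  using splitting by (simp add: emb_def is_splitting_def)

text \<open>An element \<open>x\<close> with conjugate \<open>y\<close> satisfies \<open>X(t - X) = n\<close> for its trace \<open>t\<close> and norm \<open>n\<close>. A matrix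
  that is not a scalar satisfies only one monic quadratic equation, so \<open>n\<close> is its determinant; scalars come
  from scalars because the splitting is injective.\<close>

lemma det_emb: "det (emb x) = of_rat (quat_nrd a b x)"
proof -
  obtain x0 x1 x2 x3 where x: "x = (x0, x1, x2, x3)" by (cases x)
  let ?X = "emb x" and ?Y = "emb (quat_conj x)"
  define n t :: "'p padic" where "n = of_rat (quat_nrd a b x)" and "t = of_rat (2 * x0)"
  have "?X ** ?Y = mat n"
    unfolding emb_mult[symmetric] n_def emb_scalar[symmetric] x quat_conj.simps
    by (simp only: quat_mult_conj)
  moreover have sum: "?X + ?Y = mat t"
    unfolding emb_add[symmetric] t_def emb_scalar[symmetric] x by (simp add: quat_alg_simps)
  have "?Y $ i $ j = (mat t :: 'p padic ^ 2 ^ 2) $ i $ j - ?X $ i $ j" for i j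
    unfolding sum[symmetric] by simp
  ultimately have q: "(\<Sum>l\<in>UNIV. ?X $ i $ l * ((mat t :: 'p padic ^ 2 ^ 2) $ l $ j - ?X $ l $ j)) = (mat n :: 'p padic ^ 2 ^ 2) $ i $ j" for i j
    by (metis (no_types, lifting) matrix_matrix_mult_def sum.cong vec_lambda_beta)
  let ?a = "?X $ 1 $ 1" and ?b = "?X $ 1 $ 2" and ?c = "?X $ 2 $ 1" and ?d = "?X $ 2 $ 2"
  have e11: "?a * (t - ?a) - ?b * ?c = n" using q[of 1 1] by (simp add: sum_2 mat2_scalar_nth)
  have e12: "?b * (t - ?a - ?d) = 0" using q[of 1 2] by (simp add: sum_2 mat2_scalar_nth algebra_simps)
  have e21: "?c * (t - ?a - ?d) = 0" using q[of 2 1] by (simp add: sum_2 mat2_scalar_nth algebra_simps)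
  have e22: "?d * (t - ?d) - ?b * ?c = n" using q[of 2 2] by (simp add: sum_2 mat2_scalar_nth algebra_simps)
  have "?a * (t - ?a) - ?d * (t - ?d) = 0" using e11 e22 by (simp add: algebra_simps)
  hence ed: "(?a - ?d) * (t - ?a - ?d) = 0" by (simp add: algebra_simps)
  show ?thesis
  proof (cases "t - ?a - ?d = 0")
    case True
    hence "t = ?a + ?d" by (simp add: algebra_simps)
    thus ?thesis using e11 unfolding n_def[symmetric] by (simp add: det_2 algebra_simps)
  next
    case False
    hence z: "?b = 0" "?c = 0" "?a = ?d" using e12 e21 ed by auto
    have "?X = mat ?a" by (rule mat2_eqI) (simp_all add: mat2_scalar_nth z)
    hence "\<iota> (quat_of_rat x) = \<iota> (?a, 0, 0, 0)"
      using splitting by (simp add: emb_def is_splitting_def)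
    hence "quat_of_rat x = (?a, 0, 0, 0)" by (rule injD[OF iota_inj])
    hence "x1 = 0" "x2 = 0" "x3 = 0" "?a = of_rat x0" unfolding x by (auto simp: of_rat_eq_0_iff)
    thus ?thesis unfolding x using z by (simp add: det_2 x power2_eq_square of_rat_mult)
  qed
qed

end

section \<open>Finiteness of the double coset space\<close>

locale definite_arithmetic_group = quat_splitting a b \<iota>
  for a b :: rat and \<iota> :: "'p padic \<times> 'p padic \<times> 'p padic \<times> 'p::prime_card padic \<Rightarrow> 'p padic ^ 2 ^ 2" +
  fixes R :: "(rat \<times> rat \<times> rat \<times> rat) set"
  assumes a_neg: "a < 0" and b_neg: "b < 0"
    and subring: "subring R (rat_quat a b)"
    and torsion: "\<And>x. \<exists>n::nat. n > 0 \<and> [n] \<cdot>\<^bsub>rat_quat a b\<^esub> x \<in> R"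
    and integral: "\<And>x. x \<in> R \<Longrightarrow> \<iota> (quat_of_rat x) \<in> mat2_ints"
begin

abbreviation qmult (infixl "\<odot>" 70) where "x \<odot> y \<equiv> x \<otimes>\<^bsub>rat_quat a b\<^esub> y"
abbreviation qadd (infixl "\<boxplus>" 65) where "x \<boxplus> y \<equiv> x \<oplus>\<^bsub>rat_quat a b\<^esub> y"

lemma R_mult: "x \<in> R \<Longrightarrow> y \<in> R \<Longrightarrow> x \<odot> y \<in> R"
  using subringE(6)[OF subring] by blast

lemma R_add: "x \<in> R \<Longrightarrow> y \<in> R \<Longrightarrow> x \<boxplus> y \<in> R"
  using subringE(7)[OF subring] by blast

lemma R_scalar: "(of_int n, 0, 0, 0) \<in> R"
proof -
  have one: "(1, 0, 0, 0) \<in> R" using subringE(3)[OF subring] by (simp add: quat_alg_simps)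
  have zero: "(0, 0, 0, 0) \<in> R" using subringE(2)[OF subring] by (simp add: quat_alg_simps)
  have "\<ominus>\<^bsub>rat_quat a b\<^esub> (1, 0, 0, 0) = (- 1, 0, 0, 0)"
    unfolding a_inv_def m_inv_def by (rule the_equality) (auto simp: quat_alg_simps)
  hence mone: "(- 1, 0, 0, 0) \<in> R" using subringE(5)[OF subring one] by simp
  have nat: "(of_nat n, 0, 0, 0) \<in> R" for n
  proof (induction n)
    case (Suc n)
    thus ?case using R_add[OF one Suc] by (simp add: quat_alg_simps)
  qed (use zero in simp)
  show ?thesis
  proof (cases n rule: int_cases2)
    case (nonpos m)
    thus ?thesis using R_mult[OF mone nat[of m]] by (simp add: quat_alg_simps)
  qed (use nat in simp)
qed

lemma R_scale: "(x0, x1, x2, x3) \<in> R \<Longrightarrow> (of_int n * x0, of_int n * x1, of_int n * x2, of_int n * x3) \<in> R"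
  using R_mult[OF R_scalar[of n], of "(x0, x1, x2, x3)"] by (simp add: quat_alg_simps)

text \<open>A common denominator: \<open>R\<close> contains the lattice with basis \<open>N, N i, N j, N i j\<close>, and the reduced norm
  is integral on that lattice.\<close>

lemma conductor_exists:
  "\<exists>N A B :: int. N > 0 \<and> of_int A = of_int N * a \<and> of_int B = of_int N * b \<and>
    (0, of_int N, 0, 0) \<in> R \<and> (0, 0, of_int N, 0) \<in> R \<and> (0, 0, 0, of_int N) \<in> R"
proof -
  have t: "\<exists>n::int. n > 0 \<and> (of_int n * x0, of_int n * x1, of_int n * x2, of_int n * x3) \<in> R" for x0 x1 x2 x3
  proof -
    obtain n :: nat where "n > 0" "[n] \<cdot>\<^bsub>rat_quat a b\<^esub> (x0, x1, x2, x3) \<in> R"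
      using torsion by blast
    thus ?thesis by (intro exI[of _ "int n"]) (simp add: quat_nsmult)
  qed
  obtain n1 where n1: "n1 > 0" "(0, of_int n1, 0, 0) \<in> R" using t[of 0 1 0 0] by auto
  obtain n2 where n2: "n2 > 0" "(0, 0, of_int n2, 0) \<in> R" using t[of 0 0 1 0] by auto
  obtain n3 where n3: "n3 > 0" "(0, 0, 0, of_int n3) \<in> R" using t[of 0 0 0 1] by auto
  obtain ra da where qa: "quotient_of a = (ra, da)" by force
  obtain rb db where qb: "quotient_of b = (rb, db)" by force
  have da: "da > 0" "a = of_int ra / of_int da" using quotient_of_denom_pos[OF qa] quotient_of_div[OF qa] by auto
  have db: "db > 0" "b = of_int rb / of_int db" using quotient_of_denom_pos[OF qb] quotient_of_div[OF qb] by auto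
  show ?thesis
  proof (intro exI conjI)
    show "n1 * n2 * n3 * da * db > 0" using n1 n2 n3 da db by simp
    show "of_int (n1 * n2 * n3 * ra * db) = of_int (n1 * n2 * n3 * da * db) * a" using da by simp
    show "of_int (n1 * n2 * n3 * da * rb) = of_int (n1 * n2 * n3 * da * db) * b" using db by simp
    show "(0, of_int (n1 * n2 * n3 * da * db), 0, 0) \<in> R"
      using R_scale[OF n1(2), of "n2 * n3 * da * db"] by (simp add: mult_ac)
    show "(0, 0, of_int (n1 * n2 * n3 * da * db), 0) \<in> R"
      using R_scale[OF n2(2), of "n1 * n3 * da * db"] by (simp add: mult_ac)
    show "(0, 0, 0, of_int (n1 * n2 * n3 * da * db)) \<in> R"
      using R_scale[OF n3(2), of "n1 * n2 * da * db"] by (simp add: mult_ac)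
  qed
qed

definition N :: int where
  "N = (SOME N. \<exists>A B :: int. N > 0 \<and> of_int A = of_int N * a \<and> of_int B = of_int N * b \<and>
    (0, of_int N, 0, 0) \<in> R \<and> (0, 0, of_int N, 0) \<in> R \<and> (0, 0, 0, of_int N) \<in> R)"

definition A :: int where "A = (SOME A. of_int A = of_int N * a)"
definition B :: int where "B = (SOME B. of_int B = of_int N * b)"

lemma conductor:
  "N > 0" "of_int A = of_int N * a" "of_int B = of_int N * b"
  "(0, of_int N, 0, 0) \<in> R" "(0, 0, of_int N, 0) \<in> R" "(0, 0, 0, of_int N) \<in> R"
proof -
  have ex: "\<exists>A B :: int. N > 0 \<and> of_int A = of_int N * a \<and> of_int B = of_int N * b \<and>
    (0, of_int N, 0, 0) \<in> R \<and> (0, 0, of_int N, 0) \<in> R \<and> (0, 0, 0, of_int N) \<in> R"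
    unfolding N_def using someI_ex[OF conductor_exists] .
  thus "N > 0" "(0, of_int N, 0, 0) \<in> R" "(0, 0, of_int N, 0) \<in> R" "(0, 0, 0, of_int N) \<in> R" by blast+
  show "of_int A = of_int N * a" unfolding A_def by (rule someI_ex) (use ex in blast)
  show "of_int B = of_int N * b" unfolding B_def by (rule someI_ex) (use ex in blast)
qed

lemma AB_neg: "A < 0" "B < 0"
proof -
  have "(of_int A :: rat) < 0" "(of_int B :: rat) < 0"
    unfolding conductor using a_neg b_neg conductor(1) by (simp_all add: mult_pos_neg)
  thus "A < 0" "B < 0" by simp_all
qed

fun lat :: "int \<times> int \<times> int \<times> int \<Rightarrow> rat \<times> rat \<times> rat \<times> rat" where
  "lat (y0, y1, y2, y3) = (of_int (N * y0), of_int (N * y1), of_int (N * y2), of_int (N * y3))"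

lemma lat_add: "lat (y + z) = lat y \<boxplus> lat z"
  by (cases y; cases z) (simp add: quat_alg_simps algebra_simps)

lemma lat_R: "lat y \<in> R"
proof -
  obtain y0 y1 y2 y3 where y: "y = (y0, y1, y2, y3)" by (cases y)
  have "lat y = ((of_int (N * y0), 0, 0, 0) \<boxplus> (0, of_int (N * y1), 0, 0)) \<boxplus> ((0, 0, of_int (N * y2), 0) \<boxplus> (0, 0, 0, of_int (N * y3)))"
    by (simp add: y quat_alg_simps)
  also have "\<dots> \<in> R"
    using R_scale[OF conductor(4), of y1] R_scale[OF conductor(5), of y2] R_scale[OF conductor(6), of y3]
    by (intro R_add R_scalar) (simp_all add: mult.commute)
  finally show ?thesis .
qed

lemma lat_conj: "quat_conj (lat y) \<in> R"
proof -
  obtain y0 y1 y2 y3 where y: "y = (y0, y1, y2, y3)" by (cases y)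
  have "quat_conj (lat y) = lat (y0, - y1, - y2, - y3)" by (simp add: y)
  thus ?thesis by (simp only: lat_R)
qed

lemma lat_emb: "emb (lat y) \<in> mat2_ints"
  unfolding emb_def by (rule integral[OF lat_R])

fun nrd_form :: "int \<times> int \<times> int \<times> int \<Rightarrow> int" where
  "nrd_form (y0, y1, y2, y3) = N\<^sup>2 * y0\<^sup>2 - N * A * y1\<^sup>2 - N * B * y2\<^sup>2 + A * B * y3\<^sup>2"

lemma nrd_lat: "quat_nrd a b (lat y) = of_int (nrd_form y)"
  by (cases y) (simp add: conductor(2,3) power2_eq_square algebra_simps)

lemma nrd_form_pos:
  assumes "y \<noteq> 0"
  shows "nrd_form y > 0"
proof -
  have "lat y \<noteq> (0, 0, 0, 0)" using assms conductor(1) by (cases y) (auto simp: zero_prod_def)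
  from quat_nrd_pos[OF a_neg b_neg this] show ?thesis by (simp add: nrd_lat)
qed

definition nrd_const :: int where "nrd_const = N\<^sup>2 - N * A - N * B + A * B"

lemma nrd_const_nonneg: "0 \<le> nrd_const"
  using nrd_form_pos[of "(1, 1, 1, 1)"] by (simp add: nrd_const_def zero_prod_def)

lemma nrd_form_le:
  assumes "\<bar>y0\<bar> \<le> h" "\<bar>y1\<bar> \<le> h" "\<bar>y2\<bar> \<le> h" "\<bar>y3\<bar> \<le> h"
  shows "nrd_form (y0, y1, y2, y3) \<le> nrd_const * h\<^sup>2"
proof -
  have sq: "y\<^sup>2 \<le> h\<^sup>2" if "\<bar>y\<bar> \<le> h" for y :: int using that by (metis abs_ge_zero power2_abs power_mono)
  have "N\<^sup>2 * y0\<^sup>2 \<le> N\<^sup>2 * h\<^sup>2" "(- N * A) * y1\<^sup>2 \<le> (- N * A) * h\<^sup>2" "(- N * B) * y2\<^sup>2 \<le> (- N * B) * h\<^sup>2"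
    "(A * B) * y3\<^sup>2 \<le> (A * B) * h\<^sup>2"
    using conductor(1) AB_neg
    by (intro mult_left_mono sq assms; simp add: mult_pos_neg mult_neg_neg less_imp_le)+
  thus ?thesis by (simp add: nrd_const_def algebra_simps)
qed

text \<open>A substitute for Minkowski's theorem. The condition that \<open>g\<close> divides the image of a lattice point
  consists of two congruences modulo \<open>p\<^sup>v\<close>, where \<open>\<bar>det g\<bar> = p\<^sup>-\<^sup>v\<close>, so among more than \<open>p\<^sup>2\<^sup>v\<close> points of a box two
  have a difference that satisfies it.\<close>

lemma short_element:
  fixes g :: "'p padic ^ 2 ^ 2"
  assumes g: "g \<in> mat2_ints" and i: "g $ i $ j = 1" and d: "det g \<noteq> 0"
  obtains v n z m where "emb (lat z) = g ** m" "m \<in> mat2_ints" "quat_nrd a b (lat z) = of_nat (n * CARD('p) ^ v)"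
    "0 < n" "n \<le> nat nrd_const * CARD('p)" "padic_norm (det m) = padic_norm (of_nat n :: 'p padic)"
proof -
  let ?p = "CARD('p)"
  have p1: "real ?p > 1" by (rule CARD_gt_1_real)
  obtain l where l: "padic_norm (det g) = real ?p powi l" using padic_norm_discrete[OF d] .
  have "\<not> l > 0"
  proof
    assume "l > 0"
    hence "real ?p powi 0 < real ?p powi l" using p1 by (intro power_int_strict_increasing) auto
    thus False using mat2_ints_det[OF g] l by simp
  qed
  define v where "v = nat (- l)"
  have dv: "padic_norm (det g) = 1 / real ?p ^ v"
    using \<open>\<not> l > 0\<close> by (simp add: l v_def power_int_def divide_inverse power_inverse)
  obtain r s where rs: "padic_norm r \<le> 1" "padic_norm s \<le> 1"
    and div: "\<And>X. X \<in> mat2_ints \<Longrightarrow> (\<And>c. padic_norm (r * X $ 1 $ c + s * X $ 2 $ c) \<le> padic_norm (det g)) \<Longrightarrow>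
      matrix_inv g ** X \<in> mat2_ints"
    by (rule primitive_divisibility_row[OF g i d]) blast
  (* Four coordinates of size about p^(v/2) give more than p^(2v) points of norm at most about p^v. *)
  define h where "h = int ?p ^ ((v + 1) div 2)"
  have h: "h > 0" using CARD_gt_1[where 'p='p] by (simp add: h_def)
  define Y where "Y = {0..h} \<times> {0..h} \<times> {0..h} \<times> {0..h}"
  define row where "row = (\<lambda>(X :: 'p padic ^ 2 ^ 2) c. r * X $ 1 $ c + s * X $ 2 $ c)"
  define key where "key = (\<lambda>y. (padic_residue v (row (emb (lat y)) 1), padic_residue v (row (emb (lat y)) 2)))"
  have row1: "padic_norm (row (emb (lat y)) c) \<le> 1" for y c
    using lat_emb[of y] rs unfolding row_def mat2_ints_iff by (intro padic_norm_add_le padic_norm_mult_le_1) auto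
  have "key ` Y \<subseteq> {..<?p ^ v} \<times> {..<?p ^ v}"
    using padic_residue(1)[OF row1] by (auto simp: key_def)
  hence "card (key ` Y) \<le> card ({..<?p ^ v} \<times> {..<?p ^ v})" by (intro card_mono) auto
  also have "\<dots> = ?p ^ v * ?p ^ v" by simp
  also have "\<dots> < card Y"
  proof -
    have "int (card Y) = (h + 1) ^ 4" using h by (simp add: Y_def power4_eq_xxxx mult.assoc)
    moreover have "int ?p ^ v \<le> h * h"
      unfolding h_def power_add[symmetric] using p1 by (intro power_increasing) auto
    hence "int ?p ^ v * int ?p ^ v \<le> (h * h) * (h * h)" by (intro mult_mono) auto
    moreover have "(h * h) * (h * h) < (h + 1) ^ 4"
      using h power_strict_mono[of h "h + 1" 4] by (simp add: power4_eq_xxxx mult.assoc)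
    ultimately have "int (?p ^ v * ?p ^ v) < int (card Y)" by simp
    thus ?thesis by (simp only: of_nat_less_iff)
  qed
  finally have "\<not> inj_on key Y" by (rule pigeonhole)
  then obtain y y' where y: "y \<in> Y" "y' \<in> Y" "y \<noteq> y'" "key y = key y'"
    unfolding inj_on_def by blast
  define z where "z = y - y'"
  have z0: "z \<noteq> 0" using y by (simp add: z_def)
  have "emb (lat y) = emb (lat z) + emb (lat y')"
    unfolding emb_add[symmetric] lat_add[symmetric] by (simp add: z_def)
  hence ez: "emb (lat z) = emb (lat y) - emb (lat y')" by simp
  have "padic_norm (r * emb (lat z) $ 1 $ c + s * emb (lat z) $ 2 $ c) \<le> padic_norm (det g)" for c
  proof -
    have e: "padic_residue v (row (emb (lat y)) c) = padic_residue v (row (emb (lat y')) c)"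
      using y(4) exhaust_2[of c] by (auto simp: key_def)
    have "r * emb (lat z) $ 1 $ c + s * emb (lat z) $ 2 $ c = row (emb (lat y)) c - row (emb (lat y')) c"
      by (simp add: ez row_def algebra_simps)
    thus ?thesis using padic_residue_eq[OF row1 row1 e] dv by simp
  qed
  hence m: "matrix_inv g ** emb (lat z) \<in> mat2_ints" by (rule div[OF lat_emb])
  define m where "m = matrix_inv g ** emb (lat z)"
  have gm: "emb (lat z) = g ** m" by (simp add: m_def matrix_mul_assoc matrix_inv_right[OF d])
  have nz: "(of_int (nrd_form z) :: 'p padic) = det g * det m"
    using det_emb[of "lat z"] unfolding nrd_lat gm det_mul by simp
  have "padic_norm (of_int (nrd_form z) :: 'p padic) \<le> 1 / real ?p ^ v"
    unfolding nz padic_norm_mult dv using mat2_ints_det[OF m] p1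
    by (simp add: m_def[symmetric] divide_right_mono)
  hence "int ?p ^ v dvd nrd_form z" by (simp only: padic_norm_of_int_le_iff)
  then obtain n0 where n0: "nrd_form z = int ?p ^ v * n0" by blast
  have pv: "int ?p ^ v > 0" using CARD_gt_1[where 'p='p] by simp
  have n0p: "n0 > 0" using nrd_form_pos[OF z0] pv unfolding n0 by (simp add: zero_less_mult_iff)
  obtain z0 z1 z2 z3 where zz: "z = (z0, z1, z2, z3)" by (cases z)
  have "nrd_form z \<le> nrd_const * h\<^sup>2"
    unfolding zz by (rule nrd_form_le) (use y(1,2) zz in \<open>auto simp: Y_def z_def\<close>)
  also have "\<dots> \<le> nrd_const * int ?p ^ (v + 1)"
  proof (rule mult_left_mono)
    have "h\<^sup>2 = int ?p ^ ((v + 1) div 2 * 2)" by (simp add: h_def power_mult)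
    also have "\<dots> \<le> int ?p ^ (v + 1)" using p1 by (intro power_increasing) auto
    finally show "h\<^sup>2 \<le> int ?p ^ (v + 1)" .
    show "0 \<le> nrd_const" by (rule nrd_const_nonneg)
  qed
  finally have "int ?p ^ v * n0 \<le> int ?p ^ v * (nrd_const * int ?p)"
    unfolding n0 by (simp add: mult_ac)
  hence n0le: "n0 \<le> nrd_const * int ?p" using pv by simp
  show thesis
  proof (rule that[OF gm, of "nat n0" v])
    show "m \<in> mat2_ints" using m by (simp add: m_def)
    show "quat_nrd a b (lat z) = of_nat (nat n0 * ?p ^ v)" using n0p by (simp add: nrd_lat n0 mult.commute)
    show "0 < nat n0" using n0p by simp
    have "nat n0 \<le> nat (nrd_const * int ?p)" using n0le by simp
    thus "nat n0 \<le> nat nrd_const * ?p" by (simp add: nat_mult_distrib[OF nrd_const_nonneg])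
    have "padic_norm (det g) * padic_norm (det m) = padic_norm (of_int (nrd_form z) :: 'p padic)"
      by (simp only: nz padic_norm_mult)
    also have "\<dots> = 1 / real ?p ^ v * padic_norm (of_int n0 :: 'p padic)"
      unfolding n0 by (simp add: padic_norm_mult padic_norm_p_power)
    finally show "padic_norm (det m) = padic_norm (of_nat (nat n0) :: 'p padic)"
      using n0p p1 by (simp add: dv)
  qed
qed

text \<open>If \<open>x' = x + nr\<close> and \<open>x\<close> has norm \<open>np\<^sup>v\<close>, then \<open>x'x\<^sup>-\<^sup>1 = 1 + p\<^sup>-\<^sup>v r y\<close>, where \<open>y\<close> is the conjugate of \<open>x\<close>:
  the factor \<open>n\<close> cancels and only powers of \<open>p\<close> remain in the denominator. The norm of the quotient is an even
  power of \<open>p\<close>, so a power of \<open>p\<close> scales it to norm one.\<close>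

lemma same_double_coset:
  fixes g g' m m' :: "'p padic ^ 2 ^ 2"
  assumes x: "emb x = mat w ** g ** m" and x': "emb x' = mat w' ** g' ** m'" and w: "w \<noteq> 0" "w' \<noteq> 0"
    and xR: "quat_conj x \<in> R" and r: "r \<in> R" "x' = x \<boxplus> (of_nat n, 0, 0, 0) \<odot> r" and n: "n > 0"
    and nrd: "quat_nrd a b x = of_nat (n * CARD('p) ^ v)" "quat_nrd a b x' = of_nat (n * CARD('p) ^ v')"
    and par: "even (int v - int v')" and m': "det m' \<noteq> 0" and \<sigma>: "m ** matrix_inv m' \<in> Gamma0"
  shows "\<exists>u \<gamma> \<sigma>. u \<noteq> 0 \<and> \<gamma> \<in> quat_Gamma a b R \<iota> \<and> \<sigma> \<in> Gamma0 \<and> g' = mat u ** \<gamma> ** g ** \<sigma>"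
proof -
  let ?p = "CARD('p)"
  define P :: rat where "P = of_nat ?p"
  have P: "P > 0" using CARD_gt_1[where 'p='p] by (simp add: P_def)
  obtain e where e: "int v - int v' = 2 * e" using par by blast
  define s where "s = P powi e / (of_nat n * P ^ v)"
  have s0: "s \<noteq> 0" using P n by (simp add: s_def)
  define q where "q = (s, 0, 0, 0) \<odot> (x' \<odot> quat_conj x)"
  have nrdx: "quat_nrd a b x = of_nat n * P ^ v" "quat_nrd a b x' = of_nat n * P ^ v'"
    using nrd by (simp_all add: P_def)
  have vv: "P ^ v = P powi e * P powi e * P ^ v'"
  proof -
    have "int v = e + e + int v'" using e by simp
    hence "P powi int v = P powi (e + e + int v')" by (rule arg_cong)
    also have "\<dots> = P powi e * P powi e * P powi int v'" using P by (simp only: power_int_add[OF disjI1[OF less_imp_neq[OF P, symmetric]]])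
    finally show ?thesis by simp
  qed
  have q1: "quat_nrd a b q = 1"
  proof -
    have "quat_nrd a b q = s\<^sup>2 * (of_nat n * P ^ v' * (of_nat n * P ^ v))"
      unfolding q_def quat_nrd_mult nrdx quat_nrd_conj by simp
    also have "\<dots> = (P powi e * P powi e * P ^ v') / P ^ v"
      using n P by (simp add: s_def power2_eq_square)
    finally show ?thesis using P vv by simp
  qed
  have prod: "x' \<odot> quat_conj x = (of_nat n, 0, 0, 0) \<odot> ((P ^ v, 0, 0, 0) \<boxplus> r \<odot> quat_conj x)"
  proof -
    obtain x0 x1 x2 x3 where X: "x = (x0, x1, x2, x3)" by (cases x)
    obtain r0 r1 r2 r3 where RR: "r = (r0, r1, r2, r3)" by (cases r)
    have "x' \<odot> quat_conj x = (quat_nrd a b x, 0, 0, 0) \<boxplus> (of_nat n, 0, 0, 0) \<odot> (r \<odot> quat_conj x)"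
      unfolding r(2) X RR by (simp add: quat_alg_simps power2_eq_square algebra_simps)
    also have "\<dots> = (of_nat n, 0, 0, 0) \<odot> ((P ^ v, 0, 0, 0) \<boxplus> r \<odot> quat_conj x)"
      unfolding nrdx by (cases "r \<odot> quat_conj x") (simp add: quat_alg_simps algebra_simps)
    finally show ?thesis .
  qed
  have "\<exists>M::nat. [(?p ^ M)] \<cdot>\<^bsub>rat_quat a b\<^esub> q \<in> R"
  proof (intro exI)
    let ?M = "v + nat \<bar>e\<bar>"
    have "P ^ nat \<bar>e\<bar> = P powi \<bar>e\<bar>" by (simp add: power_int_def)
    hence "P ^ ?M * s * of_nat n = P powi (int (nat \<bar>e\<bar>) + e)"
      using n P by (simp add: s_def power_add power_int_add field_simps)
    also have "int (nat \<bar>e\<bar>) + e = int (nat (\<bar>e\<bar> + e))" by simp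
    also have "P powi \<dots> = of_int (int ?p ^ nat (\<bar>e\<bar> + e))" by (simp only: power_int_of_nat) (simp add: P_def)
    finally have sc: "P ^ ?M * s * of_nat n = of_int (int ?p ^ nat (\<bar>e\<bar> + e))" .
    have "[(?p ^ ?M)] \<cdot>\<^bsub>rat_quat a b\<^esub> q = (P ^ ?M * s * of_nat n, 0, 0, 0) \<odot> ((P ^ v, 0, 0, 0) \<boxplus> r \<odot> quat_conj x)"
      unfolding q_def prod
      by (cases "(P ^ v, 0, 0, 0) \<boxplus> r \<odot> quat_conj x") (simp add: quat_alg_simps quat_nsmult P_def mult.assoc)
    also have "\<dots> = (of_int (int ?p ^ nat (\<bar>e\<bar> + e)), 0, 0, 0) \<odot> ((of_int (int ?p ^ v), 0, 0, 0) \<boxplus> r \<odot> quat_conj x)"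
      unfolding sc by (simp add: P_def)
    also have "\<dots> \<in> R" by (intro R_mult R_add R_scalar r xR)
    finally show "[(?p ^ ?M)] \<cdot>\<^bsub>rat_quat a b\<^esub> q \<in> R" .
  qed
  hence \<gamma>: "emb q \<in> quat_Gamma a b R \<iota>"
    using q1 unfolding quat_Gamma_def emb_def invert_in_order_def mem_Collect_eq
    by (intro exI[of _ q]) (simp add: quat_alg_simps)
  define t0 where "t0 = s * quat_nrd a b x"
  have t0: "t0 \<noteq> 0" using s0 n P by (simp add: t0_def nrdx)
  have "q \<odot> x = (t0, 0, 0, 0) \<odot> x'"
    unfolding q_def t0_def by (cases x; cases x') (simp add: quat_alg_simps power2_eq_square algebra_simps)
  hence "emb q ** emb x = mat (of_rat t0) ** emb x'" by (metis emb_mult emb_scalar)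
  hence eq: "emb q ** (mat w ** g ** m) = mat (of_rat t0) ** (mat w' ** g' ** m')" by (simp only: x x')
  define t where "t = of_rat t0 * w'"
  have t: "t \<noteq> 0" using t0 w by (simp add: t_def)
  have mm: "mat (c * d) = mat c ** (mat d :: 'p padic ^ 2 ^ 2)" for c d
    by (rule mat2_eqI) (simp_all add: mat2_simps)
  have "mat (w / t) ** emb q ** g ** (m ** matrix_inv m')
    = mat (1 / t) ** (emb q ** (mat w ** g ** m)) ** matrix_inv m'"
  proof -
    have "mat (w / t) = mat (1 / t) ** (mat w :: 'p padic ^ 2 ^ 2)" by (simp add: mm[symmetric])
    hence "mat (w / t) ** emb q = mat (1 / t) ** (emb q ** mat w)"
      by (simp only: matrix_mul_assoc[symmetric] mat2_smult_commute[of "emb q" w])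
    thus ?thesis by (simp only: matrix_mul_assoc)
  qed
  also have "\<dots> = mat (1 / t) ** mat t ** g' ** (m' ** matrix_inv m')"
    unfolding eq t_def mm by (simp only: matrix_mul_assoc)
  also have "mat (1 / t) ** mat t = (mat 1 :: 'p padic ^ 2 ^ 2)" using t by (simp add: mm[symmetric])
  finally have "g' = mat (w / t) ** emb q ** g ** (m ** matrix_inv m')"
    by (simp add: matrix_inv_right[OF m'])
  thus ?thesis using w t \<gamma> \<sigma> by (intro exI[of _ "w / t"] exI[of _ "emb q"] exI[of _ "m ** matrix_inv m'"]) auto
qed

text \<open>Attach to \<open>g\<close> a short element \<open>x\<close> with image \<open>wgm\<close> and record the finitely many congruence data that
  determine the double coset of \<open>g\<close> by the preceding lemma.\<close>

theorem finite_double_cosets: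
  obtains F :: "('p padic ^ 2 ^ 2) set" where "finite F" "\<And>f. f \<in> F \<Longrightarrow> invertible f"
    "\<And>g. invertible g \<Longrightarrow> \<exists>u \<gamma> f \<sigma>. u \<noteq> 0 \<and> \<gamma> \<in> quat_Gamma a b R \<iota> \<and> f \<in> F \<and> \<sigma> \<in> Gamma0 \<and>
      g = mat u ** \<gamma> ** f ** \<sigma>"
proof -
  let ?p = "CARD('p)" and ?G = "{g :: 'p padic ^ 2 ^ 2. invertible g}"
  define K where "K = nat nrd_const * ?p"
  define good where "good = (\<lambda>g w v n z m. w \<noteq> 0 \<and> emb (lat z) = mat w ** g ** m \<and> m \<in> mat2_ints \<and>
    quat_nrd a b (lat z) = of_nat (n * ?p ^ v) \<and> 0 < n \<and> n \<le> K \<and>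
    padic_norm (det m) = padic_norm (of_nat n :: 'p padic))"
  have ex: "\<exists>w v n z m. good g w v n z m" if "invertible g" for g
  proof -
    have d: "det g \<noteq> 0" using that by (simp add: invertible_det_nz)
    obtain w i j where w: "w \<noteq> 0" "mat w ** g \<in> mat2_ints" "(mat w ** g) $ i $ j = 1"
      by (rule primitive_scaling[OF d])
    have "det (mat w ** g) \<noteq> 0" using w d by (simp add: det_mul det_scalar_2)
    from short_element[OF w(2,3) this] show ?thesis using w(1) unfolding good_def K_def by metis
  qed
  then obtain w v n z m where good: "\<And>g. invertible g \<Longrightarrow> good g (w g) (v g) (n g) (z g) (m g)"
    by metis
  define modn where "modn = (\<lambda>n (y :: int \<times> int \<times> int \<times> int). case y of (y0, y1, y2, y3) \<Rightarrow>
    (y0 mod int n, y1 mod int n, y2 mod int n, y3 mod int n))"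
  (* Modulo p^(K+1), as the absolute value of det m exceeds p^(-K): then m m'^(-1) is 1 modulo p. *)
  define res where "res = (\<lambda>m :: 'p padic ^ 2 ^ 2. \<lambda>(i :: 2, j :: 2). padic_residue (Suc K) (m $ i $ j))"
  define key where "key = (\<lambda>g. (n g, v g mod 2, modn (n g) (z g), res (m g)))"
  have "key ` ?G \<subseteq> {..K} \<times> {..<2} \<times> ({0..int K} \<times> {0..int K} \<times> {0..int K} \<times> {0..int K}) \<times> (UNIV \<rightarrow>\<^sub>E {..<?p ^ Suc K})"
  proof (rule image_subsetI)
    fix g assume "g \<in> ?G"
    hence g: "good g (w g) (v g) (n g) (z g) (m g)" using good by simp
    hence n: "0 < int (n g)" "n g \<le> K" by (auto simp: good_def)
    have md: "0 \<le> y mod int (n g)" "y mod int (n g) \<le> int K" for y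
      using n pos_mod_bound[OF n(1), of y] pos_mod_sign[OF n(1), of y] by linarith+
    have "res (m g) \<in> UNIV \<rightarrow>\<^sub>E {..<?p ^ Suc K}"
      using g padic_residue(1) by (auto simp: res_def good_def mat2_ints_iff simp del: power_Suc)
    thus "key g \<in> {..K} \<times> {..<2} \<times> ({0..int K} \<times> {0..int K} \<times> {0..int K} \<times> {0..int K}) \<times> (UNIV \<rightarrow>\<^sub>E {..<?p ^ Suc K})"
      using n md by (auto simp: key_def modn_def split: prod.splits)
  qed
  hence fin: "finite (key ` ?G)"
    by (rule finite_subset) (intro finite_cartesian_product finite_PiE finite_atMost finite_lessThan finite_atLeastAtMost_int finite)
  define rep where "rep = (\<lambda>c. SOME g. invertible g \<and> key g = c)"
  have rep: "invertible (rep (key g)) \<and> key (rep (key g)) = key g" if "invertible g" for g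
    unfolding rep_def by (rule someI[of _ g]) (use that in simp)
  show thesis
  proof (rule that[of "rep ` key ` ?G"])
    show "finite (rep ` key ` ?G)" using fin by simp
    show "invertible f" if "f \<in> rep ` key ` ?G" for f using that rep by auto
    fix g' :: "'p padic ^ 2 ^ 2" assume inv: "invertible g'"
    define g where "g = rep (key g')"
    have g: "invertible g" and kk: "key g = key g'" using rep[OF inv] by (auto simp: g_def)
    note G = good[OF g, unfolded good_def] and G' = good[OF inv, unfolded good_def]
    have nn: "n g' = n g" and vv: "v g mod 2 = v g' mod 2" and zz: "modn (n g) (z g) = modn (n g) (z g')"
      and mm: "res (m g) = res (m g')"
      using kk by (auto simp: key_def)
    obtain z0 z1 z2 z3 where z: "z g = (z0, z1, z2, z3)" by (cases "z g")
    obtain y0 y1 y2 y3 where y: "z g' = (y0, y1, y2, y3)" by (cases "z g'")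
    have "int (n g) dvd y0 - z0" "int (n g) dvd y1 - z1" "int (n g) dvd y2 - z2" "int (n g) dvd y3 - z3"
      using zz by (auto simp: modn_def z y mod_eq_dvd_iff[symmetric])
    then obtain t0 t1 t2 t3 where t: "y0 = z0 + int (n g) * t0" "y1 = z1 + int (n g) * t1"
      "y2 = z2 + int (n g) * t2" "y3 = z3 + int (n g) * t3"
      by (metis add_diff_cancel_left' diff_add_cancel dvdE add.commute)
    have lat: "lat (z g') = lat (z g) \<boxplus> (of_nat (n g), 0, 0, 0) \<odot> lat (t0, t1, t2, t3)"
      unfolding z y t by (simp add: quat_alg_simps algebra_simps)
    have nz: "padic_norm (det (m g')) > 1 / real ?p ^ K"
    proof (rule ccontr)
      assume "\<not> ?thesis"
      hence "padic_norm (of_int (int (n g)) :: 'p padic) \<le> 1 / real ?p ^ K" using G' nn by simp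
      hence "int ?p ^ K dvd int (n g)" by (simp only: padic_norm_of_int_le_iff)
      hence "?p ^ K dvd n g" by (simp only: of_nat_power[symmetric] of_nat_dvd_iff)
      hence "?p ^ K \<le> n g" using G by (auto dest: dvd_imp_le)
      also have "n g \<le> K" using G by simp
      also have "K < 2 ^ K" by simp
      also have "(2::nat) ^ K \<le> ?p ^ K" using CARD_gt_1[where 'p='p] by (intro power_mono) auto
      finally show False by simp
    qed
    have pK: "real ?p ^ K > 0" using CARD_gt_1_real[where 'p='p] by simp
    have dm': "det (m g') \<noteq> 0"
    proof
      assume "det (m g') = 0"
      thus False using nz pK by (simp add: field_simps)
    qed
    have mi: "padic_norm (m g' $ i $ j) \<le> 1" for i j using G' by (auto simp: mat2_ints_iff)
    let ?D = "padic_norm (det (m g'))"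
    have inv_le: "padic_norm (matrix_inv (m g') $ i $ j) \<le> 1 / ?D" for i j
      using mi[of 1 1] mi[of 1 2] mi[of 2 1] mi[of 2 2] nz pK exhaust_2[of i] exhaust_2[of j]
      by (auto simp: matrix_inv_2[OF dm'] vector_2 padic_norm_divide intro!: divide_right_mono)
    have dm: "padic_norm ((m g - m g') $ i $ j) \<le> 1 / real ?p ^ Suc K" for i j
    proof -
      have "padic_residue (Suc K) (m g $ i $ j) = padic_residue (Suc K) (m g' $ i $ j)"
        using fun_cong[OF mm, of "(i, j)"] by (simp add: res_def)
      thus ?thesis using padic_residue_eq[of "m g $ i $ j" "m g' $ i $ j" "Suc K"] G mi
        by (auto simp: mat2_ints_iff)
    qed
    have \<sigma>: "m g ** matrix_inv (m g') \<in> Gamma0"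
    proof (rule Gamma0_near_1)
      fix i j
      have "m g ** matrix_inv (m g') = mat 1 + (m g - m g') ** matrix_inv (m g')"
      proof -
        have "(m g - m g') ** matrix_inv (m g') = m g ** matrix_inv (m g') - m g' ** matrix_inv (m g')"
          by (rule mat2_eqI) (simp_all add: mat2_mult_nth algebra_simps)
        thus ?thesis by (simp add: matrix_inv_right[OF dm'])
      qed
      hence "(m g ** matrix_inv (m g')) $ i $ j - (if i = j then 1 else 0) = ((m g - m g') ** matrix_inv (m g')) $ i $ j"
        by (simp add: mat_def)
      also have "padic_norm \<dots> \<le> 1 / real ?p ^ Suc K * (1 / ?D)"
        unfolding mat2_mult_nth padic_norm_mult[symmetric]
        by (intro padic_norm_add_le; unfold padic_norm_mult; intro mult_mono dm inv_le) auto
      also have "\<dots> < 1 / real ?p ^ Suc K * real ?p ^ K"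
      proof (rule mult_strict_left_mono)
        have "?D > 0" using nz pK by (meson le_less_trans less_imp_le zero_less_divide_1_iff)
        thus "1 / ?D < real ?p ^ K" using nz pK by (simp add: field_simps)
      qed (use CARD_gt_1_real[where 'p='p] in simp)
      also have "\<dots> \<le> 1" using CARD_gt_1_real[where 'p='p] by simp
      finally show "padic_norm ((m g ** matrix_inv (m g')) $ i $ j - (if i = j then 1 else 0)) < 1" .
    qed
    have par: "even (int (v g) - int (v g'))"
      using vv by (metis even_diff even_iff_mod_2_eq_zero even_of_nat even_add uminus_add_conv_diff even_minus)
    have "\<exists>u \<gamma> \<sigma>. u \<noteq> 0 \<and> \<gamma> \<in> quat_Gamma a b R \<iota> \<and> \<sigma> \<in> Gamma0 \<and> g' = mat u ** \<gamma> ** g ** \<sigma>"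
      by (rule same_double_coset[where x = "lat (z g)" and x' = "lat (z g')", OF _ _ _ _ lat_conj lat_R lat _ _ _ par dm' \<sigma>])
        (use G G' nn in auto)
    thus "\<exists>u \<gamma> f \<sigma>. u \<noteq> 0 \<and> \<gamma> \<in> quat_Gamma a b R \<iota> \<and> f \<in> rep ` key ` ?G \<and> \<sigma> \<in> Gamma0 \<and>
      g' = mat u ** \<gamma> ** f ** \<sigma>"
      using inv unfolding g_def by blast
  qed
qed

end

section \<open>The substitutions \<open>x \<mapsto> j + p x\<close>\<close>

abbreviation affine_map :: "nat \<Rightarrow> 'p::prime_card padic fps" where
  "affine_map j \<equiv> fps_const (of_nat j) + fps_const (of_nat CARD('p)) * fps_X"

definition affine :: "nat \<Rightarrow> 'p::prime_card padic fps \<Rightarrow> 'p padic fps" where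
  "affine j f = fps_subst f (affine_map j)"

lemma affine_nth:
  "fps_nth (affine_map j :: 'p::prime_card padic fps) n
    = (if n = 0 then of_nat j else if n = 1 then of_nat CARD('p) else 0)"
  by (cases n) (auto simp: fps_X_def)

lemma affine_ball: "affine_map j \<in> (unit_ball :: 'p::prime_card padic fps set)"
  unfolding unit_ball_def
  by (auto intro!: tate_add tate_const_mult gauss_norm_le simp: affine_nth padic_norm_of_nat_le)

lemma affine_tate: "f \<in> tate \<Longrightarrow> affine j f \<in> tate"
  unfolding affine_def by (rule subst_tate[OF _ affine_ball])

lemma affine_add: "f \<in> tate \<Longrightarrow> g \<in> tate \<Longrightarrow> affine j (f + g) = affine j f + affine j g"
  unfolding affine_def by (rule subst_add[OF _ _ affine_ball])

lemma affine_const_mult: "f \<in> tate \<Longrightarrow> affine j (fps_const c * f) = fps_const c * affine j f"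
  unfolding affine_def by (rule subst_const_mult[OF _ affine_ball])

lemma affine_norm: "f \<in> tate \<Longrightarrow> gauss_norm (affine j f) \<le> gauss_norm f"
  unfolding affine_def by (rule subst_norm[OF _ affine_ball])

lemma affine_power_coeff:
  "padic_norm (fps_nth ((affine_map j :: 'p::prime_card padic fps) ^ n) i)
    \<le> 1 / real CARD('p) ^ i"
proof (induction n arbitrary: i)
  case 0
  show ?case by simp
next
  case (Suc n)
  let ?h = "affine_map j :: 'p padic fps"
  have h: "padic_norm (fps_nth ?h l) \<le> 1 / real CARD('p) ^ l" for l
    unfolding affine_nth by (auto simp: padic_norm_of_nat_le padic_norm_p)
  show ?case
    unfolding power_Suc fps_mult_nth
  proof (rule padic_norm_sum_le)
    fix l assume l: "l \<in> {0..i}"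
    have "padic_norm (fps_nth ?h l * fps_nth (?h ^ n) (i - l)) \<le> 1 / real CARD('p) ^ l * (1 / real CARD('p) ^ (i - l))"
      unfolding padic_norm_mult by (intro mult_mono h Suc) auto
    also have "\<dots> = 1 / real CARD('p) ^ i" using l by (simp add: power_add[symmetric])
    finally show "padic_norm (fps_nth ?h l * fps_nth (?h ^ n) (i - l)) \<le> 1 / real CARD('p) ^ i" .
  qed simp
qed

text \<open>Divisibility of the \<open>i\<close>-th coefficient by \<open>p\<^sup>i\<close> is inherited from the powers of \<open>j + px\<close>.\<close>

lemma affine_coeff:
  fixes f :: "'p::prime_card padic fps"
  assumes f: "f \<in> tate"
  shows "padic_norm (fps_nth (affine j f) i) \<le> gauss_norm f / real CARD('p) ^ i"
  unfolding affine_def subst_nth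
proof (rule padic_suminf_norm_le[OF subst_summable[OF f affine_ball]])
  fix n
  have "padic_norm (fps_nth f n) * padic_norm (fps_nth ((affine_map j :: 'p padic fps) ^ n) i)
    \<le> gauss_norm f * (1 / real CARD('p) ^ i)"
    by (intro mult_mono coeff_le_gauss_norm[OF f] affine_power_coeff gauss_norm_nonneg[OF f]) auto
  thus "padic_norm (fps_nth f n * fps_nth (affine_map j ^ n) i)
    \<le> gauss_norm f / real CARD('p) ^ i" by (simp add: padic_norm_mult)
qed (simp add: gauss_norm_nonneg[OF f])

lemma affine_tail_norm:
  fixes f :: "'p::prime_card padic fps"
  assumes f: "f \<in> tate"
  shows "gauss_norm (affine j f - fps_cutoff (Suc k) (affine j f)) \<le> gauss_norm f / real CARD('p) ^ Suc k"
proof (rule gauss_norm_le)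
  fix i
  show "padic_norm (fps_nth (affine j f - fps_cutoff (Suc k) (affine j f)) i) \<le> gauss_norm f / real CARD('p) ^ Suc k"
  proof (cases "i \<le> k")
    case True
    thus ?thesis using gauss_norm_nonneg[OF f] by simp
  next
    case False
    have "gauss_norm f / real CARD('p) ^ i \<le> gauss_norm f / real CARD('p) ^ Suc k"
      using False CARD_gt_1_real[where 'p='p]
      by (intro divide_left_mono power_increasing gauss_norm_nonneg[OF f]) auto
    thus ?thesis using affine_coeff[OF f, of j i] False by simp
  qed
qed

lemma poly_space_truncate: "truncate_fps (Suc k) f \<in> poly_space k"
  unfolding poly_space_def by (auto intro!: degree_le simp: coeff_truncate_fps)

text \<open>A functional that kills \<open>\<P>\<^sub>k\<close> sees only the tail of \<open>f(j + px)\<close> beyond degree \<open>k\<close>, which is divisible by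
  \<open>p\<^sup>k\<^sup>+\<^sup>1\<close>; dividing by \<open>p\<^sup>k\<^sup>/\<^sup>2\<close> leaves a contraction. The index set is abstract because the lemma is applied to
  families indexed by matrices \<open>g\<close> and, for the defect of equivariance, by pairs \<open>(g, \<sigma>)\<close>.\<close>

lemma U_contraction:
  fixes E :: "nat \<Rightarrow> 'i \<Rightarrow> 'p::prime_card padic fps \<Rightarrow> 'p padic"
  assumes k: "even k"
    and add: "\<And>n i f g. i \<in> I \<Longrightarrow> f \<in> tate \<Longrightarrow> g \<in> tate \<Longrightarrow> E n i (f + g) = E n i f + E n i g"
    and poly: "\<And>n i P. i \<in> I \<Longrightarrow> P \<in> poly_space k \<Longrightarrow> E n i (fps_of_poly P) = 0"
    and bound: "\<And>i f. i \<in> I \<Longrightarrow> f \<in> tate \<Longrightarrow> padic_norm (E 0 i f) \<le> C * gauss_norm f"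
    and closed: "\<And>i j. i \<in> I \<Longrightarrow> j < CARD('p) \<Longrightarrow> \<tau> j i \<in> I"
    and step: "\<And>n i f. i \<in> I \<Longrightarrow> f \<in> tate \<Longrightarrow>
      of_nat CARD('p) ^ (k div 2) * E (Suc n) i f = (\<Sum>j<CARD('p). E n (\<tau> j i) (affine j f))"
    and C: "C \<ge> 0" and i: "i \<in> I" and f: "f \<in> tate"
  shows "padic_norm (E n i f) \<le> C * (1 / real CARD('p) ^ Suc (k div 2)) ^ n * gauss_norm f"
  using i f
proof (induction n arbitrary: i f)
  case 0
  thus ?case using bound by simp
next
  case (Suc n)
  let ?p = "real CARD('p)" and ?m = "k div 2"
  have p: "?p > 1" by (rule CARD_gt_1_real)
  let ?q = "1 / ?p ^ Suc ?m"
  have t: "padic_norm (E n (\<tau> j i) (affine j f)) \<le> C * ?q ^ n * (gauss_norm f / ?p ^ Suc k)" if j: "j < CARD('p)" for j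
  proof -
    let ?F = "affine j f" and ?c = "fps_cutoff (Suc k) (affine j f)"
    have ti: "\<tau> j i \<in> I" by (rule closed[OF Suc.prems(1) j])
    have tail: "?F - ?c \<in> tate" by (intro tate_diff affine_tate tate_cutoff Suc.prems)
    have "E n (\<tau> j i) ?c = 0" using poly[OF ti poly_space_truncate, of n ?F] by simp
    hence "E n (\<tau> j i) ?F = E n (\<tau> j i) (?F - ?c)"
      using add[OF ti tate_cutoff tail, of n "Suc k" ?F] by simp
    also have "padic_norm \<dots> \<le> C * ?q ^ n * gauss_norm (?F - ?c)" by (rule Suc.IH[OF ti tail])
    also have "\<dots> \<le> C * ?q ^ n * (gauss_norm f / ?p ^ Suc k)"
      using C p by (intro mult_left_mono affine_tail_norm Suc.prems) auto
    finally show ?thesis .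
  qed
  have "padic_norm (of_nat CARD('p) ^ ?m * E (Suc n) i f) \<le> C * ?q ^ n * (gauss_norm f / ?p ^ Suc k)"
    unfolding step[OF Suc.prems] using C p gauss_norm_nonneg[OF Suc.prems(2)]
    by (intro padic_norm_sum_le t) auto
  hence "padic_norm (E (Suc n) i f) \<le> ?p ^ ?m * (C * ?q ^ n * (gauss_norm f / ?p ^ Suc k))"
    using p by (simp add: padic_norm_mult padic_norm_p_power field_simps)
  also have "\<dots> = C * ?q ^ Suc n * gauss_norm f"
  proof -
    have "Suc k = ?m + Suc ?m" using k by (auto elim!: evenE)
    hence "?p ^ Suc k = ?p ^ ?m * ?p ^ Suc ?m" by (simp only: power_add)
    hence "?p ^ ?m / ?p ^ Suc k = ?q" using p by (simp del: power_Suc)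
    thus ?thesis using p by (simp add: field_simps)
  qed
  finally show ?case .
qed

lemma contraction_tendsto_0:
  fixes X :: "nat \<Rightarrow> 'p::prime_card padic"
  assumes "\<And>n. padic_norm (X n) \<le> C * (1 / real CARD('p) ^ Suc m) ^ n * G"
  shows "X \<longlonglongrightarrow> 0"
proof -
  have q: "\<bar>1 / real CARD('p) ^ Suc m\<bar> < 1"
    using CARD_gt_1_real[where 'p='p] one_less_power[of "real CARD('p)" "Suc m"] by simp
  have "(\<lambda>n. C * (1 / real CARD('p) ^ Suc m) ^ n * G) \<longlonglongrightarrow> C * 0 * G"
    by (intro tendsto_intros LIMSEQ_power_zero) (use q in simp)
  hence z: "(\<lambda>n. C * (1 / real CARD('p) ^ Suc m) ^ n * G) \<longlonglongrightarrow> 0" by simp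
  have "(\<lambda>n. padic_norm (X n)) \<longlonglongrightarrow> 0"
    by (rule tendsto_sandwich[OF _ _ tendsto_const z]) (use assms in auto)
  thus ?thesis unfolding padic_tendsto_iff[of X] by simp
qed

section \<open>The matrices \<open>\<alpha>\<^sub>j\<close>\<close>

lemma alpha_nth: "alpha j $ 1 $ 1 = (of_nat CARD('p) :: 'p::prime_card padic)" "alpha j $ 1 $ 2 = (of_nat j :: 'p padic)"
  "alpha j $ 2 $ 1 = (0 :: 'p padic)" "alpha j $ 2 $ 2 = (1 :: 'p padic)"
  by (simp_all add: alpha_def vector_2)

lemma p_nonzero: "(of_nat CARD('p) :: 'p::prime_card padic) \<noteq> 0"
  using CARD_gt_1[where 'p='p] by simp

lemma det_alpha: "det (alpha j) = (of_nat CARD('p) :: 'p::prime_card padic)"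
  by (simp add: det_2 alpha_nth)

lemma det_alpha_nz: "det (alpha j :: 'p::prime_card padic ^ 2 ^ 2) \<noteq> 0"
  by (simp add: det_alpha p_nonzero)

lemma invertible_alpha: "invertible (g ** alpha j) \<longleftrightarrow> invertible (g :: 'p::prime_card padic ^ 2 ^ 2)"
  by (simp add: invertible_det_nz det_mul det_alpha_nz)

lemma alpha_inv_nth:
  "matrix_inv (alpha j) $ 1 $ 1 = 1 / (of_nat CARD('p) :: 'p::prime_card padic)"
  "matrix_inv (alpha j) $ 1 $ 2 = - of_nat j / (of_nat CARD('p) :: 'p padic)"
  "matrix_inv (alpha j) $ 2 $ 1 = (0 :: 'p padic)" "matrix_inv (alpha j) $ 2 $ 2 = (1 :: 'p padic)"
  by (simp_all add: matrix_inv_2[OF det_alpha_nz] vector_2 alpha_nth det_alpha p_nonzero)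

lemma det_alpha_inv: "det (matrix_inv (alpha j)) = 1 / (of_nat CARD('p) :: 'p::prime_card padic)"
  by (simp add: det_2 alpha_inv_nth)

lemma alpha_inv_scaled: "matrix_inv (alpha j) \<in> (scaled_Sigma0 :: ('p::prime_card padic ^ 2 ^ 2) set)"
  using CARD_gt_1_real[where 'p='p] padic_norm_of_nat_le[of j, where 'p='p] p_nonzero[where 'p='p]
  by (auto simp: scaled_Sigma0_def alpha_inv_nth det_alpha_inv padic_norm_divide padic_norm_p
      intro: order_trans[OF mult_right_mono])

text \<open>The automorphy factor of \<open>\<alpha>\<^sub>j\<^sup>-\<^sup>1\<close> is \<open>p\<^sup>k\<^sup>/\<^sup>2 p\<^sup>-\<^sup>k\<close>, which the normalisation of \<open>U\<^sub>p\<close> cancels.\<close>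

lemma tate_act_alpha_inv:
  assumes k: "even k"
  shows "fps_const (of_nat CARD('p) ^ (k div 2)) * tate_act k (matrix_inv (alpha j)) f = affine j (f :: 'p::prime_card padic fps)"
proof -
  let ?p = "of_nat CARD('p) :: 'p padic"
  obtain m where m: "k = 2 * m" using k by blast
  have den: "mob_den (matrix_inv (alpha j)) = fps_const (1 / ?p)"
    by (rule fps_ext) (simp add: mob_den_nth alpha_inv_nth)
  have "inverse (fps_const (1 / ?p)) = fps_const ?p" using p_nonzero[where 'p='p] by (simp add: fps_const_inverse)
  hence "mob (matrix_inv (alpha j)) = mob_num (matrix_inv (alpha j)) * fps_const ?p" by (simp add: mob_def den)
  also have "\<dots> = fps_const (of_nat j) + fps_const ?p * fps_X"
    by (rule fps_ext) (use p_nonzero[where 'p='p] in \<open>simp add: affine_nth mob_num_nth alpha_inv_nth\<close>)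
  finally have mob: "mob (matrix_inv (alpha j)) = fps_const (of_nat j) + fps_const ?p * fps_X" .
  have "?p ^ m * ((1 / ?p) powi (- int m) * (1 / ?p) ^ (2 * m)) = 1"
    using p_nonzero[where 'p='p] by (simp add: power_int_minus power_one_over mult_2 mult_2_right power_add field_simps)
  hence "fps_const (?p ^ m) * (fps_const ((1 / ?p) powi (- int m)) * fps_const (1 / ?p) ^ (2 * m)) = 1"
    by (simp only: fps_const_power fps_const_mult fps_const_1_eq_1)
  thus ?thesis unfolding tate_act_mob mob den det_alpha_inv affine_def m
    by (simp add: mult.assoc[symmetric])
qed

lemma Gamma0_scaled: "s \<in> Gamma0 \<Longrightarrow> s \<in> scaled_Sigma0" and Gamma0_diag: "s \<in> Gamma0 \<Longrightarrow> padic_norm (s $ i $ i) = 1"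
  for s :: "'p::prime_card padic ^ 2 ^ 2"
proof -
  assume s: "s \<in> Gamma0"
  hence n: "padic_norm (s $ i $ j) \<le> 1" "padic_norm (s $ 2 $ 1) < 1" "padic_norm (det s) = 1" for i j
    by (auto simp: Gamma0_iff mat2_ints_iff)
  have "padic_norm (s $ 1 $ 2) * padic_norm (s $ 2 $ 1) \<le> 1 * padic_norm (s $ 2 $ 1)" using n by (intro mult_right_mono) auto
  hence "padic_norm (det s - s $ 1 $ 1 * s $ 2 $ 2) < padic_norm (det s)" using n by (simp add: det_2 padic_norm_mult)
  from padic_norm_close[OF this] have e: "padic_norm (s $ 1 $ 1) * padic_norm (s $ 2 $ 2) = 1" using n by (simp add: padic_norm_mult)
  have "padic_norm (s $ 1 $ 1) * padic_norm (s $ 2 $ 2) \<le> padic_norm (s $ 1 $ 1) * 1" using n by (intro mult_left_mono) auto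
  hence d: "padic_norm (s $ 1 $ 1) = 1" using e n(1)[of 1 1] by simp
  thus "padic_norm (s $ i $ i) = 1" using e exhaust_2[of i] by auto
  have "s $ 1 $ 1 \<noteq> 0" using d by auto
  moreover have "det s \<noteq> 0" using n(3) by auto
  ultimately show "s \<in> scaled_Sigma0" using n d by (simp add: scaled_Sigma0_def)
qed

lemma Gamma0_act_norm:
  assumes "s \<in> Gamma0" "f \<in> tate"
  shows "gauss_norm (tate_act k s f) \<le> gauss_norm f"
  using tate_act_norm[OF Gamma0_scaled[OF assms(1)] assms(2), of k] Gamma0_diag[OF assms(1), of 1] assms(1)
  by (simp add: Gamma0_iff)

text \<open>Left multiplication by \<open>\<sigma> \<in> \<Gamma>\<^sub>0(p)\<close> permutes the cosets \<open>\<alpha>\<^sub>j \<Gamma>\<^sub>0(p)\<close>. Modulo \<open>p\<close> the matrix \<open>\<sigma>\<close> is upper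
  triangular with entries \<open>a, b, d\<close>, and the permutation is the affine map \<open>j \<mapsto> (aj + b)/d\<close> of \<open>\<int>/p\<close>.\<close>

definition alpha_perm :: "'p::prime_card padic ^ 2 ^ 2 \<Rightarrow> nat \<Rightarrow> nat" where
  "alpha_perm s j = padic_residue 1 ((s $ 1 $ 1 * of_nat j + s $ 1 $ 2) / s $ 2 $ 2)"

definition alpha_rest :: "'p::prime_card padic ^ 2 ^ 2 \<Rightarrow> nat \<Rightarrow> 'p padic ^ 2 ^ 2" where
  "alpha_rest s j = matrix_inv (alpha (alpha_perm s j)) ** s ** alpha j"

lemma alpha_rest: "s ** alpha j = alpha (alpha_perm s j) ** alpha_rest s j"
  by (simp add: alpha_rest_def matrix_mul_assoc matrix_inv_right[OF det_alpha_nz])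

lemma alpha_perm:
  fixes s :: "'p::prime_card padic ^ 2 ^ 2"
  assumes s: "s \<in> Gamma0"
  shows "alpha_perm s j < CARD('p)"
    "padic_norm (s $ 1 $ 1 * of_nat j + s $ 1 $ 2 - of_nat (alpha_perm s j) * s $ 2 $ 2) < 1"
proof -
  let ?x = "s $ 1 $ 1 * of_nat j + s $ 1 $ 2" and ?d = "s $ 2 $ 2"
  have d: "padic_norm ?d = 1" "?d \<noteq> 0" using Gamma0_diag[OF s, of 2] by auto
  have int: "padic_norm (?x / ?d) \<le> 1"
    using s d by (simp add: padic_norm_divide Gamma0_iff mat2_ints_iff padic_norm_add_le padic_norm_mult_le_1 padic_norm_of_nat_le)
  show "alpha_perm s j < CARD('p)" using padic_residue(1)[OF int, of 1] by (simp add: alpha_perm_def)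
  have "padic_norm (?x / ?d - of_nat (alpha_perm s j)) \<le> 1 / real CARD('p)"
    using padic_residue(2)[OF int, of 1] by (simp add: alpha_perm_def)
  also have "\<dots> < 1" using CARD_gt_1_real[where 'p='p] by simp
  also have "?x / ?d - of_nat (alpha_perm s j) = (?x - of_nat (alpha_perm s j) * ?d) / ?d"
    using d by (simp add: field_simps)
  finally show "padic_norm (?x - of_nat (alpha_perm s j) * ?d) < 1" by (simp add: padic_norm_divide d)
qed

lemma alpha_perm_bij:
  fixes s :: "'p::prime_card padic ^ 2 ^ 2"
  assumes s: "s \<in> Gamma0"
  shows "bij_betw (alpha_perm s) {..<CARD('p)} {..<CARD('p)}"
proof -
  have inj: "inj_on (alpha_perm s) {..<CARD('p)}"
  proof (rule inj_onI)
    fix i j assume ij: "i \<in> {..<CARD('p)}" "j \<in> {..<CARD('p)}" "alpha_perm s i = alpha_perm s j"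
    let ?x = "\<lambda>i. s $ 1 $ 1 * of_nat i + s $ 1 $ 2 - of_nat (alpha_perm s i) * s $ 2 $ 2"
    have "s $ 1 $ 1 * (of_nat i - of_nat j) = ?x i - ?x j" using ij by (simp add: algebra_simps)
    hence "padic_norm (s $ 1 $ 1 * (of_nat i - of_nat j)) < 1"
      using padic_norm_diff[of "?x i" "?x j"] alpha_perm(2)[OF s, of i] alpha_perm(2)[OF s, of j] by simp
    thus "i = j" using ij Gamma0_diag[OF s, of 1]
      by (intro padic_residue_unique[where 'p='p]) (simp_all add: padic_norm_mult)
  qed
  moreover have "alpha_perm s ` {..<CARD('p)} = {..<CARD('p)}"
    by (rule card_subset_eq) (use alpha_perm(1)[OF s] inj in \<open>auto simp: card_image\<close>)
  ultimately show ?thesis by (simp add: bij_betw_def)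
qed

lemma alpha_rest_Gamma0:
  fixes s :: "'p::prime_card padic ^ 2 ^ 2"
  assumes s: "s \<in> Gamma0"
  shows "alpha_rest s j \<in> Gamma0"
proof -
  let ?a = "s $ 1 $ 1" and ?c = "s $ 2 $ 1" and ?d = "s $ 2 $ 2" and ?j = "of_nat (alpha_perm s j) :: 'p padic"
    and ?P = "of_nat CARD('p) :: 'p padic" and ?t = "alpha_rest s j"
  let ?x = "?a * of_nat j + s $ 1 $ 2 - ?j * ?d"
  have n: "padic_norm ?a \<le> 1" "padic_norm ?c < 1" "padic_norm ?d \<le> 1" "padic_norm (det s) = 1"
    using s by (auto simp: Gamma0_iff mat2_ints_iff)
  have c: "padic_norm ?c \<le> 1" using n by simp
  have t: "?t $ 1 $ 1 = ?a - ?j * ?c" "?t $ 1 $ 2 = (?x - ?j * ?c * of_nat j) / ?P"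
    "?t $ 2 $ 1 = ?c * ?P" "?t $ 2 $ 2 = ?c * of_nat j + ?d"
    using p_nonzero[where 'p='p]
    by (simp_all add: alpha_rest_def mat2_mult_nth alpha_nth alpha_inv_nth field_simps)
  have "padic_norm ?j * padic_norm ?c * padic_norm (of_nat j :: 'p padic) \<le> 1 * padic_norm ?c * 1"
    by (intro mult_mono padic_norm_of_nat_le) auto
  hence "padic_norm (?x - ?j * ?c * of_nat j) < 1"
    using padic_norm_diff[of ?x "?j * ?c * of_nat j"] alpha_perm(2)[OF s, of j] n by (simp add: padic_norm_mult)
  from padic_norm_less_1[OF this] have 12: "padic_norm (?t $ 1 $ 2) \<le> 1"
    unfolding t padic_norm_divide padic_norm_p using CARD_gt_1_real[where 'p='p] by (simp add: field_simps)
  have 11: "padic_norm (?t $ 1 $ 1) \<le> 1" unfolding t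
    using n(1) c by (intro padic_norm_diff_le padic_norm_mult_le_1 padic_norm_of_nat_le) auto
  have 22: "padic_norm (?t $ 2 $ 2) \<le> 1" unfolding t
    using n(3) c by (intro padic_norm_add_le padic_norm_mult_le_1 padic_norm_of_nat_le) auto
  have 21: "padic_norm (?t $ 2 $ 1) < 1"
    unfolding t padic_norm_mult using mult_left_le[OF padic_norm_of_nat_le padic_norm_nonneg[of ?c]] n(2) by (rule le_less_trans)
  have "det ?t = det s"
    using p_nonzero[where 'p='p] by (simp add: alpha_rest_def det_mul det_alpha_inv det_alpha)
  thus ?thesis using 11 12 21 22 n(4) by (auto simp: Gamma0_iff mat2_ints_iff forall_2)
qed

text \<open>Let both sides act in the identity \<open>\<alpha>\<^sub>i\<^sup>-\<^sup>1 \<sigma> = \<tau> \<alpha>\<^sub>j\<^sup>-\<^sup>1\<close>.\<close>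

lemma affine_equivariant:
  assumes k: "even k" and s: "s \<in> Gamma0" and t: "t \<in> Gamma0" and st: "s ** alpha j = alpha i ** t" and f: "f \<in> tate"
  shows "affine i (tate_act k s f) = tate_act k t (affine j (f :: 'p::prime_card padic fps))"
proof -
  have "t ** matrix_inv (alpha j) = matrix_inv (alpha i) ** (alpha i ** t) ** matrix_inv (alpha j)"
    by (simp add: matrix_mul_assoc matrix_inv_left[OF det_alpha_nz])
  also have "\<dots> = matrix_inv (alpha i) ** s ** (alpha j ** matrix_inv (alpha j))"
    unfolding st[symmetric] by (simp only: matrix_mul_assoc)
  finally have "t ** matrix_inv (alpha j) = matrix_inv (alpha i) ** s"
    by (simp add: matrix_inv_right[OF det_alpha_nz])
  hence "tate_act k (matrix_inv (alpha i)) (tate_act k s f) = tate_act k t (tate_act k (matrix_inv (alpha j)) f)"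
    by (simp add: tate_act_mult[symmetric] Gamma0_scaled s t f alpha_inv_scaled)
  thus ?thesis
    unfolding tate_act_alpha_inv[OF k, symmetric]
    by (simp add: tate_act_const_mult Gamma0_scaled t tate_act_tate alpha_inv_scaled f)
qed

section \<open>The coefficient modules\<close>

lemma poly_space_add: "P \<in> poly_space k \<Longrightarrow> Q \<in> poly_space k \<Longrightarrow> P + Q \<in> poly_space k"
  by (simp add: poly_space_def degree_add_le)

lemma poly_space_smult: "P \<in> poly_space k \<Longrightarrow> Polynomial.smult c P \<in> poly_space k"
  using degree_smult_le[of c P] by (simp add: poly_space_def)

lemma poly_dual_add: "\<omega> \<in> poly_dual k \<Longrightarrow> P \<in> poly_space k \<Longrightarrow> Q \<in> poly_space k \<Longrightarrow> \<omega> (P + Q) = \<omega> P + \<omega> Q"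
  and poly_dual_smult: "\<omega> \<in> poly_dual k \<Longrightarrow> P \<in> poly_space k \<Longrightarrow> \<omega> (Polynomial.smult c P) = c * \<omega> P"
  and poly_dual_outside: "\<omega> \<in> poly_dual k \<Longrightarrow> P \<notin> poly_space k \<Longrightarrow> \<omega> P = 0"
  by (simp_all add: poly_dual_def)

lemma poly_dual_zero: "0 \<in> poly_dual k"
  by (simp add: poly_dual_def)

lemma distr_add: "\<omega> \<in> distributions \<Longrightarrow> f \<in> tate \<Longrightarrow> g \<in> tate \<Longrightarrow> \<omega> (f + g) = \<omega> f + \<omega> g"
  and distr_scale: "\<omega> \<in> distributions \<Longrightarrow> f \<in> tate \<Longrightarrow> \<omega> (fps_const c * f) = c * \<omega> f"
  and distr_outside: "\<omega> \<in> distributions \<Longrightarrow> f \<notin> tate \<Longrightarrow> \<omega> f = 0"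
  unfolding distributions_def by blast+

lemma distributions_zero: "0 \<in> distributions"
  by (rule distributionsI[where K = 0]) auto

lemma distributions_plus:
  assumes "\<omega> \<in> distributions" "\<eta> \<in> distributions"
  shows "\<omega> + \<eta> \<in> distributions"
proof -
  obtain K where K: "K \<ge> 0" "\<And>f. f \<in> tate \<Longrightarrow> padic_norm (\<omega> f) \<le> K * gauss_norm f"
    by (rule distributions_bounded[OF assms(1)]) blast
  obtain L where L: "L \<ge> 0" "\<And>f. f \<in> tate \<Longrightarrow> padic_norm (\<eta> f) \<le> L * gauss_norm f"
    by (rule distributions_bounded[OF assms(2)]) blast
  show ?thesis
  proof (rule distributionsI[where K = "max K L"])
    fix f :: "'a padic fps" assume f: "f \<in> tate"
    have "K * gauss_norm f \<le> max K L * gauss_norm f" "L * gauss_norm f \<le> max K L * gauss_norm f"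
      by (intro mult_right_mono gauss_norm_nonneg f; simp)+
    thus "padic_norm ((\<omega> + \<eta>) f) \<le> max K L * gauss_norm f"
      unfolding plus_fun_def using K(2)[OF f] L(2)[OF f] by (intro padic_norm_add_le) linarith+
  qed (use assms in \<open>simp_all add: distr_add distr_scale distr_outside distrib_left mult.left_commute\<close>)
qed

lemma distributions_scale:
  assumes "\<omega> \<in> distributions"
  shows "(\<lambda>f. c * \<omega> f) \<in> distributions"
proof -
  obtain K where K: "K \<ge> 0" "\<And>f. f \<in> tate \<Longrightarrow> padic_norm (\<omega> f) \<le> K * gauss_norm f"
    by (rule distributions_bounded[OF assms]) blast
  show ?thesis
  proof (rule distributionsI[where K = "padic_norm c * K"])
    fix f :: "'a padic fps" assume f: "f \<in> tate"
    show "padic_norm (c * \<omega> f) \<le> padic_norm c * K * gauss_norm f"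
      using mult_left_mono[OF K(2)[OF f] padic_norm_nonneg[of c]] by (simp add: padic_norm_mult mult.assoc)
  qed (use assms in \<open>simp_all add: distr_add distr_scale distr_outside distrib_left mult.left_commute\<close>)
qed

lemma poly_dual_plus: "\<omega> \<in> poly_dual k \<Longrightarrow> \<eta> \<in> poly_dual k \<Longrightarrow> \<omega> + \<eta> \<in> poly_dual k"
  unfolding poly_dual_def by (auto simp: algebra_simps)

lemma poly_dual_scale: "\<omega> \<in> poly_dual k \<Longrightarrow> (\<lambda>P. c * \<omega> P) \<in> poly_dual k"
  unfolding poly_dual_def by (auto simp: algebra_simps)

lemma poly_dual_bounded:
  assumes w: "\<omega> \<in> (poly_dual k :: ('p::prime_card padic poly \<Rightarrow> 'p padic) set)"
  obtains K where "K \<ge> 0" "\<And>P. P \<in> poly_space k \<Longrightarrow> padic_norm (\<omega> P) \<le> K * gauss_norm (fps_of_poly P)"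
proof -
  define K where "K = (\<Sum>i\<le>k. padic_norm (\<omega> (Polynomial.monom 1 i)))"
  have K0: "K \<ge> 0" by (simp add: K_def sum_nonneg)
  show thesis
  proof (rule that[OF K0])
    fix P :: "'p padic poly" assume P: "P \<in> poly_space k"
    have mono: "Polynomial.monom 1 i \<in> poly_space k" if "i \<le> k" for i
      using that order_trans[OF degree_monom_le, of i k] by (simp add: poly_space_def)
    have w0: "\<omega> 0 = 0" using poly_dual_smult[OF w P, of 0] by simp
    have lin: "(\<Sum>i<n. Polynomial.smult (c i) (Polynomial.monom 1 i)) \<in> poly_space k \<and>
      \<omega> (\<Sum>i<n. Polynomial.smult (c i) (Polynomial.monom 1 i)) = (\<Sum>i<n. c i * \<omega> (Polynomial.monom 1 i))"
      if "n \<le> Suc k" for n c using that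
    proof (induction n)
      case (Suc n)
      let ?S = "\<Sum>i<n. Polynomial.smult (c i) (Polynomial.monom 1 i)"
      have S: "?S \<in> poly_space k" "\<omega> ?S = (\<Sum>i<n. c i * \<omega> (Polynomial.monom 1 i))" using Suc by auto
      have m: "Polynomial.monom 1 n \<in> poly_space k" using Suc.prems by (intro mono) simp
      show ?case
        unfolding sum.lessThan_Suc poly_dual_add[OF w S(1) poly_space_smult[OF m]] S(2) poly_dual_smult[OF w m]
        by (intro conjI refl poly_space_add S(1) poly_space_smult m)
    qed (simp add: w0 poly_space_def)
    have "P = (\<Sum>i\<le>k. Polynomial.monom (poly.coeff P i) i)"
      using P poly_as_sum_of_monoms'[of P k] by (simp add: poly_space_def)
    also have "\<dots> = (\<Sum>i<Suc k. Polynomial.smult (poly.coeff P i) (Polynomial.monom 1 i))"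
      by (simp add: smult_monom lessThan_Suc_atMost)
    finally have "\<omega> P = (\<Sum>i<Suc k. poly.coeff P i * \<omega> (Polynomial.monom 1 i))"
      using lin[of "Suc k" "poly.coeff P"] by simp
    also have "padic_norm \<dots> \<le> K * gauss_norm (fps_of_poly P)"
    proof (rule padic_norm_sum_le)
      fix i assume i: "i \<in> {..<Suc k}"
      have "padic_norm (poly.coeff P i) \<le> gauss_norm (fps_of_poly P)"
        using coeff_le_gauss_norm[OF tate_poly, of P i] by simp
      moreover have "padic_norm (\<omega> (Polynomial.monom 1 i)) \<le> K"
        unfolding K_def using i by (intro member_le_sum) auto
      ultimately have "padic_norm (poly.coeff P i) * padic_norm (\<omega> (Polynomial.monom 1 i)) \<le> gauss_norm (fps_of_poly P) * K"
        by (intro mult_mono gauss_norm_nonneg tate_poly) auto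
      thus "padic_norm (poly.coeff P i * \<omega> (Polynomial.monom 1 i)) \<le> K * gauss_norm (fps_of_poly P)"
        by (simp add: padic_norm_mult mult.commute)
    qed (use K0 in \<open>simp add: gauss_norm_nonneg\<close>)
    finally show "padic_norm (\<omega> P) \<le> K * gauss_norm (fps_of_poly P)" .
  qed
qed

lemma distr_to_dual_dual: "\<omega> \<in> distributions \<Longrightarrow> distr_to_dual k \<omega> \<in> poly_dual k"
  unfolding poly_dual_def mem_Collect_eq
  by (intro conjI ballI allI impI)
    (simp_all add: distr_to_dual_def poly_space_add poly_space_smult fps_of_poly_add fps_of_poly_smult distr_add distr_scale)

lemma distr_to_dual_equivariant:
  assumes k: "even k" and s: "s \<in> scaled_Sigma0"
  shows "distr_to_dual k (distr_act k \<omega> s) = poly_dual_act k (distr_to_dual k \<omega>) s"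
proof
  fix P
  have "det s \<noteq> 0" using s by (simp add: scaled_Sigma0_def)
  thus "distr_to_dual k (distr_act k \<omega> s) P = poly_dual_act k (distr_to_dual k \<omega>) s P"
    by (simp add: distr_to_dual_def distr_act_def poly_dual_act_def tate_act_poly[OF k s] poly_lact_space[OF k])
qed

section \<open>Spaces of forms\<close>

lemma module_scale_form: "Modules.module (scale_form :: 'a::field \<Rightarrow> ('g \<Rightarrow> 'x \<Rightarrow> 'a) \<Rightarrow> _)"
  by standard (auto simp: scale_form_def fun_eq_iff algebra_simps)

lemma U_eigenspace_subspace:
  fixes V :: "('x \<Rightarrow> 'p::prime_card padic) set"
  assumes V: "0 \<in> V" "\<And>v w. v \<in> V \<Longrightarrow> w \<in> V \<Longrightarrow> v + w \<in> V" "\<And>c v. v \<in> V \<Longrightarrow> (\<lambda>x. c * v x) \<in> V"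
    and act: "\<And>v w s. act (v + w) s = act v s + act w s" "\<And>c v s. act (\<lambda>x. c * v x) s = (\<lambda>x. c * act v s x)"
  shows "module.subspace scale_form (U_eigenspace k act c (aut_forms \<Gamma> V act))"
proof -
  interpret Modules.module "scale_form :: 'p padic \<Rightarrow> ('p padic ^ 2 ^ 2 \<Rightarrow> 'x \<Rightarrow> 'p padic) \<Rightarrow> _" by (rule module_scale_form)
  have act0: "act 0 s = 0" for s using act(2)[of 0 0 s] by (simp add: zero_fun_def)
  show ?thesis
  proof (rule subspaceI)
    show "0 \<in> U_eigenspace k act c (aut_forms \<Gamma> V act)"
      using V(1) by (auto simp: U_eigenspace_def aut_forms_def act0 U_op_def scale_form_def fun_eq_iff)
  next
    fix x y assume xy: "x \<in> U_eigenspace k act c (aut_forms \<Gamma> V act)" "y \<in> U_eigenspace k act c (aut_forms \<Gamma> V act)"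
    have "U_op k act (x + y) = U_op k act x + U_op k act y"
      by (auto simp: U_op_def fun_eq_iff act sum.distrib algebra_simps)
    thus "x + y \<in> U_eigenspace k act c (aut_forms \<Gamma> V act)"
      using xy V(2) by (auto simp: U_eigenspace_def aut_forms_def act scale_form_def fun_eq_iff algebra_simps)
  next
    fix d x assume x: "x \<in> U_eigenspace k act c (aut_forms \<Gamma> V act)"
    have "U_op k act (scale_form d x) = scale_form d (U_op k act x)"
      by (auto simp: U_op_def fun_eq_iff scale_form_def act sum_distrib_left mult.left_commute)
    thus "scale_form d x \<in> U_eigenspace k act c (aut_forms \<Gamma> V act)"
      using x V(3) by (auto simp: U_eigenspace_def aut_forms_def act scale_form_def fun_eq_iff algebra_simps)
  qed
qed

section \<open>Comparison of eigenforms\<close>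

text \<open>Finiteness of the double coset space is the arithmetic input of the comparison.\<close>

locale cocompact_group =
  fixes \<Gamma> :: "('p::prime_card padic ^ 2 ^ 2) set" and k :: nat
  assumes k: "even k"
    and finite_cosets: "\<exists>F. finite F \<and> (\<forall>f\<in>F. invertible f) \<and>
      (\<forall>g. invertible g \<longrightarrow> (\<exists>u \<gamma> f \<sigma>. u \<noteq> 0 \<and> \<gamma> \<in> \<Gamma> \<and> f \<in> F \<and> \<sigma> \<in> Gamma0 \<and> g = mat u ** \<gamma> ** f ** \<sigma>))"
begin

abbreviation p_half :: "'p padic" where "p_half \<equiv> of_nat CARD('p) ^ (k div 2)"

abbreviation rigid where "rigid \<equiv> U_eigenspace k (distr_act k) p_half (rigid_forms k \<Gamma>)"
abbreviation classical where "classical \<equiv> U_eigenspace k (poly_dual_act k) p_half (classical_forms k \<Gamma>)"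

lemma p_half_nz: "p_half \<noteq> 0" using p_nonzero[where 'p='p] by simp

text \<open>A bound on a representative of a double coset holds on the whole double coset, because \<open>\<Gamma>\<^sub>0(p)\<close> does not
  increase norms. The norm \<open>\<nu>\<close> and the action are arbitrary, so as to treat both kinds of forms.\<close>

lemma bounded_on_cosets:
  fixes val :: "'p padic ^ 2 ^ 2 \<Rightarrow> 'x \<Rightarrow> 'p padic" and \<nu> :: "'x \<Rightarrow> real"
  assumes \<nu>: "\<And>x. x \<in> X \<Longrightarrow> \<nu> x \<ge> 0"
    and act: "\<And>\<sigma> x. \<sigma> \<in> Gamma0 \<Longrightarrow> x \<in> X \<Longrightarrow> act \<sigma> x \<in> X \<and> \<nu> (act \<sigma> x) \<le> \<nu> x"
    and ex: "\<And>f. invertible f \<Longrightarrow> \<exists>K\<ge>0. \<forall>x\<in>X. padic_norm (val f x) \<le> K * \<nu> x"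
    and val: "\<And>u \<gamma> f \<sigma> x. u \<noteq> 0 \<Longrightarrow> \<gamma> \<in> \<Gamma> \<Longrightarrow> invertible f \<Longrightarrow> \<sigma> \<in> Gamma0 \<Longrightarrow> x \<in> X \<Longrightarrow>
      val (mat u ** \<gamma> ** f ** \<sigma>) x = val f (act \<sigma> x)"
    and zero: "\<And>g. \<not> invertible g \<Longrightarrow> val g = 0"
  obtains C where "C \<ge> 0" "\<And>g x. x \<in> X \<Longrightarrow> padic_norm (val g x) \<le> C * \<nu> x"
proof -
  obtain F where F: "finite F" "\<And>f. f \<in> F \<Longrightarrow> invertible f"
    and cov: "\<And>g. invertible g \<Longrightarrow> \<exists>u \<gamma> f \<sigma>. u \<noteq> 0 \<and> \<gamma> \<in> \<Gamma> \<and> f \<in> F \<and> \<sigma> \<in> Gamma0 \<and> g = mat u ** \<gamma> ** f ** \<sigma>"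
    using finite_cosets by blast
  have "\<forall>f\<in>F. \<exists>K\<ge>0. \<forall>x\<in>X. padic_norm (val f x) \<le> K * \<nu> x" using F ex by blast
  then obtain K where K: "\<And>f. f \<in> F \<Longrightarrow> K f \<ge> 0 \<and> (\<forall>x\<in>X. padic_norm (val f x) \<le> K f * \<nu> x)" by metis
  have K0: "sum K F \<ge> 0" using K by (intro sum_nonneg) auto
  show thesis
  proof (rule that[OF K0])
    fix g x assume x: "x \<in> X"
    show "padic_norm (val g x) \<le> sum K F * \<nu> x"
    proof (cases "invertible g")
      case True
      then obtain u \<gamma> f \<sigma> where g: "u \<noteq> 0" "\<gamma> \<in> \<Gamma>" "f \<in> F" "\<sigma> \<in> Gamma0" "g = mat u ** \<gamma> ** f ** \<sigma>"
        using cov by blast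
      have "padic_norm (val g x) = padic_norm (val f (act \<sigma> x))"
        unfolding g(5) by (subst val) (use g F(2) x in auto)
      also have "\<dots> \<le> K f * \<nu> (act \<sigma> x)" using K[OF g(3)] act[OF g(4) x] by blast
      also have "\<dots> \<le> sum K F * \<nu> x"
        using K F(1) g(3) act[OF g(4) x] \<nu> by (intro mult_mono K0 member_le_sum) auto
      finally show ?thesis .
    qed (use zero K0 \<nu>[OF x] in simp)
  qed
qed

lemma rigid_value:
  assumes "\<Phi> \<in> rigid_forms k \<Gamma>"
  shows "\<Phi> g \<in> distributions"
  using assms distributions_zero by (cases "invertible g") (auto simp: rigid_forms_def aut_forms_def)

lemma classical_value:
  assumes "\<phi> \<in> classical_forms k \<Gamma>"
  shows "\<phi> g \<in> poly_dual k"
  using assms poly_dual_zero by (cases "invertible g") (auto simp: classical_forms_def aut_forms_def)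

lemma rigid_bounded:
  assumes \<Phi>: "\<Phi> \<in> rigid_forms k \<Gamma>"
  obtains C where "C \<ge> 0" "\<And>g f. f \<in> tate \<Longrightarrow> padic_norm (\<Phi> g f) \<le> C * gauss_norm f"
proof (rule bounded_on_cosets[of tate gauss_norm "tate_act k" \<Phi>])
  show "\<exists>K\<ge>0. \<forall>f\<in>tate. padic_norm (\<Phi> g f) \<le> K * gauss_norm f" for g
    by (rule distributions_bounded[OF rigid_value[OF \<Phi>, of g]]) blast
qed (use \<Phi> in \<open>auto simp: rigid_forms_def aut_forms_def distr_act_def gauss_norm_nonneg Gamma0_act_norm
    tate_act_tate Gamma0_scaled intro: that\<close>)

lemma classical_bounded:
  assumes \<phi>: "\<phi> \<in> classical_forms k \<Gamma>"
  obtains C where "C \<ge> 0" "\<And>g P. P \<in> poly_space k \<Longrightarrow> padic_norm (\<phi> g P) \<le> C * gauss_norm (fps_of_poly P)"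
proof (rule bounded_on_cosets[of "poly_space k" "\<lambda>P. gauss_norm (fps_of_poly P)" "poly_lact k" \<phi>])
  show "\<exists>K\<ge>0. \<forall>P\<in>poly_space k. padic_norm (\<phi> g P) \<le> K * gauss_norm (fps_of_poly P)" for g
    by (rule poly_dual_bounded[OF classical_value[OF \<phi>, of g]]) blast
  fix \<sigma> :: "'p padic ^ 2 ^ 2" and P :: "'p padic poly" assume \<sigma>: "\<sigma> \<in> Gamma0" and P: "P \<in> poly_space k"
  have "det \<sigma> \<noteq> 0" using Gamma0_scaled[OF \<sigma>] by (simp add: scaled_Sigma0_def)
  thus "poly_lact k \<sigma> P \<in> poly_space k \<and> gauss_norm (fps_of_poly (poly_lact k \<sigma> P)) \<le> gauss_norm (fps_of_poly P)"
    using Gamma0_act_norm[OF \<sigma> tate_poly, of k P]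
    by (simp add: poly_lact_space[OF k] tate_act_poly[OF k Gamma0_scaled[OF \<sigma>] P])
qed (use \<phi> in \<open>auto simp: classical_forms_def aut_forms_def poly_dual_act_def gauss_norm_nonneg intro: that\<close>)

lemma U_op_rigid:
  fixes \<Phi> :: "'p padic ^ 2 ^ 2 \<Rightarrow> 'p padic fps \<Rightarrow> 'p padic"
  assumes \<Phi>: "\<And>g. \<Phi> g \<in> distributions" and f: "f \<in> tate"
  shows "U_op k (distr_act k) \<Phi> g f = (\<Sum>j<CARD('p). \<Phi> (g ** alpha j) (affine j f))"
  unfolding U_op_def sum_distrib_left
  by (rule sum.cong) (simp_all add: distr_act_def f tate_act_alpha_inv[OF k, symmetric]
      distr_scale[OF \<Phi> tate_act_tate[OF alpha_inv_scaled f]])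

text \<open>The substitution of \<open>j + px\<close> on \<open>\<P>\<^sub>k\<close>, written as an action.\<close>

definition affine_poly :: "nat \<Rightarrow> 'p padic poly \<Rightarrow> 'p padic poly" where
  "affine_poly j P = Polynomial.smult p_half (poly_lact k (matrix_inv (alpha j)) P)"

lemma fps_affine_poly: "P \<in> poly_space k \<Longrightarrow> fps_of_poly (affine_poly j P) = affine j (fps_of_poly P)"
  by (simp add: affine_poly_def fps_of_poly_smult tate_act_poly[OF k alpha_inv_scaled, symmetric] tate_act_alpha_inv[OF k])

lemma affine_poly_space: "affine_poly j P \<in> poly_space k"
  unfolding affine_poly_def
  by (intro poly_space_smult poly_lact_space[OF k]) (simp add: det_alpha_inv p_nonzero)

lemma U_op_classical:
  assumes \<phi>: "\<And>g. \<phi> g \<in> poly_dual k" and P: "P \<in> poly_space k"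
  shows "U_op k (poly_dual_act k) \<phi> g P = (\<Sum>j<CARD('p). \<phi> (g ** alpha j) (affine_poly j P))"
  unfolding U_op_def sum_distrib_left
proof (rule sum.cong[OF refl])
  fix j
  have "det (matrix_inv (alpha j) :: 'p padic ^ 2 ^ 2) \<noteq> 0" by (simp add: det_alpha_inv p_nonzero)
  from poly_lact_space[OF k this, of P]
  show "p_half * poly_dual_act k (\<phi> (g ** alpha j)) (matrix_inv (alpha j)) P = \<phi> (g ** alpha j) (affine_poly j P)"
    by (simp add: poly_dual_act_def P affine_poly_def poly_dual_smult[OF \<phi>])
qed

lemma rigidD: "\<Phi> \<in> rigid \<Longrightarrow> \<Phi> \<in> rigid_forms k \<Gamma>"
  and classicalD: "\<phi> \<in> classical \<Longrightarrow> \<phi> \<in> classical_forms k \<Gamma>"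
  by (auto simp: U_eigenspace_def)

lemma rigid_eigen:
  assumes "\<Phi> \<in> rigid" "f \<in> tate"
  shows "p_half * \<Phi> g f = (\<Sum>j<CARD('p). \<Phi> (g ** alpha j) (affine j f))"
  using U_op_rigid[of \<Phi> f g] rigid_value[OF rigidD[OF assms(1)]] assms
  by (simp add: U_eigenspace_def scale_form_def)

lemma classical_eigen:
  assumes "\<phi> \<in> classical" "P \<in> poly_space k"
  shows "p_half * \<phi> g P = (\<Sum>j<CARD('p). \<phi> (g ** alpha j) (affine_poly j P))"
  using U_op_classical[of \<phi> P g] classical_value[OF classicalD[OF assms(1)]] assms
  by (simp add: U_eigenspace_def scale_form_def)

subsection \<open>Specialization of eigenforms\<close>

lemma specialization_classical:
  assumes \<Phi>: "\<Phi> \<in> rigid"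
  shows "specialization k \<Phi> \<in> classical"
proof -
  note R = rigidD[OF \<Phi>]
  have "specialization k \<Phi> \<in> classical_forms k \<Gamma>"
    unfolding classical_forms_def aut_forms_def mem_Collect_eq
  proof (intro conjI allI impI)
    show "specialization k \<Phi> g \<in> poly_dual k" for g
      unfolding specialization_def by (rule distr_to_dual_dual[OF rigid_value[OF R]])
    show "specialization k \<Phi> g = 0" if "\<not> invertible g" for g
      using R that by (auto simp: specialization_def rigid_forms_def aut_forms_def distr_to_dual_def)
    fix u :: "'p padic" and \<gamma> g \<sigma> :: "'p padic ^ 2 ^ 2" assume "u \<noteq> 0 \<and> \<gamma> \<in> \<Gamma> \<and> invertible g \<and> \<sigma> \<in> Gamma0"
    thus "specialization k \<Phi> (mat u ** \<gamma> ** g ** \<sigma>) = poly_dual_act k (specialization k \<Phi> g) \<sigma>"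
      using R distr_to_dual_equivariant[OF k Gamma0_scaled, of \<sigma> "\<Phi> g"]
      by (auto simp: specialization_def rigid_forms_def aut_forms_def)
  qed
  moreover have "U_op k (poly_dual_act k) (specialization k \<Phi>) = scale_form p_half (specialization k \<Phi>)"
  proof (intro ext)
    fix g P
    have val: "\<And>g. specialization k \<Phi> g \<in> poly_dual k"
      unfolding specialization_def by (rule distr_to_dual_dual[OF rigid_value[OF R]])
    show "U_op k (poly_dual_act k) (specialization k \<Phi>) g P = scale_form p_half (specialization k \<Phi>) g P"
    proof (cases "P \<in> poly_space k")
      case True
      have "U_op k (poly_dual_act k) (specialization k \<Phi>) g P
        = (\<Sum>j<CARD('p). \<Phi> (g ** alpha j) (affine j (fps_of_poly P)))"
        unfolding U_op_classical[OF val True]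
        by (simp add: specialization_def distr_to_dual_def affine_poly_space fps_affine_poly[OF True])
      also have "\<dots> = p_half * \<Phi> g (fps_of_poly P)" by (rule rigid_eigen[OF \<Phi> tate_poly, symmetric])
      finally show ?thesis using True by (simp add: scale_form_def specialization_def distr_to_dual_def)
    next
      case False
      thus ?thesis by (simp add: U_op_def poly_dual_act_def scale_form_def specialization_def distr_to_dual_def)
    qed
  qed
  ultimately show ?thesis by (simp add: U_eigenspace_def)
qed

subsection \<open>Injectivity\<close>

text \<open>The contraction lemma applies to the difference of two forms as a constant sequence.\<close>

lemma specialization_inj: "inj_on (specialization k) rigid"
proof (rule inj_onI)
  fix \<Phi> \<Psi> assume \<Phi>: "\<Phi> \<in> rigid" and \<Psi>: "\<Psi> \<in> rigid" and eq: "specialization k \<Phi> = specialization k \<Psi>"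
  note d = rigid_value[OF rigidD[OF \<Phi>]] rigid_value[OF rigidD[OF \<Psi>]]
  obtain C where C: "C \<ge> 0" "\<And>g f. f \<in> tate \<Longrightarrow> padic_norm (\<Phi> g f) \<le> C * gauss_norm f"
    by (rule rigid_bounded[OF rigidD[OF \<Phi>]]) blast
  obtain D where D: "D \<ge> 0" "\<And>g f. f \<in> tate \<Longrightarrow> padic_norm (\<Psi> g f) \<le> D * gauss_norm f"
    by (rule rigid_bounded[OF rigidD[OF \<Psi>]]) blast
  have "\<Phi> g f = \<Psi> g f" for g f
  proof (cases "f \<in> tate")
    case f: True
    let ?E = "\<lambda>(n::nat) g f. \<Phi> g f - \<Psi> g f"
    have "padic_norm (?E n g f) \<le> (C + D) * (1 / real CARD('p) ^ Suc (k div 2)) ^ n * gauss_norm f" for n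
    proof (rule U_contraction[OF k, where E = ?E and I = UNIV and \<tau> = "\<lambda>j g. g ** alpha j"])
      show "\<Phi> i (u + v) - \<Psi> i (u + v) = \<Phi> i u - \<Psi> i u + (\<Phi> i v - \<Psi> i v)" if "u \<in> tate" "v \<in> tate" for i u v
        using that by (simp add: distr_add[OF d(1)] distr_add[OF d(2)])
      show "\<Phi> i (fps_of_poly P) - \<Psi> i (fps_of_poly P) = 0" if "P \<in> poly_space k" for i P
        using fun_cong[OF fun_cong[OF eq, of i], of P] that by (simp add: specialization_def distr_to_dual_def)
      show "padic_norm (\<Phi> i u - \<Psi> i u) \<le> (C + D) * gauss_norm u" if u: "u \<in> tate" for i u
      proof (rule padic_norm_diff_le)
        have "C * gauss_norm u \<le> (C + D) * gauss_norm u" "D * gauss_norm u \<le> (C + D) * gauss_norm u"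
          using C(1) D(1) by (intro mult_right_mono gauss_norm_nonneg u; simp)+
        thus "padic_norm (\<Phi> i u) \<le> (C + D) * gauss_norm u" "padic_norm (\<Psi> i u) \<le> (C + D) * gauss_norm u"
          using C(2)[OF u, of i] D(2)[OF u, of i] by linarith+
      qed
      show "p_half * (\<Phi> i u - \<Psi> i u) = (\<Sum>j<CARD('p). \<Phi> (i ** alpha j) (affine j u) - \<Psi> (i ** alpha j) (affine j u))"
        if u: "u \<in> tate" for i u
        by (simp add: right_diff_distrib sum_subtractf rigid_eigen[OF \<Phi> u] rigid_eigen[OF \<Psi> u])
    qed (use C(1) D(1) f in auto)
    from contraction_tendsto_0[of "\<lambda>n. ?E n g f", OF this] show ?thesis
      by (simp add: LIMSEQ_const_iff)
  qed (simp add: distr_outside[OF d(1)] distr_outside[OF d(2)])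
  thus "\<Phi> = \<Psi>" by (intro ext)
qed

subsection \<open>Surjectivity\<close>

text \<open>The iterates of \<open>p\<^sup>-\<^sup>k\<^sup>/\<^sup>2 U\<^sub>p\<close> on the lift by Taylor truncation, which is in general neither equivariant
  nor an eigenvector.\<close>

primrec lift :: "('p padic ^ 2 ^ 2 \<Rightarrow> 'p padic poly \<Rightarrow> 'p padic) \<Rightarrow> nat \<Rightarrow> 'p padic ^ 2 ^ 2 \<Rightarrow> 'p padic fps \<Rightarrow> 'p padic" where
  "lift \<phi> 0 = (\<lambda>g f. \<phi> g (truncate_fps (Suc k) f))"
| "lift \<phi> (Suc n) = (\<lambda>g f. (\<Sum>j<CARD('p). lift \<phi> n (g ** alpha j) (affine j f)) / p_half)"

lemma truncate_add: "truncate_fps n (f + g) = truncate_fps n f + truncate_fps n (g :: 'p padic fps)"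
  by (rule poly_eqI) (simp add: coeff_truncate_fps)

lemma truncate_const_mult: "truncate_fps n (fps_const c * f) = Polynomial.smult c (truncate_fps n (f :: 'p padic fps))"
  by (rule poly_eqI) (simp add: coeff_truncate_fps)

lemma lift_add:
  assumes "\<And>g. \<phi> g \<in> poly_dual k" "f \<in> tate" "h \<in> tate"
  shows "lift \<phi> n g (f + h) = lift \<phi> n g f + lift \<phi> n g h"
  using assms(2,3)
  by (induction n arbitrary: f g h)
    (simp_all add: truncate_add poly_dual_add[OF assms(1)] poly_space_truncate affine_add affine_tate sum.distrib add_divide_distrib)

lemma lift_scale:
  assumes "\<And>g. \<phi> g \<in> poly_dual k" "f \<in> tate"
  shows "lift \<phi> n g (fps_const c * f) = c * lift \<phi> n g f"
  using assms(2)
  by (induction n arbitrary: f g)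
    (simp_all add: truncate_const_mult poly_dual_smult[OF assms(1)] poly_space_truncate affine_const_mult affine_tate sum_distrib_left)

lemma lift_poly:
  assumes \<phi>: "\<phi> \<in> classical" and P: "P \<in> poly_space k"
  shows "lift \<phi> n g (fps_of_poly P) = \<phi> g P"
  using P
proof (induction n arbitrary: g P)
  case 0
  have "truncate_fps (Suc k) (fps_of_poly P) = P"
    using 0 by (intro poly_eqI) (auto simp: coeff_truncate_fps poly_space_def coeff_eq_0)
  thus ?case by simp
next
  case (Suc n)
  thus ?case
    using p_half_nz by (simp add: fps_affine_poly[symmetric] affine_poly_space classical_eigen[OF \<phi>, symmetric])
qed

lemma lift_noninvertible:
  assumes \<phi>: "\<phi> \<in> classical" and g: "\<not> invertible g"
  shows "lift \<phi> n g f = 0"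
  using g
proof (induction n arbitrary: g f)
  case 0
  thus ?case using classicalD[OF \<phi>] by (simp add: classical_forms_def aut_forms_def)
qed (simp add: invertible_alpha)

lemma lift_0_bounded:
  assumes \<phi>: "\<phi> \<in> classical"
  obtains C where "C \<ge> 0" "\<And>g f. f \<in> tate \<Longrightarrow> padic_norm (lift \<phi> 0 g f) \<le> C * gauss_norm f"
proof -
  obtain C where C: "C \<ge> 0" "\<And>g P. P \<in> poly_space k \<Longrightarrow> padic_norm (\<phi> g P) \<le> C * gauss_norm (fps_of_poly P)"
    by (rule classical_bounded[OF classicalD[OF \<phi>]]) blast
  show thesis
  proof (rule that[OF C(1)])
    fix g and f :: "'p padic fps" assume f: "f \<in> tate"
    have "padic_norm (lift \<phi> 0 g f) \<le> C * gauss_norm (fps_cutoff (Suc k) f)"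
      using C(2)[OF poly_space_truncate, of g f] by simp
    also have "gauss_norm (fps_cutoff (Suc k) f) \<le> gauss_norm f"
      by (rule gauss_norm_le) (use coeff_le_gauss_norm[OF f] gauss_norm_nonneg[OF f] in auto)
    finally show "padic_norm (lift \<phi> 0 g f) \<le> C * gauss_norm f" using C(1) by (simp add: mult_left_mono)
  qed
qed

text \<open>All iterates agree with the eigenform \<open>\<phi>\<close> on \<open>\<P>\<^sub>k\<close>, so their differences are contracted.\<close>

lemma lift_difference_bounded:
  assumes \<phi>: "\<phi> \<in> classical"
  obtains C where "C \<ge> 0" "\<And>n g f. f \<in> tate \<Longrightarrow>
    padic_norm (lift \<phi> (Suc n) g f - lift \<phi> n g f) \<le> C * (1 / real CARD('p) ^ Suc (k div 2)) ^ n * gauss_norm f"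
proof -
  obtain C where C: "C \<ge> 0" "\<And>g f. f \<in> tate \<Longrightarrow> padic_norm (lift \<phi> 0 g f) \<le> C * gauss_norm f"
    by (rule lift_0_bounded[OF \<phi>]) blast
  note val = classical_value[OF classicalD[OF \<phi>]]
  let ?q = "real CARD('p) ^ (k div 2)"
  have q: "?q \<ge> 1" using CARD_gt_1_real[where 'p='p] by simp
  show thesis
  proof (rule that)
    show "0 \<le> ?q * C" using C(1) q by simp
    fix n g and f :: "'p padic fps" assume f: "f \<in> tate"
    show "padic_norm (lift \<phi> (Suc n) g f - lift \<phi> n g f) \<le> (?q * C) * (1 / real CARD('p) ^ Suc (k div 2)) ^ n * gauss_norm f"
    proof (rule U_contraction[OF k, where E = "\<lambda>n g f. lift \<phi> (Suc n) g f - lift \<phi> n g f" and I = UNIV and \<tau> = "\<lambda>j g. g ** alpha j"])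
      show "lift \<phi> (Suc n) i (u + v) - lift \<phi> n i (u + v) = lift \<phi> (Suc n) i u - lift \<phi> n i u + (lift \<phi> (Suc n) i v - lift \<phi> n i v)"
        if "u \<in> tate" "v \<in> tate" for n i u v
        unfolding lift_add[OF val that] by simp
      show "lift \<phi> (Suc n) i (fps_of_poly P) - lift \<phi> n i (fps_of_poly P) = 0" if "P \<in> poly_space k" for n i P
        unfolding lift_poly[OF \<phi> that] by simp
      show "padic_norm (lift \<phi> (Suc 0) i u - lift \<phi> 0 i u) \<le> (?q * C) * gauss_norm u" if u: "u \<in> tate" for i u
      proof (rule padic_norm_diff_le)
        have "padic_norm (\<Sum>j<CARD('p). lift \<phi> 0 (i ** alpha j) (affine j u)) \<le> C * gauss_norm u"
        proof (rule padic_norm_sum_le)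
          fix j
          show "padic_norm (lift \<phi> 0 (i ** alpha j) (affine j u)) \<le> C * gauss_norm u"
            using C(2)[OF affine_tate[OF u], of "i ** alpha j" j] mult_left_mono[OF affine_norm[OF u, of j] C(1)] by linarith
        qed (use C(1) gauss_norm_nonneg[OF u] in simp)
        thus "padic_norm (lift \<phi> (Suc 0) i u) \<le> (?q * C) * gauss_norm u"
          using q by (simp add: padic_norm_divide padic_norm_p_power field_simps)
        have "C * gauss_norm u \<le> ?q * (C * gauss_norm u)"
          using q C(1) gauss_norm_nonneg[OF u] mult_right_mono[of 1 ?q "C * gauss_norm u"] by simp
        thus "padic_norm (lift \<phi> 0 i u) \<le> (?q * C) * gauss_norm u" using C(2)[OF u, of i] by (simp add: mult.assoc)
      qed
      show "p_half * (lift \<phi> (Suc (Suc n)) i u - lift \<phi> (Suc n) i u)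
        = (\<Sum>j<CARD('p). lift \<phi> (Suc n) (i ** alpha j) (affine j u) - lift \<phi> n (i ** alpha j) (affine j u))" for n i u
        unfolding lift.simps(2)[of \<phi> "Suc n"] lift.simps(2)[of \<phi> n, THEN fun_cong, THEN fun_cong, of i u]
        using p_half_nz by (simp only: sum_subtractf right_diff_distrib times_divide_eq_right nonzero_mult_div_cancel_left not_False_eq_True)
    qed (use C(1) q f in auto)
  qed
qed

lemma lift_bounded:
  assumes \<phi>: "\<phi> \<in> classical"
  obtains C where "C \<ge> 0" "\<And>n g f. f \<in> tate \<Longrightarrow> padic_norm (lift \<phi> n g f) \<le> C * gauss_norm f"
proof -
  obtain C where C: "C \<ge> 0" "\<And>g f. f \<in> tate \<Longrightarrow> padic_norm (lift \<phi> 0 g f) \<le> C * gauss_norm f"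
    by (rule lift_0_bounded[OF \<phi>]) blast
  obtain D where D: "D \<ge> 0" "\<And>n g f. f \<in> tate \<Longrightarrow>
    padic_norm (lift \<phi> (Suc n) g f - lift \<phi> n g f) \<le> D * (1 / real CARD('p) ^ Suc (k div 2)) ^ n * gauss_norm f"
    by (rule lift_difference_bounded[OF \<phi>]) blast
  show thesis
  proof (rule that)
    show "0 \<le> C + D" using C(1) D(1) by simp
    fix n g and f :: "'p padic fps" assume f: "f \<in> tate"
    note G = gauss_norm_nonneg[OF f]
    show "padic_norm (lift \<phi> n g f) \<le> (C + D) * gauss_norm f"
    proof (induction n)
      case 0
      have "C * gauss_norm f \<le> (C + D) * gauss_norm f" using D(1) G by (intro mult_right_mono) auto
      thus ?case using C(2)[OF f, of g] by linarith
    next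
      case (Suc n)
      have "1 / real CARD('p) ^ Suc (k div 2) \<le> 1" "0 \<le> 1 / real CARD('p) ^ Suc (k div 2)"
        using one_le_power[of "real CARD('p)" "Suc (k div 2)"] CARD_gt_1_real[where 'p='p] by simp_all
      hence "(1 / real CARD('p) ^ Suc (k div 2)) ^ n \<le> 1" by (intro power_le_one)
      hence "D * (1 / real CARD('p) ^ Suc (k div 2)) ^ n * gauss_norm f \<le> D * 1 * gauss_norm f"
        using D(1) G by (intro mult_mono mult_left_mono) auto
      moreover have "D * gauss_norm f \<le> (C + D) * gauss_norm f" using C(1) G by (intro mult_right_mono) auto
      ultimately have "padic_norm (lift \<phi> (Suc n) g f - lift \<phi> n g f) \<le> (C + D) * gauss_norm f"
        using D(2)[OF f, of n g] by linarith
      from padic_norm_add_le[OF this Suc] show ?case by simp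
    qed
  qed
qed

lemma lift_convergent:
  assumes \<phi>: "\<phi> \<in> classical" and f: "f \<in> tate"
  shows "convergent (\<lambda>n. lift \<phi> n g f)"
proof -
  obtain D where D: "D \<ge> 0" "\<And>n g f. f \<in> tate \<Longrightarrow>
    padic_norm (lift \<phi> (Suc n) g f - lift \<phi> n g f) \<le> D * (1 / real CARD('p) ^ Suc (k div 2)) ^ n * gauss_norm f"
    by (rule lift_difference_bounded[OF \<phi>]) blast
  have "(\<lambda>n. lift \<phi> (Suc n) g f - lift \<phi> n g f) \<longlonglongrightarrow> 0"
    by (rule contraction_tendsto_0[OF D(2)[OF f]])
  from summable_LIMSEQ[OF padic_summable[OF this]]
  have "(\<lambda>n. (\<Sum>i<n. lift \<phi> (Suc i) g f - lift \<phi> i g f) + lift \<phi> 0 g f)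
    \<longlonglongrightarrow> (\<Sum>n. lift \<phi> (Suc n) g f - lift \<phi> n g f) + lift \<phi> 0 g f"
    by (intro tendsto_add tendsto_const)
  moreover have "(\<Sum>i<n. lift \<phi> (Suc i) g f - lift \<phi> i g f) + lift \<phi> 0 g f = lift \<phi> n g f" for n
    by (subst sum_lessThan_telescope) simp
  ultimately show ?thesis by (auto simp: convergent_def)
qed

text \<open>The defect at \<open>(g, \<sigma>)\<close> vanishes on \<open>\<P>\<^sub>k\<close>, where the iterates agree with the equivariant \<open>\<phi>\<close>, and one more
  application of \<open>U\<^sub>p\<close> turns it into the defects at the pairs \<open>(g\<alpha>\<^sub>i, \<tau>)\<close> with \<open>\<sigma>\<alpha>\<^sub>j = \<alpha>\<^sub>i\<tau>\<close>. So it is contracted.\<close>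

lemma lift_equivariance_defect:
  assumes \<phi>: "\<phi> \<in> classical" and f: "f \<in> tate"
    and ug: "u \<noteq> 0" "\<gamma> \<in> \<Gamma>" "invertible g" "\<sigma> \<in> Gamma0"
  shows "(\<lambda>n. lift \<phi> n (mat u ** \<gamma> ** g ** \<sigma>) f - lift \<phi> n g (tate_act k \<sigma> f)) \<longlonglongrightarrow> 0"
proof -
  obtain C where C: "C \<ge> 0" "\<And>g f. f \<in> tate \<Longrightarrow> padic_norm (lift \<phi> 0 g f) \<le> C * gauss_norm f"
    by (rule lift_0_bounded[OF \<phi>]) blast
  note val = classical_value[OF classicalD[OF \<phi>]]
  let ?h = "mat u ** \<gamma>"
  let ?E = "\<lambda>n (g, \<sigma>) f. lift \<phi> n (?h ** g ** \<sigma>) f - lift \<phi> n g (tate_act k \<sigma> f)"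
  let ?I = "{(g, \<sigma>). invertible g \<and> \<sigma> \<in> Gamma0} :: (('p padic ^ 2 ^ 2) \<times> ('p padic ^ 2 ^ 2)) set"
  have "padic_norm (?E n (g, \<sigma>) f) \<le> C * (1 / real CARD('p) ^ Suc (k div 2)) ^ n * gauss_norm f" for n
  proof (rule U_contraction[OF k, where E = ?E and I = ?I and \<tau> = "\<lambda>j (g, \<sigma>). (g ** alpha (alpha_perm \<sigma> j), alpha_rest \<sigma> j)"])
    fix n i and f v :: "'p padic fps" assume i: "i \<in> ?I" and f: "f \<in> tate" and v: "v \<in> tate"
    obtain g s where gs: "i = (g, s)" "invertible g" "s \<in> Gamma0" using i by auto
    note sc = Gamma0_scaled[OF gs(3)]
    show "?E n i (f + v) = ?E n i f + ?E n i v"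
      by (simp add: gs(1) lift_add[OF val f v] tate_act_add[OF sc f v] lift_add[OF val tate_act_tate[OF sc f] tate_act_tate[OF sc v]])
  next
    fix n i and P :: "'p padic poly" assume i: "i \<in> ?I" and P: "P \<in> poly_space k"
    obtain g s where gs: "i = (g, s)" "invertible g" "s \<in> Gamma0" using i by auto
    note sc = Gamma0_scaled[OF gs(3)]
    have "det s \<noteq> 0" using sc by (simp add: scaled_Sigma0_def)
    hence "lift \<phi> n g (tate_act k s (fps_of_poly P)) = \<phi> g (poly_lact k s P)"
      unfolding tate_act_poly[OF k sc P] by (intro lift_poly[OF \<phi>] poly_lact_space[OF k])
    also have "\<dots> = \<phi> (?h ** g ** s) P"
      using classicalD[OF \<phi>] ug gs P by (simp add: classical_forms_def aut_forms_def poly_dual_act_def)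
    finally show "?E n i (fps_of_poly P) = 0" by (simp add: gs(1) lift_poly[OF \<phi> P])
  next
    fix i and f :: "'p padic fps" assume i: "i \<in> ?I" and f: "f \<in> tate"
    obtain g s where gs: "i = (g, s)" "invertible g" "s \<in> Gamma0" using i by auto
    have "padic_norm (lift \<phi> 0 g (tate_act k s f)) \<le> C * gauss_norm f"
      using C(2)[OF tate_act_tate[OF Gamma0_scaled[OF gs(3)] f], of g k] mult_left_mono[OF Gamma0_act_norm[OF gs(3) f, of k] C(1)]
      by linarith
    with C(2)[OF f, of "?h ** g ** s"] show "padic_norm (?E 0 i f) \<le> C * gauss_norm f"
      unfolding gs(1) prod.case by (rule padic_norm_diff_le)
  next
    fix i j assume i: "i \<in> ?I" and j: "j < CARD('p)"
    show "(case i of (g, \<sigma>) \<Rightarrow> (g ** alpha (alpha_perm \<sigma> j), alpha_rest \<sigma> j)) \<in> ?I"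
      using i by (auto simp: invertible_alpha alpha_rest_Gamma0)
  next
    fix n i and f :: "'p padic fps" assume i: "i \<in> ?I" and f: "f \<in> tate"
    obtain g s where gs: "i = (g, s)" "invertible g" "s \<in> Gamma0" using i by auto
    let ?F = "\<lambda>j. lift \<phi> n (g ** alpha j) (affine j (tate_act k s f))"
    have "sum ?F {..<CARD('p)} = (\<Sum>j<CARD('p). ?F (alpha_perm s j))"
      by (rule sum.reindex_bij_betw[OF alpha_perm_bij[OF gs(3)], symmetric])
    also have "\<dots> = (\<Sum>j<CARD('p). lift \<phi> n (g ** alpha (alpha_perm s j)) (tate_act k (alpha_rest s j) (affine j f)))"
      by (rule sum.cong) (simp_all add: affine_equivariant[OF k gs(3) alpha_rest_Gamma0[OF gs(3)] alpha_rest f])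
    finally have 1: "p_half * lift \<phi> (Suc n) g (tate_act k s f)
      = (\<Sum>j<CARD('p). lift \<phi> n (g ** alpha (alpha_perm s j)) (tate_act k (alpha_rest s j) (affine j f)))"
      using p_half_nz by simp
    have "p_half * lift \<phi> (Suc n) (?h ** g ** s) f = (\<Sum>j<CARD('p). lift \<phi> n (?h ** g ** s ** alpha j) (affine j f))"
      using p_half_nz by simp
    also have "\<dots> = (\<Sum>j<CARD('p). lift \<phi> n (?h ** (g ** alpha (alpha_perm s j)) ** alpha_rest s j) (affine j f))"
      by (simp only: alpha_rest[of s] matrix_mul_assoc[symmetric])
    finally show "p_half * ?E (Suc n) i f
      = (\<Sum>j<CARD('p). ?E n (case i of (g, \<sigma>) \<Rightarrow> (g ** alpha (alpha_perm \<sigma> j), alpha_rest \<sigma> j)) (affine j f))"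
      using 1 unfolding gs(1) prod.case by (simp only: right_diff_distrib sum_subtractf)
  qed (use C(1) ug f in auto)
  from contraction_tendsto_0[OF this] show ?thesis by simp
qed

lemma specialization_surj:
  assumes \<phi>: "\<phi> \<in> classical"
  shows "\<exists>\<Phi>\<in>rigid. specialization k \<Phi> = \<phi>"
proof -
  note val = classical_value[OF classicalD[OF \<phi>]]
  define \<Phi> where "\<Phi> = (\<lambda>g f. if f \<in> tate then lim (\<lambda>n. lift \<phi> n g f) else 0)"
  have lim: "(\<lambda>n. lift \<phi> n g f) \<longlonglongrightarrow> \<Phi> g f" if "f \<in> tate" for g f
    using lift_convergent[OF \<phi> that, of g] that by (simp add: \<Phi>_def convergent_LIMSEQ_iff)
  obtain C where C: "C \<ge> 0" "\<And>n g f. f \<in> tate \<Longrightarrow> padic_norm (lift \<phi> n g f) \<le> C * gauss_norm f"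
    by (rule lift_bounded[OF \<phi>]) blast
  have dist: "\<Phi> g \<in> distributions" for g
  proof (rule distributionsI[where K = C])
    fix f h :: "'p padic fps" assume fh: "f \<in> tate" "h \<in> tate"
    have "(\<lambda>n. lift \<phi> n g (f + h)) \<longlonglongrightarrow> \<Phi> g f + \<Phi> g h"
      unfolding lift_add[OF val fh] by (intro tendsto_add lim fh)
    from LIMSEQ_unique[OF lim[OF tate_add[OF fh]] this] show "\<Phi> g (f + h) = \<Phi> g f + \<Phi> g h" .
  next
    fix c and f :: "'p padic fps" assume f: "f \<in> tate"
    have "(\<lambda>n. lift \<phi> n g (fps_const c * f)) \<longlonglongrightarrow> c * \<Phi> g f"
      unfolding lift_scale[OF val f] by (intro padic_tendsto_mult_left lim f)
    from LIMSEQ_unique[OF lim[OF tate_const_mult[OF f]] this] show "\<Phi> g (fps_const c * f) = c * \<Phi> g f" .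
    show "padic_norm (\<Phi> g f) \<le> C * gauss_norm f"
      by (rule LIMSEQ_le_const2[OF tendsto_padic_norm[OF lim[OF f]]]) (use C(2)[OF f] in auto)
  qed (simp add: \<Phi>_def)
  have "\<Phi> \<in> rigid_forms k \<Gamma>"
    unfolding rigid_forms_def aut_forms_def mem_Collect_eq
  proof (intro conjI allI impI dist)
    fix g :: "'p padic ^ 2 ^ 2" assume g: "\<not> invertible g"
    show "\<Phi> g = 0" by (simp add: \<Phi>_def lift_noninvertible[OF \<phi> g] fun_eq_iff limI)
  next
    fix u :: "'p padic" and \<gamma> g \<sigma> :: "'p padic ^ 2 ^ 2" assume ug: "u \<noteq> 0 \<and> \<gamma> \<in> \<Gamma> \<and> invertible g \<and> \<sigma> \<in> Gamma0"
    show "\<Phi> (mat u ** \<gamma> ** g ** \<sigma>) = distr_act k (\<Phi> g) \<sigma>"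
    proof
      fix f
      show "\<Phi> (mat u ** \<gamma> ** g ** \<sigma>) f = distr_act k (\<Phi> g) \<sigma> f"
      proof (cases "f \<in> tate")
        case f: True
        let ?g' = "mat u ** \<gamma> ** g ** \<sigma>"
        have af: "tate_act k \<sigma> f \<in> tate" using ug f by (intro tate_act_tate Gamma0_scaled) auto
        have "(\<lambda>n. (lift \<phi> n ?g' f - lift \<phi> n g (tate_act k \<sigma> f)) + lift \<phi> n g (tate_act k \<sigma> f)) \<longlonglongrightarrow> 0 + \<Phi> g (tate_act k \<sigma> f)"
          using ug by (intro tendsto_add lift_equivariance_defect[OF \<phi> f] lim[OF af]) auto
        hence "(\<lambda>n. lift \<phi> n ?g' f) \<longlonglongrightarrow> \<Phi> g (tate_act k \<sigma> f)" by simp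
        from LIMSEQ_unique[OF lim[OF f] this] show ?thesis using f by (simp add: distr_act_def)
      qed (simp add: \<Phi>_def distr_act_def)
    qed
  qed
  moreover have "U_op k (distr_act k) \<Phi> = scale_form p_half \<Phi>"
  proof (intro ext)
    fix g f
    show "U_op k (distr_act k) \<Phi> g f = scale_form p_half \<Phi> g f"
    proof (cases "f \<in> tate")
      case f: True
      have "(\<lambda>n. \<Sum>j<CARD('p). lift \<phi> n (g ** alpha j) (affine j f)) \<longlonglongrightarrow> (\<Sum>j<CARD('p). \<Phi> (g ** alpha j) (affine j f))"
        by (intro tendsto_sum lim affine_tate f)
      moreover have "(\<Sum>j<CARD('p). lift \<phi> n (g ** alpha j) (affine j f)) = p_half * lift \<phi> (Suc n) g f" for n
        using p_half_nz by simp
      moreover have "(\<lambda>n. p_half * lift \<phi> (Suc n) g f) \<longlonglongrightarrow> p_half * \<Phi> g f"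
        by (intro padic_tendsto_mult_left LIMSEQ_Suc lim f)
      ultimately have "(\<Sum>j<CARD('p). \<Phi> (g ** alpha j) (affine j f)) = p_half * \<Phi> g f"
        by (metis (no_types, lifting) LIMSEQ_unique ext)
      thus ?thesis by (simp add: U_op_rigid[OF dist f] scale_form_def)
    qed (simp add: U_op_def distr_act_def scale_form_def \<Phi>_def)
  qed
  ultimately have "\<Phi> \<in> rigid" by (simp add: U_eigenspace_def)
  moreover have "specialization k \<Phi> = \<phi>"
  proof (intro ext)
    fix g P
    show "specialization k \<Phi> g P = \<phi> g P"
    proof (cases "P \<in> poly_space k")
      case True
      have "(\<lambda>n. lift \<phi> n g (fps_of_poly P)) \<longlonglongrightarrow> \<phi> g P" unfolding lift_poly[OF \<phi> True] by (rule tendsto_const)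
      from LIMSEQ_unique[OF lim[OF tate_poly] this] show ?thesis
        using True by (simp add: specialization_def distr_to_dual_def)
    qed (simp add: specialization_def distr_to_dual_def poly_dual_outside[OF val])
  qed
  ultimately show ?thesis by blast
qed

theorem specialization_iso: "is_linear_iso rigid classical (specialization k)"
  unfolding is_linear_iso_def
proof (intro conjI ballI allI)
  show "module.subspace scale_form rigid"
    unfolding rigid_forms_def
    by (rule U_eigenspace_subspace[OF distributions_zero distributions_plus distributions_scale])
      (auto simp: distr_act_def fun_eq_iff)
  show "module.subspace scale_form classical"
    unfolding classical_forms_def
    by (rule U_eigenspace_subspace[OF poly_dual_zero poly_dual_plus poly_dual_scale])
      (auto simp: poly_dual_act_def fun_eq_iff)
  show "bij_betw (specialization k) rigid classical"
    unfolding bij_betw_def using specialization_inj specialization_classical specialization_surj by force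
  show "specialization k (\<Phi> + \<Psi>) = specialization k \<Phi> + specialization k \<Psi>" for \<Phi> \<Psi> :: "'p padic ^ 2 ^ 2 \<Rightarrow> 'p padic fps \<Rightarrow> 'p padic"
    by (auto simp: specialization_def distr_to_dual_def fun_eq_iff)
  show "specialization k (scale_form c \<Phi>) = scale_form c (specialization k \<Phi>)" for c \<Phi>
    by (auto simp: specialization_def distr_to_dual_def scale_form_def fun_eq_iff)
qed

end

section \<open>Eichler orders\<close>

lemma subring_nat_multiple:
  assumes S: "subring S (rat_quat a b)" and x: "x \<in> S"
  shows "[(n::nat)] \<cdot>\<^bsub>rat_quat a b\<^esub> x \<in> S"
proof -
  obtain x0 x1 x2 x3 where X: "x = (x0, x1, x2, x3)" by (cases x)
  have "(of_nat n * x0, of_nat n * x1, of_nat n * x2, of_nat n * x3) \<in> S"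
  proof (induction n)
    case 0
    show ?case using subringE(2)[OF S] by (simp add: quat_alg_simps)
  next
    case (Suc n)
    thus ?case using subringE(7)[OF S x Suc] by (simp add: X quat_alg_simps algebra_simps)
  qed
  thus ?thesis by (simp add: X quat_nsmult)
qed

lemma subring_Int:
  assumes "subring S A" "subring T A"
  shows "subring (S \<inter> T) A"
  unfolding subring_def
  by (intro conjI subgroup.intro submonoid.intro)
    (use subringE[OF assms(1)] subringE[OF assms(2)] in \<open>auto simp: a_inv_def\<close>)

lemma eichler_order_subring_torsion:
  assumes "is_eichler_order (rat_quat a b) n R"
  shows "subring R (rat_quat a b)" "\<exists>m::nat. m > 0 \<and> [m] \<cdot>\<^bsub>rat_quat a b\<^esub> x \<in> R"
proof -
  obtain S T where ST: "is_order (rat_quat a b) S" "is_order (rat_quat a b) T" "R = S \<inter> T"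
    using assms by (auto simp: is_eichler_order_def is_maximal_order_def)
  have S: "subring S (rat_quat a b)" and T: "subring T (rat_quat a b)" using ST by (auto simp: is_order_def)
  show "subring R (rat_quat a b)" unfolding ST(3) by (rule subring_Int[OF S T])
  obtain x0 x1 x2 x3 where X: "x = (x0, x1, x2, x3)" by (cases x)
  have tors: "\<exists>i::nat. i > 0 \<and> [i] \<cdot>\<^bsub>rat_quat a b\<^esub> x \<in> Q" if "is_order (rat_quat a b) Q" for Q
    using that unfolding is_order_def quat_alg_simps(1) by blast
  obtain i :: nat where i: "i > 0" "[i] \<cdot>\<^bsub>rat_quat a b\<^esub> x \<in> S" using tors[OF ST(1)] by blast
  obtain j :: nat where j: "j > 0" "[j] \<cdot>\<^bsub>rat_quat a b\<^esub> x \<in> T" using tors[OF ST(2)] by blast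
  have "[(i * j)] \<cdot>\<^bsub>rat_quat a b\<^esub> x \<in> S"
    using subring_nat_multiple[OF S i(2), of j] by (simp add: X quat_nsmult mult_ac)
  moreover have "[(i * j)] \<cdot>\<^bsub>rat_quat a b\<^esub> x \<in> T"
    using subring_nat_multiple[OF T j(2), of i] by (simp add: X quat_nsmult mult_ac)
  ultimately show "\<exists>m::nat. m > 0 \<and> [m] \<cdot>\<^bsub>rat_quat a b\<^esub> x \<in> R"
    unfolding ST(3) using i(1) j(1) by (intro exI[of _ "i * j"]) simp
qed

lemma order_in_completion:
  assumes "x \<in> R"
  shows "(quat_of_rat x :: 'p padic \<times> 'p padic \<times> 'p padic \<times> 'p::prime_card padic) \<in> padic_completion a b R"
proof -
  have "quat_of_rat x = (1, 0, 0, 0) \<otimes>\<^bsub>padic_quat a b\<^esub> (quat_of_rat x :: 'p padic \<times> 'p padic \<times> 'p padic \<times> 'p padic)"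
    by (cases "quat_of_rat x :: 'p padic \<times> 'p padic \<times> 'p padic \<times> 'p padic") (simp add: quat_alg_simps)
  moreover have "(1 :: 'p padic) \<in> padic_ints" by (simp add: padic_ints_def)
  ultimately have "quat_of_rat x \<in> {(z, 0, 0, 0) \<otimes>\<^bsub>padic_quat a b\<^esub> quat_of_rat r |
      (z :: 'p padic) r. z \<in> padic_ints \<and> r \<in> R}"
    using assms by blast
  thus ?thesis unfolding padic_completion_def by (rule generate.incl)
qed

theorem theorem3p15:
  fixes p k Nplus Nminus :: nat and a b :: rat and R :: "(rat \<times> rat \<times> rat \<times> rat) set"
    and \<iota> :: "'p padic \<times> 'p padic \<times> 'p padic \<times> 'p::prime_card padic \<Rightarrow> 'p padic ^ 2 ^ 2"
  assumes p: "p = CARD('p)"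
    and k: "even k"
    and ab: "a \<noteq> 0" "b \<noteq> 0"
    and definite: "definite_quat a b"
    and disc: "has_discriminant a b Nminus" "coprime Nminus p"
    and level: "Nplus > 0" "coprime Nplus (p * Nminus)"
    and eichler: "is_eichler_order (rat_quat a b) Nplus R"
    and splitting: "is_splitting a b \<iota>" "\<iota> ` padic_completion a b R = mat2_ints"
  shows "is_linear_iso
    (U_eigenspace k (distr_act k) (of_nat p ^ (k div 2)) (rigid_forms k (quat_Gamma a b R \<iota>)))
    (U_eigenspace k (poly_dual_act k) (of_nat p ^ (k div 2)) (classical_forms k (quat_Gamma a b R \<iota>)))
    (specialization k)"
proof -
  interpret definite_arithmetic_group a b \<iota> R
  proof (intro definite_arithmetic_group.intro quat_splitting.intro definite_arithmetic_group_axioms.intro)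
    show "is_splitting a b \<iota>" by (rule splitting(1))
    show "a < 0" by (rule definite_quat_negative(1)[OF definite ab])
    show "b < 0" by (rule definite_quat_negative(2)[OF definite ab])
    show "subring R (rat_quat a b)" by (rule eichler_order_subring_torsion(1)[OF eichler])
    show "\<exists>n::nat. n > 0 \<and> [n] \<cdot>\<^bsub>rat_quat a b\<^esub> x \<in> R" for x
      by (rule eichler_order_subring_torsion(2)[OF eichler])
    show "\<iota> (quat_of_rat x) \<in> mat2_ints" if "x \<in> R" for x
      using order_in_completion[OF that, of a b, where 'p='p] splitting(2) by blast
  qed
  interpret cocompact_group "quat_Gamma a b R \<iota>" k
  proof
    show "even k" by (rule k)
    show "\<exists>F. finite F \<and> (\<forall>f\<in>F. invertible f) \<and> (\<forall>g. invertible g \<longrightarrow>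
      (\<exists>u \<gamma> f \<sigma>. u \<noteq> 0 \<and> \<gamma> \<in> quat_Gamma a b R \<iota> \<and> f \<in> F \<and> \<sigma> \<in> Gamma0 \<and> g = mat u ** \<gamma> ** f ** \<sigma>))"
      by (rule finite_double_cosets) blast
  qed
  show ?thesis unfolding p by (rule specialization_iso)
qed

end
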